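(* Let $M$ be a space-time with a $C^{1,1}$-Lorentzian metric $g$, and let $p\in M$. Then $p$ has a basis of normal neighbourhoods $U$, $\exp_p:\tilde U\to U$ a bi-Lipschitz homeomorphism, such that $$I^+(p,U)=\exp_p(I^+(0)\cap\tilde U),$$ $$J^+(p,U)=\exp_p(J^+(0)\cap\tilde U),$$ $$\partial I^+(p,U)=\partial J^+(p,U)=\exp_p(\partial I^+(0)\cap\tilde U),$$ where $I^+(0)\subseteq T_pM$ is the set of future-directed vectors $v$ with $g_p(v,v)<0$, $J^+(0)\subseteq T_pM$ is the set consisting of $0$ and all future-directed vectors $v$ with $g_p(v,v)\le 0$, and the boundaries of $I^+(p,U)$ and $J^+(p,U)$ are taken relative to $U$. In particular, $I^+(p,U)$ (respectively $J^+(p,U)$) is open (respectively closed) in $U$.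
   Context: $M$ is a smooth manifold; $C^{1,1}$ means continuously differentiable with locally Lipschitz first order derivatives. A space-time is a Lorentzian manifold (signature $(-+\cdots+)$) with a time-orientation determined by a continuous timelike vector field $X$. A nonzero tangent vector $v$ is timelike if $g(v,v)<0$, null if $g(v,v)=0$, causal if $g(v,v)\le0$; a causal vector is future-directed if $g(X,v)<0$. A locally Lipschitz curve $c$ (which is differentiable almost everywhere) is called timelike (causal, null) if $c'(t)$ has the corresponding property whenever it exists; a causal curve is future-directed if $g(X(c(t)),c'(t))<0$ wherever $c'(t)$ exists. For $p\in A\subseteq M$: $I^+(p,A)$ is the set of $q\in A$ such that there is a future-directed timelike (locally Lipschitz) curve in $A$ from $p$ to $q$; $J^+(p,A)$ is the set of $q\in A$ such that there is a future-directed causal (locally Lipschitz) curve in $A$ from $p$ to $q$, together with $p$ itself. $\exp_p$ is the exponential map of $g$ at $p$. A neighbourhood $U$ of $p$ is normal if $\exp_p:\tilde U\to U$ is a bi-Lipschitz homeomorphism for some open $\tilde U\ni0$ in $T_pM$ star-shaped around $0$. *)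

theory Defs
  imports "HOL-Analysis.Analysis"
begin

text \<open>
  Smooth manifolds, and Lorentzian metrics of regularity \<open>C\<^sup>1\<^sup>,\<^sup>1\<close> on them.  The manifold is a
  Hausdorff, second countable type \<open>'m\<close> carrying a smooth atlas (which need not be maximal) with
  values in a Euclidean space \<open>'e\<close>.
\<close>

section \<open>Differentiability classes on open sets\<close>

primrec Ck_on :: "nat \<Rightarrow> 'a::euclidean_space set \<Rightarrow> ('a \<Rightarrow> 'b::euclidean_space) \<Rightarrow> bool" where
  "Ck_on 0 S f \<longleftrightarrow> continuous_on S f"
| "Ck_on (Suc k) S f \<longleftrightarrow> (\<forall>x\<in>S. f differentiable (at x)) \<and>
     (\<forall>v. Ck_on k S (\<lambda>x. frechet_derivative f (at x) v))"

definition smooth_on :: "'a::euclidean_space set \<Rightarrow> ('a \<Rightarrow> 'b::euclidean_space) \<Rightarrow> bool" where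
  "smooth_on S f \<longleftrightarrow> (\<forall>k. Ck_on k S f)"

definition locally_lipschitz_on :: "'a::metric_space set \<Rightarrow> ('a \<Rightarrow> 'b::metric_space) \<Rightarrow> bool" where
  "locally_lipschitz_on S f \<longleftrightarrow> (\<forall>x\<in>S. \<exists>e>0. \<exists>L. lipschitz_on L (S \<inter> ball x e) f)"

text \<open>Continuity of the first derivatives is implied by their local Lipschitz continuity.\<close>

definition C11_on :: "'a::euclidean_space set \<Rightarrow> ('a \<Rightarrow> 'b::euclidean_space) \<Rightarrow> bool" where
  "C11_on S f \<longleftrightarrow> (\<forall>x\<in>S. f differentiable (at x)) \<and>
     (\<forall>v. locally_lipschitz_on S (\<lambda>x. frechet_derivative f (at x) v))"

section \<open>Smooth manifolds and tangent vectors\<close>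

text \<open>A chart is given by its domain and its coordinate map, whose values off the domain are
  irrelevant.\<close>

type_synonym ('m, 'e) chart = "'m set \<times> ('m \<Rightarrow> 'e)"

definition chart_inv :: "('m, 'e) chart \<Rightarrow> 'e \<Rightarrow> 'm" where
  "chart_inv c = inv_into (fst c) (snd c)"

definition is_chart :: "('m::topological_space, 'e::euclidean_space) chart \<Rightarrow> bool" where
  "is_chart c \<longleftrightarrow> open (fst c) \<and> open (snd c ` fst c) \<and>
     homeomorphism (fst c) (snd c ` fst c) (snd c) (chart_inv c)"

definition smooth_atlas :: "('m::topological_space, 'e::euclidean_space) chart set \<Rightarrow> bool" where
  "smooth_atlas A \<longleftrightarrow> (\<forall>c\<in>A. is_chart c) \<and> (\<Union>c\<in>A. fst c) = UNIV \<and>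
     (\<forall>c\<in>A. \<forall>c'\<in>A. smooth_on (snd c ` (fst c \<inter> fst c')) (snd c' \<circ> chart_inv c))"

text \<open>
  A tangent vector at \<open>p\<close> is the family of its coordinate vectors, indexed by the charts around
  \<open>p\<close>; the coordinate vectors are related by the derivatives of the transition maps.  The
  irrelevant indices are sent to \<open>0\<close>.  Linear operations are pointwise, and evaluation at a chart
  around \<open>p\<close> is a linear isomorphism onto \<open>'e\<close>.  The subspace topology that the tangent space
  inherits from the function type (the topology of pointwise convergence) is therefore its usual
  topology as a finite-dimensional vector space.
\<close>

type_synonym ('m, 'e) tvec = "('m, 'e) chart \<Rightarrow> 'e"

definition charts_at :: "('m, 'e) chart set \<Rightarrow> 'm \<Rightarrow> ('m, 'e) chart set" where
  "charts_at A p = {c\<in>A. p \<in> fst c}"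

definition transition_deriv ::
  "('m, 'e::euclidean_space) chart \<Rightarrow> ('m, 'e) chart \<Rightarrow> 'm \<Rightarrow> 'e \<Rightarrow> 'e" where
  "transition_deriv c c' p = frechet_derivative (snd c' \<circ> chart_inv c) (at (snd c p))"

definition tangent_space ::
  "('m, 'e::euclidean_space) chart set \<Rightarrow> 'm \<Rightarrow> ('m, 'e) tvec set" where
  "tangent_space A p =
     {v. (\<forall>c\<in>charts_at A p. \<forall>c'\<in>charts_at A p. v c' = transition_deriv c c' p (v c)) \<and>
         (\<forall>c. c \<notin> charts_at A p \<longrightarrow> v c = 0)}"

text \<open>The tangent vector at \<open>p\<close> with coordinates \<open>e\<close> in the chart \<open>c\<close>.\<close>

definition tvec_of ::
  "('m, 'e::euclidean_space) chart set \<Rightarrow> ('m, 'e) chart \<Rightarrow> 'm \<Rightarrow> 'e \<Rightarrow> ('m, 'e) tvec" where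
  "tvec_of A c p e = (\<lambda>c'. if c' \<in> charts_at A p then transition_deriv c c' p e else 0)"

section \<open>Lorentzian metrics and time-orientations\<close>

type_synonym ('m, 'e) metric = "'m \<Rightarrow> ('m, 'e) tvec \<Rightarrow> ('m, 'e) tvec \<Rightarrow> real"

text \<open>The metric in the chart \<open>c\<close>, as a form on \<open>'e\<close> depending on a point of the image of \<open>c\<close>.\<close>

definition local_metric :: "('m, 'e::euclidean_space) chart set \<Rightarrow> ('m, 'e) metric \<Rightarrow>
    ('m, 'e) chart \<Rightarrow> 'e \<Rightarrow> 'e \<Rightarrow> 'e \<Rightarrow> real" where
  "local_metric A g c x u v =
     g (chart_inv c x) (tvec_of A c (chart_inv c x) u) (tvec_of A c (chart_inv c x) v)"

text \<open>Signature \<open>(- + \<dots> +)\<close> is expressed by an orthonormal family; it is automatically a basis,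
  as its Gram matrix is invertible.\<close>

definition lorentz_form :: "('e::euclidean_space \<Rightarrow> 'e \<Rightarrow> real) \<Rightarrow> bool" where
  "lorentz_form B \<longleftrightarrow> bilinear B \<and> (\<forall>u v. B u v = B v u) \<and>
     (\<exists>b :: 'e \<Rightarrow> 'e. \<exists>i0\<in>Basis. \<forall>i\<in>Basis. \<forall>j\<in>Basis.
        B (b i) (b j) = (if i \<noteq> j then 0 else if i = i0 then - 1 else 1))"

definition C11_lorentz_metric ::
  "('m, 'e::euclidean_space) chart set \<Rightarrow> ('m, 'e) metric \<Rightarrow> bool" where
  "C11_lorentz_metric A g \<longleftrightarrow> (\<forall>c\<in>A.
     (\<forall>x\<in>snd c ` fst c. lorentz_form (local_metric A g c x)) \<and>
     (\<forall>i\<in>Basis. \<forall>j\<in>Basis. C11_on (snd c ` fst c) (\<lambda>x. local_metric A g c x i j)))"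

definition timelike :: "('m, 'e) metric \<Rightarrow> 'm \<Rightarrow> ('m, 'e::zero) tvec \<Rightarrow> bool" where
  "timelike g p v \<longleftrightarrow> v \<noteq> (\<lambda>c. 0) \<and> g p v v < 0"

definition causal :: "('m, 'e) metric \<Rightarrow> 'm \<Rightarrow> ('m, 'e::zero) tvec \<Rightarrow> bool" where
  "causal g p v \<longleftrightarrow> v \<noteq> (\<lambda>c. 0) \<and> g p v v \<le> 0"

definition time_orientation :: "('m::topological_space, 'e::euclidean_space) chart set \<Rightarrow>
    ('m, 'e) metric \<Rightarrow> ('m \<Rightarrow> ('m, 'e) tvec) \<Rightarrow> bool" where
  "time_orientation A g X \<longleftrightarrow>
     (\<forall>p. X p \<in> tangent_space A p \<and> timelike g p (X p)) \<and>
     (\<forall>c\<in>A. continuous_on (fst c) (\<lambda>p. X p c))"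

definition future_directed ::
  "('m, 'e) metric \<Rightarrow> ('m \<Rightarrow> ('m, 'e) tvec) \<Rightarrow> 'm \<Rightarrow> ('m, 'e) tvec \<Rightarrow> bool" where
  "future_directed g X p v \<longleftrightarrow> g p (X p) v < 0"

text \<open>The subsets \<open>I\<^sup>+(0)\<close> and \<open>J\<^sup>+(0)\<close> of the tangent space at \<open>p\<close>.\<close>

definition I_plus_0 :: "('m, 'e::euclidean_space) chart set \<Rightarrow> ('m, 'e) metric \<Rightarrow>
    ('m \<Rightarrow> ('m, 'e) tvec) \<Rightarrow> 'm \<Rightarrow> ('m, 'e) tvec set" where
  "I_plus_0 A g X p = {v\<in>tangent_space A p. timelike g p v \<and> future_directed g X p v}"

definition J_plus_0 :: "('m, 'e::euclidean_space) chart set \<Rightarrow> ('m, 'e) metric \<Rightarrow>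
    ('m \<Rightarrow> ('m, 'e) tvec) \<Rightarrow> 'm \<Rightarrow> ('m, 'e) tvec set" where
  "J_plus_0 A g X p =
     {\<lambda>c. 0} \<union> {v\<in>tangent_space A p. causal g p v \<and> future_directed g X p v}"

section \<open>Curves, chronological and causal futures\<close>

definition locally_lipschitz_curve :: "('m, 'e::euclidean_space) chart set \<Rightarrow> real set \<Rightarrow>
    (real \<Rightarrow> 'm) \<Rightarrow> bool" where
  "locally_lipschitz_curve A S \<gamma> \<longleftrightarrow> (\<forall>t\<in>S. \<forall>c\<in>charts_at A (\<gamma> t). \<exists>e>0. \<exists>L.
     \<gamma> ` (S \<inter> ball t e) \<subseteq> fst c \<and> lipschitz_on L (S \<inter> ball t e) (snd c \<circ> \<gamma>))"

text \<open>Derivatives at end points of intervals are one-sided.  The curve has to be continuous for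
  this notion to be meaningful.\<close>

definition has_velocity :: "('m, 'e::euclidean_space) chart set \<Rightarrow> real set \<Rightarrow>
    (real \<Rightarrow> 'm) \<Rightarrow> ('m, 'e) tvec \<Rightarrow> real \<Rightarrow> bool" where
  "has_velocity A S \<gamma> v t \<longleftrightarrow> v \<in> tangent_space A (\<gamma> t) \<and>
     (\<forall>c\<in>charts_at A (\<gamma> t). ((snd c \<circ> \<gamma>) has_vector_derivative v c) (at t within S))"

definition timelike_curve :: "('m, 'e::euclidean_space) chart set \<Rightarrow> ('m, 'e) metric \<Rightarrow>
    real set \<Rightarrow> (real \<Rightarrow> 'm) \<Rightarrow> bool" where
  "timelike_curve A g S \<gamma> \<longleftrightarrow> locally_lipschitz_curve A S \<gamma> \<and>
     (\<forall>t\<in>S. \<forall>v. has_velocity A S \<gamma> v t \<longrightarrow> timelike g (\<gamma> t) v)"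

definition causal_curve :: "('m, 'e::euclidean_space) chart set \<Rightarrow> ('m, 'e) metric \<Rightarrow>
    real set \<Rightarrow> (real \<Rightarrow> 'm) \<Rightarrow> bool" where
  "causal_curve A g S \<gamma> \<longleftrightarrow> locally_lipschitz_curve A S \<gamma> \<and>
     (\<forall>t\<in>S. \<forall>v. has_velocity A S \<gamma> v t \<longrightarrow> causal g (\<gamma> t) v)"

definition future_directed_curve :: "('m, 'e::euclidean_space) chart set \<Rightarrow> ('m, 'e) metric \<Rightarrow>
    ('m \<Rightarrow> ('m, 'e) tvec) \<Rightarrow> real set \<Rightarrow> (real \<Rightarrow> 'm) \<Rightarrow> bool" where
  "future_directed_curve A g X S \<gamma> \<longleftrightarrow>
     (\<forall>t\<in>S. \<forall>v. has_velocity A S \<gamma> v t \<longrightarrow> future_directed g X (\<gamma> t) v)"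

definition I_plus :: "('m, 'e::euclidean_space) chart set \<Rightarrow> ('m, 'e) metric \<Rightarrow>
    ('m \<Rightarrow> ('m, 'e) tvec) \<Rightarrow> 'm \<Rightarrow> 'm set \<Rightarrow> 'm set" where
  "I_plus A g X p S = {q\<in>S. \<exists>\<gamma> a b. a < b \<and> timelike_curve A g {a..b} \<gamma> \<and>
     future_directed_curve A g X {a..b} \<gamma> \<and> \<gamma> ` {a..b} \<subseteq> S \<and> \<gamma> a = p \<and> \<gamma> b = q}"

definition J_plus :: "('m, 'e::euclidean_space) chart set \<Rightarrow> ('m, 'e) metric \<Rightarrow>
    ('m \<Rightarrow> ('m, 'e) tvec) \<Rightarrow> 'm \<Rightarrow> 'm set \<Rightarrow> 'm set" where
  "J_plus A g X p S = {p} \<union> {q\<in>S. \<exists>\<gamma> a b. a < b \<and> causal_curve A g {a..b} \<gamma> \<and>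
     future_directed_curve A g X {a..b} \<gamma> \<and> \<gamma> ` {a..b} \<subseteq> S \<and> \<gamma> a = p \<and> \<gamma> b = q}"

section \<open>Geodesics and the exponential map\<close>

definition metric_deriv :: "('m, 'e::euclidean_space) chart set \<Rightarrow> ('m, 'e) metric \<Rightarrow>
    ('m, 'e) chart \<Rightarrow> 'e \<Rightarrow> 'e \<Rightarrow> 'e \<Rightarrow> 'e \<Rightarrow> real" where
  "metric_deriv A g c x w u v = frechet_derivative (\<lambda>y. local_metric A g c y u v) (at x) w"

text \<open>
  \<open>christoffel A g c x u v\<close> is the vector with components \<open>\<Gamma>\<^sup>k\<^sub>i\<^sub>j u\<^sup>i v\<^sup>j\<close>; multiplication with the
  inverse of the metric is expressed by solving for the unique \<open>z\<close> with the given lowered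
  components.
\<close>

definition christoffel :: "('m, 'e::euclidean_space) chart set \<Rightarrow> ('m, 'e) metric \<Rightarrow>
    ('m, 'e) chart \<Rightarrow> 'e \<Rightarrow> 'e \<Rightarrow> 'e \<Rightarrow> 'e" where
  "christoffel A g c x u v = (THE z. \<forall>w. local_metric A g c x z w =
     1/2 * (metric_deriv A g c x u v w + metric_deriv A g c x v u w - metric_deriv A g c x w u v))"

definition geodesic_on :: "('m::topological_space, 'e::euclidean_space) chart set \<Rightarrow>
    ('m, 'e) metric \<Rightarrow> real set \<Rightarrow> (real \<Rightarrow> 'm) \<Rightarrow> bool" where
  "geodesic_on A g S \<gamma> \<longleftrightarrow> continuous_on S \<gamma> \<and>
     (\<forall>c\<in>A. \<exists>x'. \<forall>t\<in>S. \<gamma> t \<in> fst c \<longrightarrow>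
        ((snd c \<circ> \<gamma>) has_vector_derivative x' t) (at t within S) \<and>
        (x' has_vector_derivative - christoffel A g c (snd c (\<gamma> t)) (x' t) (x' t)) (at t within S))"

text \<open>The geodesic with initial velocity \<open>v\<close> at \<open>p\<close>, on the unit interval.\<close>

definition geodesic_from :: "('m::topological_space, 'e::euclidean_space) chart set \<Rightarrow>
    ('m, 'e) metric \<Rightarrow> 'm \<Rightarrow> ('m, 'e) tvec \<Rightarrow> (real \<Rightarrow> 'm) \<Rightarrow> bool" where
  "geodesic_from A g p v \<gamma> \<longleftrightarrow>
     geodesic_on A g {0..1} \<gamma> \<and> \<gamma> 0 = p \<and> has_velocity A {0..1} \<gamma> v 0"

definition exp_domain :: "('m::topological_space, 'e::euclidean_space) chart set \<Rightarrow>
    ('m, 'e) metric \<Rightarrow> 'm \<Rightarrow> ('m, 'e) tvec set" where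
  "exp_domain A g p = {v\<in>tangent_space A p. \<exists>\<gamma>. geodesic_from A g p v \<gamma>}"

definition exp_map :: "('m::topological_space, 'e::euclidean_space) chart set \<Rightarrow>
    ('m, 'e) metric \<Rightarrow> 'm \<Rightarrow> ('m, 'e) tvec \<Rightarrow> 'm" where
  "exp_map A g p v = (THE q. \<exists>\<gamma>. geodesic_from A g p v \<gamma> \<and> q = \<gamma> 1)"

section \<open>Normal neighbourhoods\<close>

definition star_shaped_0 :: "('m, 'e::real_vector) tvec set \<Rightarrow> bool" where
  "star_shaped_0 V \<longleftrightarrow> (\<lambda>c. 0) \<in> V \<and> (\<forall>v\<in>V. \<forall>t\<in>{0..1}. (\<lambda>c. t *\<^sub>R v c) \<in> V)"

text \<open>
  Bi-Lipschitz maps from a set of tangent vectors at \<open>p\<close> into the manifold: the image is relatively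
  compact in the domain of a chart around \<open>p\<close>, in whose coordinates there is a two-sided Lipschitz
  estimate on the whole set.  By relative compactness, such an estimate then holds in every chart
  whose domain contains the closure of the image, and also for the distance of every Riemannian
  metric on the manifold.
\<close>

definition bi_lipschitz_into :: "('m::topological_space, 'e::euclidean_space) chart set \<Rightarrow>
    'm \<Rightarrow> ('m, 'e) tvec set \<Rightarrow> (('m, 'e) tvec \<Rightarrow> 'm) \<Rightarrow> bool" where
  "bi_lipschitz_into A p V f \<longleftrightarrow> (\<exists>c\<in>charts_at A p.
     compact (closure (f ` V)) \<and> closure (f ` V) \<subseteq> fst c \<and>
     (\<exists>L>0. \<forall>v\<in>V. \<forall>w\<in>V.
        dist (snd c (f v)) (snd c (f w)) \<le> L * dist (v c) (w c) \<and>
        dist (v c) (w c) \<le> L * dist (snd c (f v)) (snd c (f w))))"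

text \<open>\<open>U\<close> is a normal neighbourhood of \<open>p\<close>, with \<open>V\<close> the corresponding subset of the tangent space.\<close>

definition normal_neighbourhood :: "('m::topological_space, 'e::euclidean_space) chart set \<Rightarrow>
    ('m, 'e) metric \<Rightarrow> 'm \<Rightarrow> ('m, 'e) tvec set \<Rightarrow> 'm set \<Rightarrow> bool" where
  "normal_neighbourhood A g p V U \<longleftrightarrow>
     open U \<and> p \<in> U \<and>
     openin (top_of_set (tangent_space A p)) V \<and> star_shaped_0 V \<and> V \<subseteq> exp_domain A g p \<and>
     (\<exists>h. homeomorphism V U (exp_map A g p) h) \<and> bi_lipschitz_into A p V (exp_map A g p)"

end

theory Submission
  imports Defs
begin

text \<open>
  Everything is done in the coordinates of one chart around \<open>p\<close>, without regularising the metric.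
  Picard iteration on the velocity of a geodesic gives
  \<open>\<bar>u\<^sub>v(t) - u\<^sub>w(t) - (v - w)\<bar> \<le> \<bar>v - w\<bar>/4\<close> for small initial velocities, so that
  \<open>exp\<^sub>p\<close> is a Lipschitz perturbation of the identity and nearby geodesics are \<open>C\<^sup>1\<close>-close.  The first
  variation of the energy then yields the Gauss lemma in the form
  \<open>q(y) - q(x) = 2 g\<^sub>x(P, y - x) + O(\<bar>y - x\<bar>\<^sup>2)\<close>, where \<open>q(exp\<^sub>p v) = g\<^sub>p(v, v)\<close> and \<open>P\<close> is the final
  velocity of the radial geodesic, although \<open>exp\<^sub>p\<close> itself need not be differentiable.

  Let \<open>\<tau>\<close> be a linear time coordinate vanishing at \<open>p\<close>.  Along a future-directed causal curve from
  \<open>p\<close>, where \<open>q > 0\<close>, the vector \<open>P + (q/2a) T\<close> with \<open>a = -g(P, T)\<close> is causal and future-directed;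
  this gives \<open>q' \<le> q \<tau>' (1/\<tau> + C)\<close>, so \<open>q e\<^sup>-\<^sup>C\<^sup>\<tau>/\<tau>\<close> does not increase.  As \<open>q = O(\<tau>\<^sup>2)\<close>, it follows that
  \<open>q \<le> 0\<close>.  For timelike curves \<open>q' = 2 g(P, \<gamma>') < 0\<close> then gives \<open>q < 0\<close>.
\<close>

section \<open>Differentiability of Lipschitz functions on the line\<close>

text \<open>Two obstacles shape the argument. The curves are merely Lipschitz and may have no
  velocity at the start, so one cannot argue that the lift enters the cone because its initial
  direction does. The definitions constrain only velocities that exist; differentiability almost
  everywhere must therefore be supplied, and monotonicity along curves rests on one lemma that
  tolerates a null set. Moreover the lift of a curve may lack a derivative where the curve has one;
  q is still differentiable there, since the error in its Gauss expansion is quadratic in the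
  distance of the lifts.

  The differential inequality alone would allow q to grow linearly in \<tau>; the quadratic
  vanishing of q at p rules this out. The multiple q/2a of T cancels the linear part of the energy
  of the sum: g(P, P) = q and 2 (q/2a) g(P, T) = -q, which leaves a negative multiple of a square.
  The constant C absorbs the variation of the metric and the gap between P and the position vector,
  both of higher order in \<tau> because causal cones stay uniformly away from the hyperplane \<tau>
  = 0.\<close>

lemma dini_mono:
  fixes h :: "real \<Rightarrow> real"
  assumes "continuous_on {a..b} h" "a \<le> b"
    and step: "\<And>x. a \<le> x \<Longrightarrow> x < b \<Longrightarrow> \<exists>y. x < y \<and> y \<le> b \<and> h x \<le> h y"
  shows "h a \<le> h b"
proof -
  \<comment> \<open>The largest point of this compact set is \<open>b\<close>, since at any other
    point the step hypothesis leads further to the right inside it.\<close>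
  let ?S = "{x\<in>{a..b}. h a \<le> h x}"
  have "closedin (top_of_set {a..b}) ?S"
    using continuous_closedin_preimage[OF assms(1) closed_atLeast[of "h a"]]
    by (simp add: vimage_def Int_def)
  then have "compact ?S"
    by (rule closedin_compact[OF compact_Icc])
  moreover have "?S \<noteq> {}" using assms(2) by auto
  ultimately obtain s where s: "s \<in> ?S" "\<And>t. t \<in> ?S \<Longrightarrow> t \<le> s"
    using compact_attains_sup[of ?S] by blast
  have "s = b"
  proof (rule ccontr)
    assume "s \<noteq> b"
    then obtain y where "s < y" "y \<le> b" "h s \<le> h y"
      using step[of s] s(1) by auto
    then have "y \<in> ?S" using s(1) by auto
    with s(2)[of y] \<open>s < y\<close> show False by simp
  qed
  then show ?thesis using s(1) by auto
qed

text \<open>The primitive of the indicator of \<open>K\<close> has slopes between 0 and 1, slope 0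
  in gaps of \<open>K\<close> and slope 1 on intervals inside \<open>K\<close>. It is the comparison
  function of the Dini arguments below, in place of integrating derivatives.\<close>

lemma measure_Int_Icc_diff:
  fixes K :: "real set"
  assumes "K \<in> sets lebesgue" "c \<le> x" "x \<le> y"
  shows "measure lebesgue (K \<inter> {c..x}) \<le> measure lebesgue (K \<inter> {c..y})"
    and "measure lebesgue (K \<inter> {c..y}) \<le> measure lebesgue (K \<inter> {c..x}) + (y - x)"
    and "K \<inter> {x<..y} = {} \<Longrightarrow> measure lebesgue (K \<inter> {c..y}) = measure lebesgue (K \<inter> {c..x})"
    and "{x<..y} \<subseteq> K \<Longrightarrow> measure lebesgue (K \<inter> {c..y}) = measure lebesgue (K \<inter> {c..x}) + (y - x)"
proof -
  have m: "K \<inter> {a..b} \<in> lmeasurable" "K \<inter> {a<..b} \<in> lmeasurable" for a b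
    using assms(1) by (auto intro!: bounded_set_imp_lmeasurable bounded_subset[OF bounded_closed_interval[of a b]])
  have eq: "K \<inter> {c..y} = (K \<inter> {c..x}) \<union> (K \<inter> {x<..y})" using assms by auto
  have *: "measure lebesgue (K \<inter> {c..y}) = measure lebesgue (K \<inter> {c..x}) + measure lebesgue (K \<inter> {x<..y})"
    unfolding eq by (rule measure_Union) (use m m[THEN fmeasurableD2] in \<open>auto simp del: emeasure_completion dest: fmeasurableD\<close>)
  have **: "measure lebesgue (K \<inter> {x<..y}) \<le> measure lebesgue {x<..y}"
    by (rule measure_mono_fmeasurable)
      (use m assms in \<open>auto intro!: bounded_set_imp_lmeasurable bounded_subset[OF bounded_closed_interval[of x y]]\<close>)
  have ***: "measure lebesgue {x<..y} = y - x" using assms by simp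
  show "measure lebesgue (K \<inter> {c..x}) \<le> measure lebesgue (K \<inter> {c..y})" using * by simp
  show "measure lebesgue (K \<inter> {c..y}) \<le> measure lebesgue (K \<inter> {c..x}) + (y - x)"
    using * ** *** by simp
  show "K \<inter> {x<..y} = {} \<Longrightarrow> measure lebesgue (K \<inter> {c..y}) = measure lebesgue (K \<inter> {c..x})"
    using * by simp
  show "{x<..y} \<subseteq> K \<Longrightarrow> measure lebesgue (K \<inter> {c..y}) = measure lebesgue (K \<inter> {c..x}) + (y - x)"
    using * *** by (simp add: Int_absorb1)
qed

lemma continuous_on_measure_Int_Icc:
  fixes K :: "real set"
  assumes "K \<in> sets lebesgue"
  shows "continuous_on {c..d} (\<lambda>x. measure lebesgue (K \<inter> {c..x}))"
proof -
  have "1-lipschitz_on {c..d} (\<lambda>x. measure lebesgue (K \<inter> {c..x}))"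
  proof (rule lipschitz_onI)
    fix x y assume "x \<in> {c..d}" "y \<in> {c..d}"
    then show "dist (measure lebesgue (K \<inter> {c..x})) (measure lebesgue (K \<inter> {c..y})) \<le> 1 * dist x y"
      using measure_Int_Icc_diff(1,2)[OF assms, of c x y] measure_Int_Icc_diff(1,2)[OF assms, of c y x]
      by (cases "x \<le> y") (auto simp: dist_real_def)
  qed simp
  then show ?thesis by (rule lipschitz_on_continuous_on)
qed

text \<open>Points of \<open>K\<close> contribute slope at least \<open>q\<close>, all others slope
  at least \<open>- L\<close>. Once both rates are subtracted, with the measure of \<open>K\<close>
  to the left as the clock of \<open>K\<close>, the remainder satisfies the step hypothesis of
  \<open>dini_mono\<close>.\<close>

lemma lipschitz_increment_ge:
  fixes f :: "real \<Rightarrow> real"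
  assumes L: "L-lipschitz_on UNIV f" and K: "closed K" and q: "- L \<le> q" and "c \<le> d"
    and slope: "\<And>x \<delta>. x \<in> K \<Longrightarrow> 0 < \<delta> \<Longrightarrow> \<exists>h. 0 < h \<and> h < \<delta> \<and> q * h \<le> f (x + h) - f x"
  shows "q * measure lebesgue (K \<inter> {c..d}) - L * ((d - c) - measure lebesgue (K \<inter> {c..d})) \<le> f d - f c"
proof -
  define M where "M x = measure lebesgue (K \<inter> {c..x})" for x
  have KL: "K \<in> sets lebesgue" using K by (simp add: borel_closed)
  \<comment> \<open>On \<open>K\<close> the middle term costs at most \<open>q + L\<close> per unit
    of length and the last one returns \<open>L\<close>; off \<open>K\<close> the middle term is
    locally constant to the right because \<open>K\<close> is closed.\<close>
  define h where "h x = f x - (q + L) * M x + L * (x - c)" for x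
  have "h c \<le> h d"
  proof (rule dini_mono[of c d h])
    show "continuous_on {c..d} h"
      unfolding h_def M_def
      by (intro continuous_intros continuous_on_measure_Int_Icc KL
          continuous_on_subset[OF lipschitz_on_continuous_on[OF L]]) auto
    fix x assume x: "c \<le> x" "x < d"
    show "\<exists>y>x. y \<le> d \<and> h x \<le> h y"
    proof (cases "x \<in> K")
      case True
      then obtain k where k: "0 < k" "k < d - x" "q * k \<le> f (x + k) - f x"
        using slope[of x "d - x"] x by auto
      have "M (x + k) \<le> M x + k"
        using measure_Int_Icc_diff(2)[OF KL, of c x "x + k"] x k by (simp add: M_def)
      then have "(q + L) * M (x + k) \<le> (q + L) * (M x + k)"
        using q by (intro mult_left_mono) auto
      then show ?thesis using k
        by (intro exI[of _ "x + k"]) (auto simp: h_def algebra_simps)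
    next
      case False
      then obtain e where e: "e > 0" "\<And>y. dist y x < e \<Longrightarrow> y \<notin> K"
        using K unfolding closed_def open_dist by (metis ComplD ComplI)
      define k where "k = min (e/2) (d - x)"
      have k: "0 < k" "k \<le> d - x" "k < e" using e x by (auto simp: k_def)
      have "K \<inter> {x<..x+k} = {}"
        using e(2) k by (force simp: dist_real_def)
      then have "M (x + k) = M x"
        using measure_Int_Icc_diff(3)[OF KL, of c x "x + k"] x k by (simp add: M_def)
      moreover have "\<bar>f (x + k) - f x\<bar> \<le> L * k"
        using lipschitz_onD[OF L, of "x + k" x] k by (simp add: dist_real_def)
      ultimately show ?thesis using k
        by (intro exI[of _ "x + k"]) (auto simp: h_def algebra_simps)
    qed
  qed (use assms in auto)
  moreover have "M c = 0"
    using negligible_imp_measure0[OF negligible_subset[OF negligible_sing[of c], of "K \<inter> {c..c}"]]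
    by (auto simp: M_def)
  ultimately show ?thesis by (simp add: h_def M_def algebra_simps)
qed

text \<open>Reflection: the right slopes of the reflected function are the negated left slopes of
  \<open>f\<close>, so the lower estimate applies to it with \<open>- p\<close> for
  \<open>q\<close>.\<close>

lemma lipschitz_increment_le:
  fixes f :: "real \<Rightarrow> real"
  assumes L: "L-lipschitz_on UNIV f" and K: "closed K" and p: "p \<le> L" and "c \<le> d"
    and slope: "\<And>x \<delta>. x \<in> K \<Longrightarrow> 0 < \<delta> \<Longrightarrow> \<exists>h. 0 < h \<and> h < \<delta> \<and> f x - f (x - h) \<le> p * h"
  shows "f d - f c \<le> p * measure lebesgue (K \<inter> {c..d}) + L * ((d - c) - measure lebesgue (K \<inter> {c..d}))"
proof -
  define f' where "f' x = f (- x)" for x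
  have im: "uminus ` K \<inter> {-d..-c} = uminus ` (K \<inter> {c..d})"
    by (force simp: image_iff)
  have meas: "measure lebesgue (uminus ` K \<inter> {-d..-c}) = measure lebesgue (K \<inter> {c..d})"
  proof -
    have "uminus ` (K \<inter> {c..d}) = (*\<^sub>R) (-1) ` (K \<inter> {c..d})" by (auto simp: image_iff)
    then show ?thesis unfolding im
      using measure_lebesgue_affine[of "-1" 0 "K \<inter> {c..d}"] by simp
  qed
  have "(- p) * measure lebesgue (uminus ` K \<inter> {-d..-c})
       - L * ((- c - (- d)) - measure lebesgue (uminus ` K \<inter> {-d..-c})) \<le> f' (- c) - f' (- d)"
  proof (rule lipschitz_increment_ge)
    show "L-lipschitz_on UNIV f'"
    proof (rule lipschitz_onI)
      show "dist (f' x) (f' y) \<le> L * dist x y" for x y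
        using lipschitz_onD[OF L, of "-x" "-y"] by (simp add: f'_def dist_real_def abs_minus_commute)
    qed (rule lipschitz_on_nonneg[OF L])
    show "closed (uminus ` K)" using K by (rule closed_negations)
    fix x \<delta> assume "x \<in> uminus ` K" "0 < (\<delta>::real)"
    then obtain h where "0 < h" "h < \<delta>" "f (-x) - f (- x - h) \<le> p * h"
      using slope[of "-x" \<delta>] by auto
    then show "\<exists>h>0. h < \<delta> \<and> - p * h \<le> f' (x + h) - f' x"
      by (intro exI[of _ h]) (auto simp: f'_def)
  qed (use assms in auto)
  then show ?thesis unfolding meas by (simp add: f'_def)
qed

text \<open>A weak form of the density theorem: covering \<open>K\<close> by nonoverlapping
  intervals of total length at most |K| + e gives |K| \<le> \<theta> (|K| + e), which is impossible
  for small e if |K| > 0.\<close>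

lemma null_if_low_density:
  fixes K :: "real set"
  assumes K: "K \<in> lmeasurable" "bounded K" and \<theta>: "0 \<le> \<theta>" "\<theta> < 1"
    and dens: "\<And>c d. c \<le> d \<Longrightarrow> measure lebesgue (K \<inter> {c..d}) \<le> \<theta> * (d - c)"
  shows "measure lebesgue K = 0"
proof (rule ccontr)
  assume "measure lebesgue K \<noteq> 0"
  then have pos: "0 < measure lebesgue K" by (simp add: zero_less_measure_iff)
  obtain a b where ab: "K \<subseteq> cbox a b"
    using bounded_subset_cbox_symmetric[OF K(2)] by metis
  define e where "e = (1 - \<theta>) * measure lebesgue K / 2"
  have e: "e > 0" using \<theta> pos by (simp add: e_def)
  obtain \<D> where \<D>: "countable \<D>" "\<And>J. J \<in> \<D> \<Longrightarrow> J \<subseteq> cbox a b \<and> J \<noteq> {} \<and> (\<exists>c d. J = cbox c d)"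
      "pairwise (\<lambda>A B. interior A \<inter> interior B = {}) \<D>"
      "K \<subseteq> \<Union>\<D>" "\<Union>\<D> \<in> lmeasurable" "measure lebesgue (\<Union>\<D>) \<le> measure lebesgue K + e"
    using measurable_outer_intervals_bounded[OF K(1) ab e] by metis
  have lm: "J \<in> lmeasurable" if "J \<in> \<D>" for J using \<D>(2)[OF that] by auto
  \<comment> \<open>The cover is countable, so the estimate is made for finite subfamilies and then
    passed to the union by \<open>measure_UN_bound\<close>.\<close>
  have fin: "measure lebesgue (\<Union>J\<in>F. K \<inter> J) \<le> \<theta> * measure lebesgue (\<Union>\<D>)"
    if F: "finite F" "F \<subseteq> \<D>" for F
  proof -
    have "measure lebesgue (\<Union>J\<in>F. K \<inter> J) \<le> (\<Sum>J\<in>F. measure lebesgue (K \<inter> J))"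
      by (rule measure_UNION_le) (use F lm K in auto)
    also have "\<dots> \<le> (\<Sum>J\<in>F. \<theta> * measure lebesgue J)"
    proof (rule sum_mono)
      fix J assume "J \<in> F"
      then have "J \<in> \<D>" using F by blast
      then obtain c d where "J = {c..d}" "J \<noteq> {}" using \<D>(2)[of J] by (metis cbox_interval)
      then show "measure lebesgue (K \<inter> J) \<le> \<theta> * measure lebesgue J"
        using dens[of c d] by simp
    qed
    also have "\<dots> = \<theta> * (\<Sum>J\<in>F. measure lebesgue J)" by (simp add: sum_distrib_left)
    also have "(\<Sum>J\<in>F. measure lebesgue J) = measure lebesgue (\<Union>F)"
    proof (rule measure_negligible_finite_Union[symmetric])
      show "pairwise (\<lambda>S T. negligible (S \<inter> T)) F"
      proof (rule pairwiseI)
        fix S T assume ST: "S \<in> F" "T \<in> F" "S \<noteq> T"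
        then have "interior (S \<inter> T) = {}"
          using \<D>(3) F unfolding pairwise_def by (metis interior_Int subsetD)
        moreover obtain c d c' d' where "S = cbox c d" "T = cbox c' d'"
          using \<D>(2)[of S] \<D>(2)[of T] ST F by blast
        then have "convex (S \<inter> T)" by (simp add: convex_Int convex_box)
        ultimately show "negligible (S \<inter> T)"
          by (simp add: negligible_convex_interior)
      qed
    qed (use F lm in auto)
    also have "\<theta> * measure lebesgue (\<Union>F) \<le> \<theta> * measure lebesgue (\<Union>\<D>)"
    proof (intro mult_left_mono measure_mono_fmeasurable)
      show "\<Union>F \<in> sets lebesgue" using F lm by (intro sets.finite_Union) auto
    qed (use F \<theta> \<D>(5) in auto)
    finally show ?thesis .
  qed
  have "measure lebesgue (\<Union>J\<in>\<D>. K \<inter> J) \<le> \<theta> * measure lebesgue (\<Union>\<D>)"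
    by (rule measure_UN_bound[OF \<D>(1)]) (use lm K fin in auto)
  moreover have "(\<Union>J\<in>\<D>. K \<inter> J) = K" using \<D>(4) by auto
  ultimately have "measure lebesgue K \<le> \<theta> * (measure lebesgue K + e)"
    using \<D>(6) mult_left_mono[OF \<D>(6) \<theta>(1)] by simp
  also have "\<dots> \<le> \<theta> * measure lebesgue K + e"
    using \<theta> e mult_right_mono[of \<theta> 1 e] by (simp add: algebra_simps)
  also have "\<dots> < measure lebesgue K"
    using \<theta> pos by (simp add: e_def field_simps)
  finally show False by simp
qed


section \<open>Comparison of Dini derivatives and differentiability almost everywhere\<close>

lemma all_pos_iff_all_inverse:
  "(\<forall>\<delta>>0. \<exists>h. 0 < h \<and> h < \<delta> \<and> P h) \<longleftrightarrow> (\<forall>n. \<exists>h\<in>{0<..<inverse (real (Suc n))}. P h)"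
proof
  assume *: "\<forall>n. \<exists>h\<in>{0<..<inverse (real (Suc n))}. P h"
  show "\<forall>\<delta>>0. \<exists>h. 0 < h \<and> h < \<delta> \<and> P h"
  proof (intro allI impI)
    fix \<delta> :: real assume "\<delta> > 0"
    then obtain n where n: "inverse (real (Suc n)) < \<delta>" using reals_Archimedean by blast
    obtain h where "h \<in> {0<..<inverse (real (Suc n))}" "P h" using * by blast
    then show "\<exists>h. 0 < h \<and> h < \<delta> \<and> P h" using n by (intro exI[of _ h]) auto
  qed
next
  assume *: "\<forall>\<delta>>0. \<exists>h. 0 < h \<and> h < \<delta> \<and> P h"
  show "\<forall>n. \<exists>h\<in>{0<..<inverse (real (Suc n))}. P h"
  proof
    fix n
    have "0 < inverse (real (Suc n))" by simp
    then obtain h where "0 < h" "h < inverse (real (Suc n))" "P h" using * by blast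
    then show "\<exists>h\<in>{0<..<inverse (real (Suc n))}. P h" by (intro bexI[of _ h]) auto
  qed
qed

text \<open>On a closed bounded subset \<open>K\<close>, the right slopes above \<open>q\<close> and
  the left slopes below \<open>p\<close> bound the same increments from both sides. This forces the
  density of \<open>K\<close> in every interval to be at most a fixed \<theta> < 1, so
  \<open>K\<close> is null, and inner regularity passes to the whole set.\<close>

lemma null_opposite_slopes:
  fixes f :: "real \<Rightarrow> real"
  assumes L: "L-lipschitz_on UNIV f" and pq: "p < q"
  shows "negligible {x. (\<forall>\<delta>>0. \<exists>h. 0 < h \<and> h < \<delta> \<and> q * h < f (x + h) - f x) \<and>
                        (\<forall>\<delta>>0. \<exists>h. 0 < h \<and> h < \<delta> \<and> f x - f (x - h) < p * h)}"
    (is "negligible ?E")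
proof -
  have contf: "continuous_on UNIV f" by (rule lipschitz_on_continuous_on[OF L])
  have bound: "\<bar>f x - f y\<bar> \<le> L * \<bar>x - y\<bar>" for x y
    using lipschitz_onD[OF L, of x y] by (simp add: dist_real_def)
  \<comment> \<open>Countably many scales suffice, so the set is a countable intersection of open
    sets; the approximation by closed sets from inside requires this measurability.\<close>
  have E_eq: "?E = (\<Inter>n. (\<Union>h\<in>{0<..<inverse (Suc n)}. {x. q * h < f (x + h) - f x}) \<inter>
                     (\<Union>h\<in>{0<..<inverse (Suc n)}. {x. f x - f (x - h) < p * h}))" (is "_ = ?G")
    unfolding all_pos_iff_all_inverse by (auto simp only: set_eq_iff mem_Collect_eq INT_iff Int_iff UN_iff)
  have "open (\<Union>h\<in>{0<..<inverse (real (Suc n))}. {x. q * h < f (x + h) - f x})" for n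
    by (intro open_UN ballI open_Collect_less continuous_intros continuous_on_compose2[OF contf]) auto
  moreover have "open (\<Union>h\<in>{0<..<inverse (real (Suc n))}. {x. f x - f (x - h) < p * h})" for n
    by (intro open_UN ballI open_Collect_less continuous_intros continuous_on_compose2[OF contf]) auto
  ultimately have "?G \<in> sets borel"
    by (intro sets.countable_INT') (auto intro!: borel_open open_Int)
  then have E_meas: "?E \<in> sets lebesgue"
    using E_eq by (simp add: sets_completionI_sets)
  have ineq: "p \<le> L" "- L \<le> q" if "x \<in> ?E" for x
  proof -
    obtain h where "0 < h" "q * h < f (x + h) - f x" using \<open>x \<in> ?E\<close> zero_less_one by blast
    obtain k where "0 < k" "f x - f (x - k) < p * k" using \<open>x \<in> ?E\<close> zero_less_one by blast
    have "- (L * k) \<le> f x - f (x - k)" using bound[of x "x-k"] \<open>0 < k\<close> by (simp add: abs_le_iff)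
    then have "(- L) * k < p * k" using \<open>f x - f (x - k) < p * k\<close> by simp
    then have "- L < p" using \<open>0 < k\<close> mult_less_cancel_right_pos by blast
    have "f (x + h) - f x \<le> L * h" using bound[of "x+h" x] \<open>0 < h\<close> by (simp add: abs_le_iff)
    then have "q * h < L * h" using \<open>q * h < f (x + h) - f x\<close> by simp
    then have "q < L" using \<open>0 < h\<close> mult_less_cancel_right_pos by blast
    show "p \<le> L" "- L \<le> q" using pq \<open>q < L\<close> \<open>- L < p\<close> by auto
  qed
  have null: "measure lebesgue K = 0" if K: "closed K" "bounded K" "K \<subseteq> ?E" for K
  proof (cases "K = {}")
    case False
    then obtain x0 where "x0 \<in> K" by auto
    then have pL: "p \<le> L" "- L \<le> q" using ineq[OF subsetD[OF K(3)]] by auto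
    have up: "\<exists>h. 0 < h \<and> h < \<delta> \<and> q * h \<le> f (x + h) - f x"
      and dn: "\<exists>h. 0 < h \<and> h < \<delta> \<and> f x - f (x - h) \<le> p * h" if "x \<in> K" "0 < \<delta>" for x \<delta>
      using subsetD[OF K(3) that(1), unfolded mem_Collect_eq] that(2) by (meson less_imp_le)+
    have L0: "0 \<le> L" by (rule lipschitz_on_nonneg[OF L])
    \<comment> \<open>For an interval of length l that meets \<open>K\<close> in measure m, the two
      increment bounds give q m - L (l - m) \<le> p m + L (l - m), that is m \<le> \<theta>
      l.\<close>
    define \<theta> where "\<theta> = 2 * L / (q - p + 2 * L)"
    show ?thesis
    proof (rule null_if_low_density)
      show "K \<in> lmeasurable" using K by (simp add: bounded_set_imp_lmeasurable)
      show "0 \<le> \<theta>" "\<theta> < 1" using pq L0 by (auto simp: \<theta>_def)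
      fix c d :: real assume cd: "c \<le> d"
      let ?m = "measure lebesgue (K \<inter> {c..d})"
      have "q * ?m - L * ((d - c) - ?m) \<le> f d - f c"
        by (rule lipschitz_increment_ge[OF L K(1) pL(2) cd]) (use up in auto)
      moreover have "f d - f c \<le> p * ?m + L * ((d - c) - ?m)"
        by (rule lipschitz_increment_le[OF L K(1) pL(1) cd]) (use dn in auto)
      ultimately have "(q - p + 2 * L) * ?m \<le> 2 * L * (d - c)"
        by (simp add: algebra_simps)
      then show "?m \<le> \<theta> * (d - c)"
        using pq L0 by (simp add: \<theta>_def field_simps)
    qed (rule K)
  qed simp
  have "negligible (?E \<inter> cbox a b)" for a b
  proof -
    have S: "?E \<inter> cbox a b \<in> sets lebesgue" using E_meas by auto
    have bS: "bounded (?E \<inter> cbox a b)" by (meson bounded_cbox bounded_subset inf_le2)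
    have lS: "?E \<inter> cbox a b \<in> lmeasurable" using S bS by (simp add: bounded_set_imp_lmeasurable)
    have "measure lebesgue (?E \<inter> cbox a b) \<le> e" if e0: "e > 0" for e
    proof -
      obtain K where K: "closed K" "K \<subseteq> ?E \<inter> cbox a b" "(?E \<inter> cbox a b) - K \<in> lmeasurable"
        "emeasure lebesgue ((?E \<inter> cbox a b) - K) < ennreal e"
        using sets_lebesgue_inner_closed[OF S e0] by blast
      have bK: "bounded K" using K(2) bS bounded_subset by blast
      then have "K \<in> lmeasurable" using K(1) by (simp add: bounded_set_imp_lmeasurable)
      have "measure lebesgue (?E \<inter> cbox a b - K) \<le> e"
        using K(3,4) e0 emeasure_eq_measure2[OF K(3)] by (simp del: emeasure_completion add: ennreal_less_iff)
      moreover have "measure lebesgue K = 0" using null[OF K(1) bK] K(2) by blast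
      moreover have "measure lebesgue (?E \<inter> cbox a b - K) = measure lebesgue (?E \<inter> cbox a b) - measure lebesgue K"
        by (rule measurable_measure_Diff[OF lS fmeasurableD[OF \<open>K \<in> lmeasurable\<close>] K(2)])
      ultimately show ?thesis by simp
    qed
    then have "measure lebesgue (?E \<inter> cbox a b) \<le> 0"
      by (rule field_le_epsilon[of _ 0, simplified])
    then show ?thesis
      using lS by (simp add: negligible_iff_measure order_antisym)
  qed
  then show ?thesis by (subst negligible_on_intervals) auto
qed


text \<open>The four Dini derivatives are compared in the cycle
  upper right, lower left, upper left, lower right.\<close>

lemma real_lipschitz_differentiable_ae:
  fixes f :: "real \<Rightarrow> real"
  assumes L: "L-lipschitz_on UNIV f"
  shows "negligible {x. \<not> f differentiable (at x)}"
proof -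
  define UR where "UR q x \<longleftrightarrow> (\<forall>\<delta>>0. \<exists>h. 0 < h \<and> h < \<delta> \<and> q * h < f (x + h) - f x)" for q x
  define LL where "LL p x \<longleftrightarrow> (\<forall>\<delta>>0. \<exists>h. 0 < h \<and> h < \<delta> \<and> f x - f (x - h) < p * h)" for p x
  define UL where "UL q x \<longleftrightarrow> (\<forall>\<delta>>0. \<exists>h. 0 < h \<and> h < \<delta> \<and> q * h < f x - f (x - h))" for q x
  define LR where "LR p x \<longleftrightarrow> (\<forall>\<delta>>0. \<exists>h. 0 < h \<and> h < \<delta> \<and> f (x + h) - f x < p * h)" for p x
  \<comment> \<open>This reflection keeps the values of slopes and exchanges left and right, so the
    second family of null sets follows from the first.\<close>
  define f' where "f' x = - f (- x)" for x
  have bound: "\<bar>f x - f y\<bar> \<le> L * \<bar>x - y\<bar>" for x y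
    using lipschitz_onD[OF L, of x y] by (simp add: dist_real_def)
  have L': "L-lipschitz_on UNIV f'"
  proof (rule lipschitz_onI)
    show "dist (f' x) (f' y) \<le> L * dist x y" for x y
      using bound[of "-x" "-y"] by (simp add: f'_def dist_real_def abs_minus_commute)
  qed (rule lipschitz_on_nonneg[OF L])
  have n1: "negligible {x. UR q x \<and> LL p x}" if "p < q" for p q
    using null_opposite_slopes[OF L that] by (simp add: UR_def LL_def)
  have n2: "negligible {x. UL q x \<and> LR p x}" if "p < q" for p q
  proof -
    have "{x. UL q x \<and> LR p x} = uminus ` {x. (\<forall>\<delta>>0. \<exists>h. 0 < h \<and> h < \<delta> \<and> q * h < f' (x + h) - f' x) \<and>
                        (\<forall>\<delta>>0. \<exists>h. 0 < h \<and> h < \<delta> \<and> f' x - f' (x - h) < p * h)}" (is "_ = uminus ` ?S")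
    proof (intro set_eqI)
      fix x
      have "x \<in> uminus ` ?S \<longleftrightarrow> - x \<in> ?S" by (metis (no_types, lifting) add.inverse_inverse image_iff)
      moreover have "- x \<in> ?S \<longleftrightarrow> UL q x \<and> LR p x"
        by (simp add: f'_def UL_def LR_def add.commute)
      ultimately show "x \<in> {x. UL q x \<and> LR p x} \<longleftrightarrow> x \<in> uminus ` ?S" by simp
    qed
    moreover have "negligible (uminus ` ?S)"
      by (rule negligible_differentiable_image_negligible[OF order_refl null_opposite_slopes[OF L' that]])
        (intro derivative_intros)
    ultimately show ?thesis by simp
  qed
  let ?N = "\<Union>(p, q)\<in>{(p, q). p \<in> \<rat> \<and> q \<in> \<rat> \<and> p < q}. {x. UR q x \<and> LL p x} \<union> {x. UL q x \<and> LR p x}"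
  have "countable {(p, q). p \<in> \<rat> \<and> q \<in> \<rat> \<and> p < (q::real)}"
    by (rule countable_subset[of _ "\<rat> \<times> \<rat>"]) (auto simp: countable_rat)
  then have "negligible ?N"
    by (intro negligible_countable_Union countable_image) (auto simp: n1 n2)
  moreover have "f differentiable (at x)" if x: "x \<notin> ?N" for x
  proof -
    \<comment> \<open>Only rational pairs enter the null set. Two rationals between \<open>p\<close>
      and \<open>q\<close> suffice, since both slope conditions weaken when the thresholds move
      towards each other.\<close>
    have URLL: "\<not> LL p x" if *: "UR q x" "p < q" for p q
    proof
      assume "LL p x"
      obtain q' where q': "q' \<in> \<rat>" "p < q'" "q' < q" using Rats_dense_in_real[OF *(2)] by blast
      obtain p' where p': "p' \<in> \<rat>" "p < p'" "p' < q'" using Rats_dense_in_real[OF q'(2)] by blast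
      have "UR q' x" unfolding UR_def
      proof (intro allI impI)
        fix \<delta> :: real assume "\<delta> > 0"
        then obtain h where h: "0 < h" "h < \<delta>" "q * h < f (x + h) - f x" using *(1) unfolding UR_def by blast
        then have "q' * h < f (x + h) - f x" using q'(3) mult_strict_right_mono[OF q'(3) h(1)] by linarith
        with h show "\<exists>h. 0 < h \<and> h < \<delta> \<and> q' * h < f (x + h) - f x" by blast
      qed
      moreover have "LL p' x" unfolding LL_def
      proof (intro allI impI)
        fix \<delta> :: real assume "\<delta> > 0"
        then obtain h where h: "0 < h" "h < \<delta>" "f x - f (x - h) < p * h" using \<open>LL p x\<close> unfolding LL_def by blast
        then have "f x - f (x - h) < p' * h" using mult_strict_right_mono[OF p'(2) h(1)] by linarith
        with h show "\<exists>h. 0 < h \<and> h < \<delta> \<and> f x - f (x - h) < p' * h" by blast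
      qed
      ultimately show False using x q'(1) p'(1,3) by auto
    qed
    have ULLR: "\<not> LR p x" if *: "UL q x" "p < q" for p q
    proof
      assume "LR p x"
      obtain q' where q': "q' \<in> \<rat>" "p < q'" "q' < q" using Rats_dense_in_real[OF *(2)] by blast
      obtain p' where p': "p' \<in> \<rat>" "p < p'" "p' < q'" using Rats_dense_in_real[OF q'(2)] by blast
      have "UL q' x" unfolding UL_def
      proof (intro allI impI)
        fix \<delta> :: real assume "\<delta> > 0"
        then obtain h where h: "0 < h" "h < \<delta>" "q * h < f x - f (x - h)" using *(1) unfolding UL_def by blast
        then have "q' * h < f x - f (x - h)" using q'(3) mult_strict_right_mono[OF q'(3) h(1)] by linarith
        with h show "\<exists>h. 0 < h \<and> h < \<delta> \<and> q' * h < f x - f (x - h)" by blast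
      qed
      moreover have "LR p' x" unfolding LR_def
      proof (intro allI impI)
        fix \<delta> :: real assume "\<delta> > 0"
        then obtain h where h: "0 < h" "h < \<delta>" "f (x + h) - f x < p * h" using \<open>LR p x\<close> unfolding LR_def by blast
        then have "f (x + h) - f x < p' * h" using mult_strict_right_mono[OF p'(2) h(1)] by linarith
        with h show "\<exists>h. 0 < h \<and> h < \<delta> \<and> f (x + h) - f x < p' * h" by blast
      qed
      ultimately show False using x q'(1) p'(1,3) by auto
    qed
    \<comment> \<open>The upper right Dini derivative at \<open>x\<close>, which turns out to be the
      derivative.\<close>
    define D where "D = Sup {q. UR q x}"
    have L0: "0 \<le> L" by (rule lipschitz_on_nonneg[OF L])
    have ubd: "q \<le> L" if "UR q x" for q
    proof -
      obtain h where h: "0 < h" "q * h < f (x + h) - f x" using \<open>UR q x\<close> zero_less_one unfolding UR_def by blast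
      moreover have "f (x + h) - f x \<le> L * h" using bound[of "x + h" x] h(1) by (simp add: abs_le_iff)
      ultimately have "q * h < L * h" by linarith
      then show ?thesis using h(1) by simp
    qed
    have lbd: "UR (- L - 1) x" unfolding UR_def
    proof (intro allI impI)
      fix \<delta> :: real assume "\<delta> > 0"
      define h where "h = \<delta> / 2"
      have h: "0 < h" "h < \<delta>" using \<open>\<delta> > 0\<close> by (auto simp: h_def)
      have "- (L * h) \<le> f (x + h) - f x" using bound[of "x + h" x] h by (simp add: abs_le_iff)
      moreover have "(- L - 1) * h = - (L * h) - h" by (simp add: algebra_simps)
      ultimately show "\<exists>h. 0 < h \<and> h < \<delta> \<and> (- L - 1) * h < f (x + h) - f x"
        using h by (intro exI[of _ h]) linarith
    qed
    have Dup: "\<not> UR q x" if "q > D" for q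
      using cSup_upper[of q "{q. UR q x}"] ubd that unfolding D_def bdd_above_def by fastforce
    have Dlo: "\<exists>q'>q. UR q' x" if "q < D" for q
      using less_cSupD[of "{q. UR q x}" q] lbd that unfolding D_def by auto
    \<comment> \<open>The supremum \<open>D\<close> bounds right quotients from above; slopes just
      below \<open>D\<close> bound left quotients from below, and these in turn bound right
      quotients from below. A left quotient near \<open>D + e\<close> at arbitrarily small scales
      would force right quotients above \<open>D + e/4\<close>. The losses e/4, e/2, e leave room
      for the strict inequalities.\<close>
    have ev: "\<exists>\<delta>>0. \<forall>h. 0 < h \<and> h < \<delta> \<longrightarrow>
        \<bar>f (x + h) - f x - D * h\<bar> \<le> e * h \<and> \<bar>f x - f (x - h) - D * h\<bar> \<le> e * h" if e: "e > 0" for e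
    proof -
      have "\<not> UR (D + e/4) x" using Dup e by simp
      then obtain d1 where d1: "d1 > 0" "\<And>h. 0 < h \<Longrightarrow> h < d1 \<Longrightarrow> f (x + h) - f x \<le> (D + e/4) * h"
        unfolding UR_def by (metis not_less)
      obtain q where q: "q > D - e/4" "UR q x" using Dlo[of "D - e/4"] e by auto
      have "\<not> LL (D - e/4) x" by (rule URLL[OF q(2,1)])
      then obtain d2 where d2: "d2 > 0" "\<And>h. 0 < h \<Longrightarrow> h < d2 \<Longrightarrow> (D - e/4) * h \<le> f x - f (x - h)"
        unfolding LL_def by (metis not_less)
      have "\<not> UL (D + e) x"
      proof
        assume "UL (D + e) x"
        then have "\<not> LR (D + e/2) x" by (rule ULLR) (use e in simp)
        then obtain d where d: "d > 0" "\<And>h. 0 < h \<Longrightarrow> h < d \<Longrightarrow> (D + e/2) * h \<le> f (x + h) - f x"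
          unfolding LR_def by (metis not_less)
        define h where "h = min d d1 / 2"
        have h: "0 < h" "h < d" "h < d1" using d(1) d1(1) by (auto simp: h_def)
        have "(D + e/2) * h \<le> (D + e/4) * h" using d(2)[OF h(1,2)] d1(2)[OF h(1,3)] by linarith
        then show False using h(1) e by simp
      qed
      then obtain d3 where d3: "d3 > 0" "\<And>h. 0 < h \<Longrightarrow> h < d3 \<Longrightarrow> f x - f (x - h) \<le> (D + e) * h"
        unfolding UL_def by (metis not_less)
      have "UL (D - e/2) x" unfolding UL_def
      proof (intro allI impI)
        fix \<delta> :: real assume "\<delta> > 0"
        define h where "h = min \<delta> d2 / 2"
        have h: "0 < h" "h < \<delta>" "h < d2" using \<open>\<delta> > 0\<close> d2(1) by (auto simp: h_def)
        have "(D - e/2) * h < (D - e/4) * h" using h(1) e by simp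
        then show "\<exists>h. 0 < h \<and> h < \<delta> \<and> (D - e/2) * h < f x - f (x - h)"
          using less_le_trans[OF _ d2(2)[OF h(1,3)]] h by (intro exI[of _ h]) blast
      qed
      then have "\<not> LR (D - e) x" by (rule ULLR) (use e in simp)
      then obtain d4 where d4: "d4 > 0" "\<And>h. 0 < h \<Longrightarrow> h < d4 \<Longrightarrow> (D - e) * h \<le> f (x + h) - f x"
        unfolding LR_def by (metis not_less)
      define \<delta> where "\<delta> = min (min d1 d2) (min d3 d4)"
      have "\<bar>f (x + h) - f x - D * h\<bar> \<le> e * h \<and> \<bar>f x - f (x - h) - D * h\<bar> \<le> e * h" if h: "0 < h" "h < \<delta>" for h
      proof -
        have "h < d1" "h < d2" "h < d3" "h < d4" using h by (auto simp: \<delta>_def)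
        moreover have "e/4 * h \<le> e * h" using e h by simp
        ultimately show ?thesis
          using d1(2)[of h] d2(2)[of h] d3(2)[of h] d4(2)[of h] h by (auto simp: abs_le_iff algebra_simps)
      qed
      moreover have "\<delta> > 0" using d1 d2 d3 d4 by (simp add: \<delta>_def)
      ultimately show ?thesis by blast
    qed
    have "(f has_real_derivative D) (at x)"
      unfolding has_field_derivative_def has_derivative_at_alt
    proof (intro conjI allI impI)
      show "bounded_linear ((*) D)" by (rule bounded_linear_mult_right)
      fix e :: real assume "e > 0"
      then obtain \<delta> where \<delta>: "\<delta> > 0" "\<And>h. 0 < h \<Longrightarrow> h < \<delta> \<Longrightarrow>
        \<bar>f (x + h) - f x - D * h\<bar> \<le> e * h \<and> \<bar>f x - f (x - h) - D * h\<bar> \<le> e * h" using ev by blast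
      show "\<exists>d>0. \<forall>y. norm (y - x) < d \<longrightarrow> norm (f y - f x - D * (y - x)) \<le> e * norm (y - x)"
      proof (intro exI[of _ \<delta>] conjI allI impI \<delta>(1))
        fix y assume y: "norm (y - x) < \<delta>"
        consider "y > x" | "y = x" | "y < x" by linarith
        then show "norm (f y - f x - D * (y - x)) \<le> e * norm (y - x)"
        proof cases
          case 1 then show ?thesis using \<delta>(2)[of "y - x"] y by simp
        next
          case 3
          have eq: "f y - f x - D * (y - x) = - (f x - f y - D * (x - y))" by (simp add: algebra_simps)
          show ?thesis unfolding eq norm_minus_cancel using \<delta>(2)[of "x - y"] y 3 by simp
        qed simp
      qed
    qed
    then show ?thesis using real_differentiable_def by blast
  qed
  ultimately show ?thesis
    by (elim negligible_subset) auto
qed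

lemma lipschitz_curve_vector_derivative_ae:
  fixes f :: "real \<Rightarrow> 'a::euclidean_space"
  assumes L: "L-lipschitz_on {a..b} f" and "a < b"
  obtains N where "negligible N" "\<And>t. a < t \<Longrightarrow> t < b \<Longrightarrow> t \<notin> N \<Longrightarrow> \<exists>v. (f has_vector_derivative v) (at t)"
proof -
  \<comment> \<open>Clamping the parameter extends each component to the whole line with the same
    Lipschitz constant.\<close>
  define g where "g i t = f (max a (min b t)) \<bullet> i" for i t
  have Lg: "L-lipschitz_on UNIV (g i)" if i: "i \<in> Basis" for i
  proof (rule lipschitz_onI)
    fix s t :: real
    let ?s = "max a (min b s)" and ?t = "max a (min b t)"
    have "dist (g i s) (g i t) \<le> norm (f ?s - f ?t)"
      using Basis_le_norm[OF i, of "f ?s - f ?t"] by (simp add: g_def dist_real_def inner_diff_left)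
    also have "\<dots> \<le> L * dist ?s ?t"
      using lipschitz_onD[OF L, of ?s ?t] \<open>a < b\<close> by (auto simp: dist_norm)
    also have "dist ?s ?t \<le> dist s t" by (auto simp: dist_real_def)
    finally show "dist (g i s) (g i t) \<le> L * dist s t"
      using lipschitz_on_nonneg[OF L] by (simp add: mult_left_mono)
  qed (rule lipschitz_on_nonneg[OF L])
  let ?N = "\<Union>i\<in>Basis. {x. \<not> g i differentiable (at x)}"
  show thesis
  proof
    show "negligible ?N"
      by (intro negligible_Union finite_imageI) (auto intro: real_lipschitz_differentiable_ae Lg)
    fix t assume t: "a < t" "t < b" "t \<notin> ?N"
    define v where "v = (\<Sum>i\<in>Basis. deriv (g i) t *\<^sub>R i)"
    have "((\<lambda>t. f t \<bullet> i) has_vector_derivative v \<bullet> i) (at t)" if i: "i \<in> Basis" for i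
    proof -
      have "(g i has_real_derivative deriv (g i) t) (at t)"
        using t(3) i by (simp add: DERIV_deriv_iff_real_differentiable)
      then have "((\<lambda>t. f t \<bullet> i) has_real_derivative deriv (g i) t) (at t)"
      proof (rule has_field_derivative_transform_within_open)
        show "open {a<..<b}" "t \<in> {a<..<b}" using t by auto
      qed (auto simp: g_def)
      then show ?thesis using i
        by (simp add: v_def has_real_derivative_iff_has_vector_derivative)
    qed
    then have "(f has_vector_derivative v) (at t)"
      unfolding has_vector_derivative_def by (subst has_derivative_componentwise_within) auto
    then show "\<exists>v. (f has_vector_derivative v) (at t)" by blast
  qed
qed

text \<open>Takes the place of the fundamental theorem of calculus for Lipschitz functions: an open
  set \<open>U\<close> of small measure covers the null set, and \<open>L\<close> times the measure
  of \<open>U\<close> to the left pays for whatever \<open>f\<close> may gain there.\<close>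

lemma lipschitz_nonincreasing:
  fixes f :: "real \<Rightarrow> real"
  assumes L: "L-lipschitz_on {a..b} f" and "a \<le> b" and N: "negligible N"
    and D: "\<And>t. a < t \<Longrightarrow> t < b \<Longrightarrow> t \<notin> N \<Longrightarrow> \<exists>D\<le>0. (f has_real_derivative D) (at t)"
  shows "f b \<le> f a"
proof (rule field_le_epsilon)
  fix e :: real assume e: "e > 0"
  have L0: "0 \<le> L" by (rule lipschitz_on_nonneg[OF L])
  define \<epsilon> where "\<epsilon> = e / (L + (b - a) + 1)"
  have pos: "L + (b - a) + 1 > 0" using L0 \<open>a \<le> b\<close> by simp
  then have \<epsilon>: "\<epsilon> > 0" using e by (simp add: \<epsilon>_def)
  \<comment> \<open>The left end point joins the null set, as no derivative is assumed
    there.\<close>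
  have N': "insert a N \<in> sets lebesgue" "negligible (insert a N)"
    using N by (auto simp: negligible_imp_sets negligible_insert)
  obtain U where U: "open U" "insert a N \<subseteq> U" "U - insert a N \<in> lmeasurable"
      "emeasure lebesgue (U - insert a N) < ennreal \<epsilon>"
    using sets_lebesgue_outer_open[OF N'(1) \<epsilon>] by blast
  have Us: "U \<in> sets lebesgue" using U(1) by (simp add: borel_open)
  have mU: "measure lebesgue (U \<inter> {a..b}) \<le> \<epsilon>"
  proof -
    have "measure lebesgue (U \<inter> {a..b}) = measure lebesgue ((U \<inter> {a..b}) - insert a N)"
      by (rule measure_Diff_null_set[symmetric])
        (use N'(2) Us in \<open>auto simp: negligible_iff_null_sets\<close>)
    also have "\<dots> \<le> measure lebesgue (U - insert a N)"
    proof (rule measure_mono_fmeasurable[OF _ _ U(3)])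
      show "U \<inter> {a..b} - insert a N \<in> sets lebesgue"
        using Us N'(1) by (intro sets.Diff sets.Int) auto
    qed auto
    also have "\<dots> \<le> \<epsilon>"
      using U(3,4) \<epsilon> emeasure_eq_measure2[OF U(3)] by (simp del: emeasure_completion add: ennreal_less_iff)
    finally show ?thesis .
  qed
  define M where "M t = measure lebesgue (U \<inter> {a..t})" for t
  define h where "h t = L * M t + \<epsilon> * (t - a) - f t" for t
  have "h a \<le> h b"
  proof (rule dini_mono[of a b h])
    show "continuous_on {a..b} h"
      unfolding h_def M_def
      by (intro continuous_intros continuous_on_measure_Int_Icc Us lipschitz_on_continuous_on[OF L])
    fix t assume t: "a \<le> t" "t < b"
    show "\<exists>y>t. y \<le> b \<and> h t \<le> h y"
    proof (cases "t \<in> insert a N")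
      case True
      then have "t \<in> U" using U(2) by blast
      then obtain d where d: "d > 0" "ball t d \<subseteq> U" using U(1) openE by blast
      define k where "k = min (d/2) (b - t)"
      have k: "0 < k" "k \<le> b - t" "k < d" using d t by (auto simp: k_def)
      have "{t<..t+k} \<subseteq> U" using d(2) k by (force simp: ball_def dist_real_def)
      then have "M (t + k) = M t + k"
        using measure_Int_Icc_diff(4)[OF Us, of a t "t + k"] t k by (simp add: M_def)
      moreover have "\<bar>f (t + k) - f t\<bar> \<le> L * k"
        using lipschitz_onD[OF L, of "t + k" t] k t by (simp add: dist_real_def)
      moreover have "0 \<le> \<epsilon> * k" using \<epsilon> k by simp
      ultimately show ?thesis using k
        by (intro exI[of _ "t + k"]) (auto simp: h_def algebra_simps)
    next
      case False
      then have "a < t" "t \<notin> N" using t by auto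
      then obtain D where D0: "D \<le> 0" "(f has_real_derivative D) (at t)" using D t by blast
      then obtain d where d: "d > 0" "\<And>y. norm (y - t) < d \<Longrightarrow> norm (f y - f t - D * (y - t)) \<le> \<epsilon> * norm (y - t)"
        using \<epsilon> unfolding has_field_derivative_def has_derivative_at_alt by blast
      define k where "k = min (d/2) (b - t)"
      have k: "0 < k" "k \<le> b - t" "k < d" using d t by (auto simp: k_def)
      have "f (t + k) - f t \<le> D * k + \<epsilon> * k" using d(2)[of "t + k"] k by simp
      moreover have "D * k \<le> 0" using D0 k by (simp add: mult_nonpos_nonneg)
      moreover have "L * M t \<le> L * M (t + k)"
        using measure_Int_Icc_diff(1)[OF Us, of a t "t + k"] t k L0 by (auto simp: M_def intro!: mult_left_mono)
      ultimately show ?thesis using k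
        by (intro exI[of _ "t + k"]) (auto simp: h_def algebra_simps)
    qed
  qed (rule \<open>a \<le> b\<close>)
  moreover have "0 \<le> M a" by (simp add: M_def)
  ultimately have "f b \<le> f a + L * M b + \<epsilon> * (b - a)" 
    using mult_nonneg_nonneg[OF L0, of "M a"] by (simp add: h_def)
  also have "\<dots> \<le> f a + L * \<epsilon> + \<epsilon> * (b - a)"
    using mU L0 by (simp add: M_def mult_left_mono)
  also have "\<dots> = f a + (L + (b - a)) * \<epsilon>" by (simp add: algebra_simps)
  also have "\<dots> \<le> f a + (L + (b - a) + 1) * \<epsilon>" using \<epsilon> by (simp add: algebra_simps)
  also have "\<dots> = f a + e" using pos by (simp add: \<epsilon>_def)
  finally show "f b \<le> f a + e" .
qed

section \<open>Lorentzian bilinear forms\<close>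

text \<open>In orthonormal components the spatial part of \<open>T\<close> is shorter than its time
  part. Orthogonality and the ordinary Cauchy-Schwarz inequality for spatial parts then make the
  spatial part of \<open>w\<close> longer than its time part.\<close>

lemma lorentz_form_complement_pos:
  fixes B :: "'e::euclidean_space \<Rightarrow> 'e \<Rightarrow> real"
  assumes lf: "lorentz_form B" and T: "B T T < 0" and w: "w \<noteq> 0" "B T w = 0"
  shows "B w w > 0"
proof -
  have bil: "bilinear B" using lf by (simp add: lorentz_form_def)
  obtain b :: "'e \<Rightarrow> 'e" and i0 where i0: "i0 \<in> Basis"
    and b: "\<And>i j. i \<in> Basis \<Longrightarrow> j \<in> Basis \<Longrightarrow> B (b i) (b j) = (if i \<noteq> j then 0 else if i = i0 then - 1 else 1)"
    using lf unfolding lorentz_form_def by blast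
  define \<epsilon> where "\<epsilon> i = (if i = i0 then - 1 else 1 :: real)" for i
  define \<phi> where "\<phi> z = (\<Sum>i\<in>Basis. (z \<bullet> i) *\<^sub>R b i)" for z
  have lin: "linear \<phi>"
    unfolding \<phi>_def by (intro linear_compose_sum ballI linearI) (auto simp: inner_add_left scaleR_add_left)
  have B\<phi>: "B (\<phi> y) (\<phi> z) = (\<Sum>i\<in>Basis. \<epsilon> i * (y \<bullet> i) * (z \<bullet> i))" for y z
  proof -
    have "B (\<phi> y) (\<phi> z) = (\<Sum>(i,j)\<in>Basis\<times>Basis. B ((y \<bullet> i) *\<^sub>R b i) ((z \<bullet> j) *\<^sub>R b j))"
      unfolding \<phi>_def by (rule bilinear_sum[OF bil])
    also have "\<dots> = (\<Sum>i\<in>Basis. \<Sum>j\<in>Basis. B ((y \<bullet> i) *\<^sub>R b i) ((z \<bullet> j) *\<^sub>R b j))"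
      by (simp add: sum.cartesian_product)
    also have "\<dots> = (\<Sum>i\<in>Basis. \<Sum>j\<in>Basis. if j = i then \<epsilon> i * (y \<bullet> i) * (z \<bullet> i) else 0)"
      by (intro sum.cong refl)
        (auto simp: bilinear_lmul[OF bil] bilinear_rmul[OF bil] b \<epsilon>_def)
    also have "\<dots> = (\<Sum>i\<in>Basis. \<epsilon> i * (y \<bullet> i) * (z \<bullet> i))"
      by (intro sum.cong refl) simp
    finally show ?thesis .
  qed
  \<comment> \<open>The orthonormal family is independent, hence a basis, so \<open>T\<close> and
    \<open>w\<close> have components with respect to it.\<close>
  have "inj \<phi>"
    unfolding linear_injective_0[OF lin]
  proof (intro allI impI)
    fix z assume z: "\<phi> z = 0"
    show "z = 0"
    proof (rule euclidean_eqI)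
      fix j :: 'e assume j: "j \<in> Basis"
      have "B (\<phi> z) (\<phi> j) = 0" using z by (simp add: bilinear_lzero[OF bil])
      moreover have "(\<Sum>i\<in>Basis. \<epsilon> i * (z \<bullet> i) * (j \<bullet> i)) = \<epsilon> j * (z \<bullet> j)"
        using j by (simp add: inner_Basis if_distrib[of "(*) _"] cong: if_cong)
      ultimately show "z \<bullet> j = 0 \<bullet> j" using B\<phi>[of z j] by (auto simp: \<epsilon>_def split: if_splits)
    qed
  qed
  then have "surj \<phi>" using linear_injective_imp_surjective[OF lin] by blast
  then obtain t y where t: "T = \<phi> t" and y: "w = \<phi> y" by (metis surjD)
  have split: "(\<Sum>i\<in>Basis. \<epsilon> i * f i) = - f i0 + (\<Sum>i\<in>Basis-{i0}. f i)" for f :: "'e \<Rightarrow> real"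
    using i0 by (subst sum.remove[of _ i0]) (auto simp: \<epsilon>_def intro!: sum.cong)
  define \<alpha> where "\<alpha> = (\<Sum>i\<in>Basis-{i0}. (t \<bullet> i)\<^sup>2)"
  define \<beta> where "\<beta> = (\<Sum>i\<in>Basis-{i0}. (y \<bullet> i)\<^sup>2)"
  define \<gamma> where "\<gamma> = (\<Sum>i\<in>Basis-{i0}. (t \<bullet> i) * (y \<bullet> i))"
  have 1: "\<alpha> < (t \<bullet> i0)\<^sup>2"
    using T unfolding t B\<phi> mult.assoc split by (simp add: \<alpha>_def power2_eq_square)
  have 2: "\<gamma> = (t \<bullet> i0) * (y \<bullet> i0)"
    using w(2) unfolding t y B\<phi> mult.assoc split by (simp add: \<gamma>_def)
  have CS: "\<gamma>\<^sup>2 \<le> \<alpha> * \<beta>"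
    unfolding \<alpha>_def \<beta>_def \<gamma>_def by (rule Cauchy_Schwarz_ineq_sum)
  have "\<alpha> \<ge> 0" "\<beta> \<ge> 0" by (auto simp: \<alpha>_def \<beta>_def intro: sum_nonneg)
  have "(y \<bullet> i0)\<^sup>2 < \<beta>"
  proof (cases "\<beta> = 0")
    case True
    then have "\<gamma> = 0" using CS by simp
    moreover have "t \<bullet> i0 \<noteq> 0" using 1 \<open>\<alpha> \<ge> 0\<close> by auto
    ultimately have "y \<bullet> i0 = 0" using 2 by simp
    moreover have "\<forall>i\<in>Basis-{i0}. y \<bullet> i = 0"
      using True unfolding \<beta>_def by (simp add: sum_nonneg_eq_0_iff)
    ultimately have "y \<bullet> i = 0 \<bullet> i" if "i \<in> Basis" for i using that by (cases "i = i0") auto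
    then have "y = 0" by (rule euclidean_eqI)
    then have "w = 0" using linear_0[OF lin] y by simp
    with w(1) show ?thesis by simp
  next
    case False
    then have "\<beta> > 0" using \<open>\<beta> \<ge> 0\<close> by simp
    then have "(t \<bullet> i0)\<^sup>2 * (y \<bullet> i0)\<^sup>2 < (t \<bullet> i0)\<^sup>2 * \<beta>"
      using CS mult_strict_right_mono[OF 1 \<open>\<beta> > 0\<close>] unfolding 2 power_mult_distrib by linarith
    then show ?thesis by (simp add: mult_less_cancel_left)
  qed
  then show ?thesis
    unfolding y B\<phi> mult.assoc split by (simp add: \<beta>_def power2_eq_square)
qed

text \<open>The multiple of \<open>w\<close> is chosen so that its difference from \<open>u\<close>
  is orthogonal to \<open>T\<close>, hence spacelike or zero; expanding the square of that
  difference isolates \<open>B u w\<close>.\<close>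

lemma timelike_complement_inner:
  fixes B :: "'e::euclidean_space \<Rightarrow> 'e \<Rightarrow> real"
  assumes lf: "lorentz_form B" and T: "B T T < 0"
    and u: "B T u < 0" and w: "B T w < 0" and c: "B u u \<le> 0" "B w w \<le> 0"
  shows "B u w \<le> 0" and "B w w < 0 \<Longrightarrow> B u w < 0"
proof -
  have bil: "bilinear B" and sym: "B x y = B y x" for x y using lf by (auto simp: lorentz_form_def)
  define c where "c = B T u / B T w"
  define z where "z = u - c *\<^sub>R w"
  have "c > 0" using u w by (simp add: c_def zero_less_divide_iff)
  have "B T z = 0"
    using w by (simp add: z_def bilinear_rsub[OF bil] bilinear_rmul[OF bil] c_def)
  then have "B z z \<ge> 0"
    using lorentz_form_complement_pos[OF lf T, of z] by (cases "z = 0") (auto simp: bilinear_lzero[OF bil])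
  moreover have "B z z = B u u - 2 * c * B u w + c * c * B w w"
    by (simp add: z_def bilinear_rsub[OF bil] bilinear_lsub[OF bil] bilinear_rmul[OF bil] bilinear_lmul[OF bil]
        sym[of w u] algebra_simps)
  ultimately have *: "2 * c * B u w \<le> B u u + c * c * B w w" by simp
  have **: "c * c * B w w \<le> 0" using c by (simp add: mult_nonneg_nonpos)
  then have "c * B u w \<le> 0" using * c by linarith
  then show "B u w \<le> 0" using \<open>c > 0\<close> by (simp add: mult_le_0_iff)
  assume "B w w < 0"
  then have "c * c * B w w < 0" using \<open>c > 0\<close> by (simp add: mult_pos_neg)
  then have "c * B u w < 0" using * c by linarith
  then show "B u w < 0" using \<open>c > 0\<close> by (simp add: mult_less_0_iff)
qed

text \<open>Such a vector is orthogonal to the timelike \<open>b i0\<close> and to itself, so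
  positivity on the complement of \<open>b i0\<close> leaves only 0.\<close>

lemma lorentz_form_nondegenerate:
  fixes B :: "'e::euclidean_space \<Rightarrow> 'e \<Rightarrow> real"
  assumes "lorentz_form B" "\<And>w. B z w = 0"
  shows "z = 0"
proof -
  obtain b :: "'e \<Rightarrow> 'e" and i0 where "i0 \<in> Basis" "B (b i0) (b i0) = - 1"
    using assms(1) unfolding lorentz_form_def by metis
  moreover have "B (b i0) z = B z (b i0)"
    using assms(1) unfolding lorentz_form_def by blast
  then have "B (b i0) z = 0" using assms(2) by simp
  ultimately show ?thesis
    using lorentz_form_complement_pos[OF assms(1), of "b i0" z] assms(2)[of z] by fastforce
qed

text \<open>An injective linear map of a finite-dimensional space is onto. This makes the definite
  description in \<open>christoffel\<close> well defined.\<close>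

lemma lorentz_form_riesz:
  fixes B :: "'e::euclidean_space \<Rightarrow> 'e \<Rightarrow> real"
  assumes lf: "lorentz_form B" and lin: "linear l"
  shows "\<exists>!z. \<forall>w. B z w = l w"
proof -
  have bil: "bilinear B" using lf by (simp add: lorentz_form_def)
  define \<phi> where "\<phi> z = (\<Sum>i\<in>Basis. B z i *\<^sub>R i)" for z
  have B: "B z w = \<phi> z \<bullet> w" for z w
  proof -
    have "B z w = B z (\<Sum>i\<in>Basis. (w \<bullet> i) *\<^sub>R i)" by (simp add: euclidean_representation)
    also have "\<dots> = (\<Sum>i\<in>Basis. (w \<bullet> i) * B z i)"
      using bil by (simp add: bilinear_def linear_sum linear_scale)
    also have "\<dots> = \<phi> z \<bullet> w" by (simp add: \<phi>_def inner_sum_left inner_commute[of w] mult.commute)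
    finally show ?thesis .
  qed
  have lin\<phi>: "linear \<phi>"
    unfolding \<phi>_def
    by (intro linear_compose_sum ballI linearI)
      (auto simp: bilinear_ladd[OF bil] bilinear_lmul[OF bil] scaleR_add_left)
  have "inj \<phi>"
    unfolding linear_injective_0[OF lin\<phi>] using lorentz_form_nondegenerate[OF lf] B by simp
  then have "surj \<phi>" using linear_injective_imp_surjective[OF lin\<phi>] by blast
  define L where "L = (\<Sum>i\<in>Basis. l i *\<^sub>R i)"
  obtain z where z: "\<phi> z = L" using \<open>surj \<phi>\<close> by (metis surjD)
  have l: "l w = L \<bullet> w" for w
  proof -
    have "l w = l (\<Sum>i\<in>Basis. (w \<bullet> i) *\<^sub>R i)" by (simp add: euclidean_representation)
    also have "\<dots> = (\<Sum>i\<in>Basis. (w \<bullet> i) * l i)"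
      using lin by (simp add: linear_sum linear_scale)
    also have "\<dots> = L \<bullet> w" by (simp add: L_def inner_sum_left inner_commute[of w] mult.commute)
    finally show ?thesis .
  qed
  show ?thesis
  proof
    show "\<forall>w. B z w = l w" using B l z by simp
    fix z' assume "\<forall>w. B z' w = l w"
    then have "\<And>w. (\<phi> z' - \<phi> z) \<bullet> w = 0" using B l z by (simp add: inner_diff_left)
    then have "\<phi> z' = \<phi> z" by (metis eq_iff_diff_eq_0 inner_eq_zero_iff)
    then show "z' = z" using \<open>inj \<phi>\<close> by (simp add: inj_eq)
  qed
qed

text \<open>Flipping the sign of the timelike direction makes the form positive definite; coercivity
  then follows by compactness of the unit sphere.\<close>

lemma lorentz_form_coercive:
  fixes B :: "'e::euclidean_space \<Rightarrow> 'e \<Rightarrow> real"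
  assumes lf: "lorentz_form B" and T: "B T T < 0"
  obtains m where "m > 0" "\<And>w. m * (norm w)\<^sup>2 \<le> B w w - 2 / B T T * (B T w)\<^sup>2"
proof -
  have bil: "bilinear B" and sym: "B x y = B y x" for x y using lf by (auto simp: lorentz_form_def)
  define N where "N w = B w w - 2 / B T T * (B T w)\<^sup>2" for w
  have pos: "N w > 0" if "w \<noteq> 0" for w
  proof -
    define \<alpha> where "\<alpha> = B T w / B T T"
    define z where "z = w - \<alpha> *\<^sub>R T"
    have w: "w = z + \<alpha> *\<^sub>R T" by (simp add: z_def)
    have Tz: "B T z = 0"
      using T by (simp add: z_def bilinear_rsub[OF bil] bilinear_rmul[OF bil] \<alpha>_def)
    have "B w w = B z z + \<alpha> * \<alpha> * B T T"
      unfolding w using Tz sym[of z T]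
      by (simp add: bilinear_radd[OF bil] bilinear_ladd[OF bil] bilinear_rmul[OF bil] bilinear_lmul[OF bil])
    moreover have "B T w = \<alpha> * B T T" using T by (simp add: \<alpha>_def)
    ultimately have Nw: "N w = B z z - \<alpha>\<^sup>2 * B T T"
      using T by (simp add: N_def power2_eq_square field_simps)
    show ?thesis
    proof (cases "z = 0")
      case True
      then have "\<alpha> \<noteq> 0" using that w by auto
      then have "\<alpha>\<^sup>2 * B T T < 0" using T by (simp add: mult_pos_neg)
      then show ?thesis using Nw True by (simp add: bilinear_lzero[OF bil])
    next
      case False
      have "\<alpha>\<^sup>2 * B T T \<le> 0" using T by (simp add: mult_nonneg_nonpos)
      then show ?thesis using Nw lorentz_form_complement_pos[OF lf T False Tz] by linarith
    qed
  qed
  have bb: "bounded_bilinear B" using bil bilinear_conv_bounded_bilinear by blast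
  have cont: "continuous_on (sphere 0 1) N"
    unfolding N_def by (intro continuous_intros bounded_bilinear.continuous_on[OF bb])
  obtain i :: 'e where "i \<in> Basis" using nonempty_Basis by blast
  then have "sphere (0::'e) 1 \<noteq> {}" by (auto intro!: exI[of _ i])
  then obtain w0 where w0: "w0 \<in> sphere 0 1" "\<And>w. w \<in> sphere 0 1 \<Longrightarrow> N w0 \<le> N w"
    using continuous_attains_inf[OF compact_sphere _ cont] by blast
  show thesis
  proof
    show "N w0 > 0" using w0(1) by (intro pos) auto
    fix w :: 'e
    show "N w0 * (norm w)\<^sup>2 \<le> B w w - 2 / B T T * (B T w)\<^sup>2"
    proof (cases "w = 0")
      case False
      define e where "e = w /\<^sub>R norm w"
      define r where "r = norm w"
      have we: "w = r *\<^sub>R e" using False by (simp add: e_def r_def)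
      have "N (r *\<^sub>R e) = r\<^sup>2 * N e"
        unfolding N_def by (simp add: bilinear_rmul[OF bil] bilinear_lmul[OF bil] power2_eq_square algebra_simps)
      then have "N w = (norm w)\<^sup>2 * N e" by (metis we r_def)
      moreover have "e \<in> sphere 0 1" using False by (simp add: e_def)
      ultimately have "N w0 * (norm w)\<^sup>2 \<le> N w"
        using mult_right_mono[OF w0(2)[of e], of "(norm w)\<^sup>2"] by (simp add: mult.commute)
      then show ?thesis by (simp add: N_def)
    qed (simp add: bilinear_lzero[OF bil] bilinear_rzero[OF bil])
  qed
qed

section \<open>Ordinary differential equations and local sprays\<close>

lemma vector_derivative_bound:
  fixes f :: "real \<Rightarrow> 'a::real_normed_vector"
  assumes "\<And>t. t \<in> {a..b} \<Longrightarrow> (f has_vector_derivative f' t) (at t within {a..b})"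
    and "\<And>t. t \<in> {a..b} \<Longrightarrow> norm (f' t) \<le> B" and "s \<in> {a..b}" "t \<in> {a..b}"
  shows "norm (f t - f s) \<le> B * \<bar>t - s\<bar>"
proof -
  have "norm (f t - f s) \<le> B * norm (t - s)"
  proof (rule differentiable_bound[of "{a..b}" f "\<lambda>t h. h *\<^sub>R f' t"])
    show "onorm (\<lambda>h. h *\<^sub>R f' x) \<le> B" if "x \<in> {a..b}" for x
    proof (rule onorm_le)
      show "norm (h *\<^sub>R f' x) \<le> B * norm h" for h
        using mult_right_mono[OF assms(2)[OF that], of "norm h"] by (simp add: mult.commute)
    qed
  qed (use assms in \<open>auto simp: has_vector_derivative_def\<close>)
  then show ?thesis by simp
qed

text \<open>The local step is left as a hypothesis and the values lie in any Hausdorff space, so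
  that the argument serves both differential equations in a vector space and geodesics that pass
  from chart to chart.\<close>

lemma interval_eq_continuation:
  fixes z1 z2 :: "real \<Rightarrow> 'm::t2_space"
  assumes cont: "continuous_on {a..b} z1" "continuous_on {a..b} z2" and start: "z1 a = z2 a"
    and step: "\<And>T. a \<le> T \<Longrightarrow> T < b \<Longrightarrow> \<forall>s\<in>{a..T}. z1 s = z2 s \<Longrightarrow> \<exists>d>0. \<forall>s\<in>{T..T+d}\<inter>{..b}. z1 s = z2 s"
    and t: "t \<in> {a..b}"
  shows "z1 t = z2 t"
proof -
  define S where "S = {t\<in>{a..b}. \<forall>s\<in>{a..t}. z1 s = z2 s}"
  define T where "T = Sup S"
  have aS: "a \<in> S" using start t by (auto simp: S_def)
  have bdd: "bdd_above S" by (rule bdd_aboveI[of _ b]) (auto simp: S_def)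
  have aT: "a \<le> T" unfolding T_def by (rule cSup_upper[OF aS bdd])
  have Tb: "T \<le> b" unfolding T_def using aS by (intro cSup_least) (auto simp: S_def)
  have before: "z1 s = z2 s" if "a \<le> s" "s < T" for s
    using less_cSupD[of S s] aS that unfolding T_def S_def by force
  have atT: "z1 T = z2 T"
  proof (cases "a = T")
    case False
    then have "a < T" using aT by simp
    have "(z1 \<longlongrightarrow> z1 T) (at_left T)" "(z2 \<longlongrightarrow> z2 T) (at_left T)"
      using continuous_on_Icc_at_leftD[OF continuous_on_subset[OF cont(1)] \<open>a < T\<close>]
        continuous_on_Icc_at_leftD[OF continuous_on_subset[OF cont(2)] \<open>a < T\<close>] Tb by auto
    moreover have "\<forall>\<^sub>F s in at_left T. z1 s = z2 s"
      using before \<open>a < T\<close> by (auto simp: eventually_at_left intro!: exI[of _ a])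
    ultimately show ?thesis
      using tendsto_unique[OF trivial_limit_at_left_real] tendsto_cong[of z1 z2 "at_left T"] by metis
  qed (use start in simp)
  have all: "z1 s = z2 s" if "s \<in> {a..T}" for s
    using that before atT by (cases "s = T") auto
  have "T = b"
  proof (rule ccontr)
    assume "T \<noteq> b"
    then have "T < b" using Tb by simp
    then obtain d where d: "d > 0" "\<forall>s\<in>{T..T+d}\<inter>{..b}. z1 s = z2 s" using step[of T] aT all by blast
    define r where "r = min (T + d) b"
    have r: "r > T" "r \<le> T + d" "r \<le> b" using d(1) \<open>T < b\<close> by (auto simp: r_def)
    have "z1 s = z2 s" if "s \<in> {a..r}" for s
      using that all[of s] d(2) r by (cases "s \<le> T") auto
    then have "r \<in> S" using r aT by (auto simp: S_def)
    then have "r \<le> T" unfolding T_def by (intro cSup_upper bdd)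
    then show False using r by simp
  qed
  then show ?thesis using all t by simp
qed

text \<open>On an interval of length d with L d \<le> 1/2, the maximum of the difference is at most
  half of itself, hence 0. Only the common initial point is known to lie in \<open>Z\<close>, so
  continuity first shortens the interval until both curves stay where \<open>H\<close> is
  Lipschitz.\<close>

lemma ode_unique_step:
  fixes H :: "'a::real_normed_vector \<Rightarrow> 'a"
  assumes H: "locally_lipschitz_on Z H" and Z: "open Z"
    and z1: "\<And>t. t \<in> {T..b} \<Longrightarrow> (z1 has_vector_derivative H (z1 t)) (at t within {T..b})"
    and z2: "\<And>t. t \<in> {T..b} \<Longrightarrow> (z2 has_vector_derivative H (z2 t)) (at t within {T..b})"
    and "T < b" "z1 T = z2 T" "z1 T \<in> Z"
  shows "\<exists>d>0. \<forall>s\<in>{T..T+d}\<inter>{..b}. z1 s = z2 s"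
proof -
  obtain e L where e: "e > 0" and L: "L-lipschitz_on (Z \<inter> ball (z1 T) e) H"
    using H \<open>z1 T \<in> Z\<close> unfolding locally_lipschitz_on_def by blast
  have L0: "0 \<le> L" by (rule lipschitz_on_nonneg[OF L])
  have nb: "open (Z \<inter> ball (z1 T) e)" using Z by auto
  have ev: "\<exists>d>0. \<forall>s\<in>{T..b}. dist s T < d \<longrightarrow> z s \<in> Z \<inter> ball (z1 T) e"
    if "(z has_vector_derivative v) (at T within {T..b})" "z T = z1 T" for z v
  proof -
    have "(z \<longlongrightarrow> z1 T) (at T within {T..b})"
      using has_vector_derivative_continuous[OF that(1)] that(2) by (simp add: continuous_within)
    then have "\<forall>\<^sub>F s in at T within {T..b}. z s \<in> Z \<inter> ball (z1 T) e"
      using nb e \<open>z1 T \<in> Z\<close> by (intro topological_tendstoD) auto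
    then obtain d where "d > 0" "\<forall>s\<in>{T..b}. s \<noteq> T \<and> dist s T < d \<longrightarrow> z s \<in> Z \<inter> ball (z1 T) e"
      unfolding eventually_at by blast
    then show ?thesis using that(2) e \<open>z1 T \<in> Z\<close> by (intro exI[of _ d]) auto
  qed
  have TT: "T \<in> {T..b}" using \<open>T < b\<close> by simp
  obtain d1 where d1: "d1 > 0" "\<forall>s\<in>{T..b}. dist s T < d1 \<longrightarrow> z1 s \<in> Z \<inter> ball (z1 T) e"
    using ev[OF z1[OF TT] refl] by blast
  obtain d2 where d2: "d2 > 0" "\<forall>s\<in>{T..b}. dist s T < d2 \<longrightarrow> z2 s \<in> Z \<inter> ball (z1 T) e"
    using ev[OF z2[OF TT]] \<open>z1 T = z2 T\<close> by auto
  define d where "d = min (min (d1/2) (d2/2)) (min (b - T) (1 / (2 * (L + 1))))"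
  have d: "d > 0" "d < d1" "d < d2" "d \<le> b - T" "d \<le> 1 / (2 * (L + 1))"
    using d1(1) d2(1) \<open>T < b\<close> L0 by (auto simp: d_def)
  have Ld: "L * d \<le> 1/2"
  proof -
    have "L * d \<le> (L + 1) * (1 / (2 * (L + 1)))" using d L0 by (intro mult_mono) auto
    also have "\<dots> = 1/2" using L0 by (simp add: field_simps)
    finally show ?thesis .
  qed
  have sub: "{T..T+d} \<subseteq> {T..b}" using d by auto
  define y where "y s = z1 s - z2 s" for s
  have yd: "(y has_vector_derivative H (z1 t) - H (z2 t)) (at t within {T..T+d})" if "t \<in> {T..T+d}" for t
    unfolding y_def
    by (intro has_vector_derivative_diff has_vector_derivative_within_subset[OF z1 sub]
        has_vector_derivative_within_subset[OF z2 sub]) (use that sub in auto)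
  have "continuous_on {T..T+d} (\<lambda>s. norm (y s))"
    by (intro continuous_on_norm) (metis continuous_on_eq_continuous_within has_vector_derivative_continuous yd)
  then obtain s0 where s0: "s0 \<in> {T..T+d}" "\<And>s. s \<in> {T..T+d} \<Longrightarrow> norm (y s) \<le> norm (y s0)"
    using continuous_attains_sup[of "{T..T+d}" "\<lambda>s. norm (y s)"] d by auto
  have Hb: "norm (H (z1 t) - H (z2 t)) \<le> L * norm (y s0)" if t: "t \<in> {T..T+d}" for t
  proof -
    have "dist t T < d1" "dist t T < d2" "t \<in> {T..b}" using t d by (auto simp: dist_real_def)
    then have "norm (H (z1 t) - H (z2 t)) \<le> L * norm (y t)"
      using lipschitz_onD[OF L, of "z1 t" "z2 t"] d1(2) d2(2) by (simp add: dist_norm y_def)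
    also have "\<dots> \<le> L * norm (y s0)" using s0(2)[OF t] L0 by (rule mult_left_mono)
    finally show ?thesis .
  qed
  have "norm (y s0 - y T) \<le> L * norm (y s0) * \<bar>s0 - T\<bar>"
    by (rule vector_derivative_bound[OF yd Hb]) (use s0 d in auto)
  also have "\<dots> \<le> L * norm (y s0) * d" using s0 L0 by (intro mult_left_mono) auto
  also have "\<dots> = (L * d) * norm (y s0)" by simp
  also have "\<dots> \<le> 1/2 * norm (y s0)" using Ld by (intro mult_right_mono) auto
  finally have "norm (y s0) = 0" using \<open>z1 T = z2 T\<close> by (simp add: y_def)
  then have "z1 s = z2 s" if "s \<in> {T..T+d}" for s using s0(2)[OF that] by (simp add: y_def)
  then show ?thesis using d(1) by auto
qed

lemma ode_unique:
  fixes H :: "'a::real_normed_vector \<Rightarrow> 'a"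
  assumes H: "locally_lipschitz_on Z H" and Z: "open Z"
    and z1: "\<And>t. t \<in> {a..b} \<Longrightarrow> (z1 has_vector_derivative H (z1 t)) (at t within {a..b})"
    and z2: "\<And>t. t \<in> {a..b} \<Longrightarrow> (z2 has_vector_derivative H (z2 t)) (at t within {a..b})"
    and "z1 a = z2 a" and "\<And>t. t \<in> {a..b} \<Longrightarrow> z1 t \<in> Z" and t: "t \<in> {a..b}"
  shows "z1 t = z2 t"
proof (rule interval_eq_continuation[where a=a and b=b])
  show "continuous_on {a..b} z1" "continuous_on {a..b} z2"
    by (metis continuous_on_eq_continuous_within has_vector_derivative_continuous z1)
      (metis continuous_on_eq_continuous_within has_vector_derivative_continuous z2)
  fix T assume T: "a \<le> T" "T < b" "\<forall>s\<in>{a..T}. z1 s = z2 s"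
  have sub: "{T..b} \<subseteq> {a..b}" using T by auto
  show "\<exists>d>0. \<forall>s\<in>{T..T+d}\<inter>{..b}. z1 s = z2 s"
    by (rule ode_unique_step[OF H Z])
      (use T sub assms(3-5) assms(6)[of T] in \<open>auto intro: has_vector_derivative_within_subset[OF _ sub]\<close>)
qed (use assms in auto)

text \<open>\<open>\<Gamma> x u\<close> stands for the quadratic expression in the velocity formed
  with the Christoffel symbols, reduced to its two estimates. Both scale with the velocity, so small
  initial velocities, rather than short times, give a contraction on the whole unit interval. In
  \<open>x\<close> the dependence is Lipschitz, which is what a C^{1,1} metric provides.\<close>

locale local_spray =
  fixes x0 :: "'e::euclidean_space" and R K :: real and \<Gamma> :: "'e \<Rightarrow> 'e \<Rightarrow> 'e"
  assumes R: "R > 0" and K: "K \<ge> 1"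
    and spray_bound: "x \<in> cball x0 R \<Longrightarrow> norm (\<Gamma> x u) \<le> K * (norm u)\<^sup>2"
    and spray_lip: "x \<in> cball x0 R \<Longrightarrow> y \<in> cball x0 R \<Longrightarrow>
      norm (\<Gamma> x u - \<Gamma> y v) \<le> K * (norm (x - y) * (norm u)\<^sup>2 + norm (u - v) * (norm u + norm v))"
begin

text \<open>Velocities up to \<open>2 * \<rho>\<close> keep unit-time trajectories in the ball of
  radius \<open>R\<close>, and the bound 1/(40 K) makes the Picard map contract with factor 8 K
  \<rho> \<le> 1/5.\<close>

definition \<rho> :: real where "\<rho> = min 1 (min (R / 2) (1 / (40 * K)))"

lemma rho: "\<rho> > 0" "\<rho> \<le> 1" "2 * \<rho> \<le> R" "8 * K * \<rho> \<le> 1/5"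
proof -
  show "\<rho> > 0" "\<rho> \<le> 1" "2 * \<rho> \<le> R" using R K by (auto simp: \<rho>_def)
  have "\<rho> \<le> 1 / (40 * K)" by (simp add: \<rho>_def)
  then have "\<rho> * (40 * K) \<le> 1" using K by (simp add: pos_le_divide_eq)
  moreover have "8 * K * \<rho> = \<rho> * (40 * K) / 5" by (simp add: mult.commute)
  ultimately show "8 * K * \<rho> \<le> 1/5" by linarith
qed

lemma continuous_on_spray:
  assumes "continuous_on S x" "continuous_on S u" "x ` S \<subseteq> cball x0 R"
  shows "continuous_on S (\<lambda>s. \<Gamma> (x s) (u s))"
  unfolding continuous_on_def
proof
  fix s assume s: "s \<in> S"
  have x: "(x \<longlongrightarrow> x s) (at s within S)" and u: "(u \<longlongrightarrow> u s) (at s within S)"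
    using assms s by (auto simp: continuous_on_def)
  have "((\<lambda>r. K * (norm (x r - x s) * (norm (u r))\<^sup>2 + norm (u r - u s) * (norm (u r) + norm (u s)))) \<longlongrightarrow>
      K * (norm (x s - x s) * (norm (u s))\<^sup>2 + norm (u s - u s) * (norm (u s) + norm (u s)))) (at s within S)"
    by (intro tendsto_intros x u)
  then have lim: "((\<lambda>r. K * (norm (x r - x s) * (norm (u r))\<^sup>2 + norm (u r - u s) * (norm (u r) + norm (u s)))) \<longlongrightarrow> 0) (at s within S)"
    by simp
  have "((\<lambda>r. \<Gamma> (x r) (u r) - \<Gamma> (x s) (u s)) \<longlongrightarrow> 0) (at s within S)"
    by (rule Lim_null_comparison[OF _ lim])
      (use assms(3) s in \<open>auto simp: eventually_at_filter intro!: always_eventually spray_lip\<close>)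
  then show "((\<lambda>r. \<Gamma> (x r) (u r)) \<longlongrightarrow> \<Gamma> (x s) (u s)) (at s within S)"
    by (simp add: LIM_zero_iff)
qed

text \<open>The iteration runs on the velocity alone, a bounded continuous function on the line; the
  position is its integral. A sup norm estimate on velocities thus controls positions as well, which
  is the closeness used in the first variation.\<close>

definition pos :: "(real \<Rightarrow>\<^sub>C 'e) \<Rightarrow> real \<Rightarrow> 'e" where
  "pos u t = x0 + integral {0..t} (apply_bcontfun u)"

definition picard :: "'e \<Rightarrow> (real \<Rightarrow>\<^sub>C 'e) \<Rightarrow> real \<Rightarrow> 'e" where
  "picard v u t = v - integral {0..t} (\<lambda>s. \<Gamma> (pos u s) (apply_bcontfun u s))"

lemma pos_deriv: "t \<in> {0..1} \<Longrightarrow> (pos u has_vector_derivative apply_bcontfun u t) (at t within {0..1})"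
  unfolding pos_def
  by (rule has_vector_derivative_add[of "\<lambda>_. x0" 0, simplified])
    (auto intro: integral_has_vector_derivative)

lemma pos_0: "pos u 0 = x0"
  by (simp add: pos_def)

lemma pos_near:
  assumes "\<And>t. norm (apply_bcontfun u t) \<le> B" "t \<in> {0..1}"
  shows "norm (pos u t - x0) \<le> B * t"
  using vector_derivative_bound[OF pos_deriv, of u B 0 t] assms pos_0 by simp

lemma pos_diff:
  assumes "\<And>s. s \<in> {0..1} \<Longrightarrow> norm (apply_bcontfun u s - apply_bcontfun w s - d) \<le> B" "t \<in> {0..1}"
  shows "norm (pos u t - pos w t - t *\<^sub>R d) \<le> B * t"
proof -
  have "((\<lambda>t. pos u t - pos w t - t *\<^sub>R d) has_vector_derivative
     (apply_bcontfun u t - apply_bcontfun w t - d)) (at t within {0..1})" if "t \<in> {0..1}" for t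
    using that by (auto intro!: derivative_eq_intros pos_deriv)
  from vector_derivative_bound[OF this assms(1), of 0 t] assms(2) show ?thesis
    by (simp add: pos_0)
qed

lemma continuous_on_pos: "continuous_on {0..1} (pos u)"
  by (metis continuous_on_eq_continuous_within has_vector_derivative_continuous pos_deriv)

lemma pos_in_cball:
  assumes "\<And>t. norm (apply_bcontfun u t) \<le> 2 * \<rho>" "t \<in> {0..1}"
  shows "pos u t \<in> cball x0 R"
proof -
  have "norm (pos u t - x0) \<le> 2 * \<rho> * t" by (rule pos_near[OF assms])
  also have "\<dots> \<le> 2 * \<rho> * 1" using assms(2) rho by (intro mult_left_mono) auto
  finally show ?thesis using rho by (simp add: dist_norm norm_minus_commute)
qed

lemma picard_deriv:
  assumes u: "\<And>t. norm (apply_bcontfun u t) \<le> 2 * \<rho>" and t: "t \<in> {0..1}"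
  shows "(picard v u has_vector_derivative - \<Gamma> (pos u t) (apply_bcontfun u t)) (at t within {0..1})"
proof -
  have "continuous_on {0..1} (\<lambda>s. \<Gamma> (pos u s) (apply_bcontfun u s))"
    using pos_in_cball[OF u] by (intro continuous_on_spray continuous_on_pos) auto
  from integral_has_vector_derivative[OF this t]
  show ?thesis unfolding picard_def
    using has_vector_derivative_diff[OF has_vector_derivative_const[of v]] by fastforce
qed

lemma picard_0: "picard v u 0 = v"
  by (simp add: picard_def)

text \<open>Two initial velocities are allowed so that one estimate serves twice: as contraction
  when they agree, and as Lipschitz dependence of the fixed point on the initial velocity.\<close>

lemma picard_diff:
  assumes u: "\<And>t. norm (apply_bcontfun u t) \<le> 2 * \<rho>" and w: "\<And>t. norm (apply_bcontfun w t) \<le> 2 * \<rho>"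
    and t: "t \<in> {0..1}"
  shows "norm (picard v u t - picard v' w t - (v - v')) \<le> dist u w / 5"
proof -
  let ?f = "\<lambda>t. picard v u t - picard v' w t - (v - v')"
  have der: "(?f has_vector_derivative
     (- \<Gamma> (pos u t) (apply_bcontfun u t) - - \<Gamma> (pos w t) (apply_bcontfun w t))) (at t within {0..1})" if "t \<in> {0..1}" for t
    using has_vector_derivative_diff[OF has_vector_derivative_diff[OF picard_deriv[OF u that, of v] picard_deriv[OF w that, of v']]
       has_vector_derivative_const[of "v - v'"]] by simp
  have bound: "norm (- \<Gamma> (pos u s) (apply_bcontfun u s) - - \<Gamma> (pos w s) (apply_bcontfun w s)) \<le> dist u w / 5"
    if s: "s \<in> {0..1}" for s
  proof -
    define D where "D = dist u w"
    have D0: "0 \<le> D" by (simp add: D_def)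
    have D: "norm (apply_bcontfun u r - apply_bcontfun w r - 0) \<le> D" for r
      using dist_bounded[of u r w] by (simp add: dist_norm D_def)
    have "norm (pos u s - pos w s - s *\<^sub>R 0) \<le> D * s" by (rule pos_diff[OF D s])
    also have "\<dots> \<le> D * 1" using s by (intro mult_left_mono) (auto simp: D_def)
    finally have 1: "norm (pos u s - pos w s) \<le> D" by simp
    have "norm (\<Gamma> (pos u s) (apply_bcontfun u s) - \<Gamma> (pos w s) (apply_bcontfun w s)) \<le>
       K * (norm (pos u s - pos w s) * (norm (apply_bcontfun u s))\<^sup>2 +
         norm (apply_bcontfun u s - apply_bcontfun w s) * (norm (apply_bcontfun u s) + norm (apply_bcontfun w s)))"
      by (rule spray_lip) (intro pos_in_cball u w s)+
    also have "\<dots> \<le> K * (D * (2 * \<rho>)\<^sup>2 + D * (2 * \<rho> + 2 * \<rho>))"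
      using 1 D[of s] u[of s] w[of s] K D0
      by (intro mult_left_mono add_mono mult_mono power_mono) auto
    also have "\<dots> \<le> K * (D * (4 * \<rho>) + D * (4 * \<rho>))"
    proof -
      have "(2 * \<rho>)\<^sup>2 \<le> 4 * \<rho>" using rho by (simp add: power2_eq_square)
      then have "D * (2 * \<rho>)\<^sup>2 \<le> D * (4 * \<rho>)" by (intro mult_left_mono) (auto simp: D_def)
      then show ?thesis using K by (intro mult_left_mono) auto
    qed
    also have "\<dots> = (8 * K * \<rho>) * D" by (simp add: algebra_simps)
    also have "\<dots> \<le> 1/5 * D" using rho by (intro mult_right_mono) (auto simp: D_def)
    finally show ?thesis by (simp add: D_def norm_minus_commute)
  qed
  have "norm (?f t - ?f 0) \<le> dist u w / 5 * \<bar>t - 0\<bar>"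
    by (rule vector_derivative_bound[OF der bound]) (use t in auto)
  also have "\<dots> \<le> dist u w / 5 * 1" using t by (intro mult_left_mono) auto
  finally show ?thesis by (simp add: picard_0)
qed

lemma small_velocity:
  assumes "norm v \<le> \<rho>" "norm (u - v) \<le> norm v / 2"
  shows "norm u \<le> 3/2 * norm v" "norm u \<le> 2 * \<rho>" "norm v / 2 \<le> norm u"
proof -
  have "norm u \<le> norm v + norm (u - v)" by (metis add.commute diff_add_cancel norm_triangle_ineq)
  then show "norm u \<le> 3/2 * norm v" "norm u \<le> 2 * \<rho>" using assms rho(1) by auto
  have "norm v \<le> norm u + norm (u - v)" by (metis norm_minus_commute add.commute diff_add_cancel norm_triangle_ineq)
  then show "norm v / 2 \<le> norm u" using assms by auto
qed

lemma picard_near: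
  assumes v: "norm v \<le> \<rho>" and u: "\<And>t. norm (apply_bcontfun u t - v) \<le> norm v / 2" and t: "t \<in> {0..1}"
  shows "norm (picard v u t - v) \<le> 3 * K * (norm v)\<^sup>2" "norm (picard v u t - v) \<le> norm v / 2"
proof -
  note sv = small_velocity[OF v u]
  have bound: "norm (- \<Gamma> (pos u s) (apply_bcontfun u s)) \<le> 3 * K * (norm v)\<^sup>2" if "s \<in> {0..1}" for s
  proof -
    have "norm (\<Gamma> (pos u s) (apply_bcontfun u s)) \<le> K * (norm (apply_bcontfun u s))\<^sup>2"
      by (rule spray_bound[OF pos_in_cball[OF sv(2) that]])
    also have "\<dots> \<le> K * (3/2 * norm v)\<^sup>2" using K sv by (intro mult_left_mono power_mono) auto
    also have "\<dots> \<le> 3 * K * (norm v)\<^sup>2" using K by (simp add: power2_eq_square)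
    finally show ?thesis by simp
  qed
  have "norm (picard v u t - picard v u 0) \<le> 3 * K * (norm v)\<^sup>2 * \<bar>t - 0\<bar>"
    by (rule vector_derivative_bound[OF picard_deriv[OF sv(2)] bound]) (use t in auto)
  also have "\<dots> \<le> 3 * K * (norm v)\<^sup>2 * 1" using t K by (intro mult_left_mono) auto
  finally show 1: "norm (picard v u t - v) \<le> 3 * K * (norm v)\<^sup>2" by (simp add: picard_0)
  have "3 * K * (norm v)\<^sup>2 = (3 * K * norm v) * norm v" by (simp add: power2_eq_square)
  also have "\<dots> \<le> (3 * K * \<rho>) * norm v" using v K by (intro mult_right_mono mult_left_mono) auto
  also have "\<dots> \<le> 1/2 * norm v" using rho K by (intro mult_right_mono) auto
  finally show "norm (picard v u t - v) \<le> norm v / 2" using 1 by simp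
qed

text \<open>Banach's fixed point theorem on the closed set of velocities within
  \<open>norm v / 2\<close> of the constant \<open>v\<close>. Clamping time to the unit interval
  turns the Picard image into a bounded continuous function on the whole line.\<close>

lemma solution_exists:
  assumes v: "norm v \<le> \<rho>"
  shows "\<exists>u::real \<Rightarrow>\<^sub>C 'e. (\<forall>t. norm (apply_bcontfun u t - v) \<le> norm v / 2) \<and> (\<forall>t. apply_bcontfun u t = picard v u (max 0 (min 1 t)))"
proof -
  define S where "S = {u::real \<Rightarrow>\<^sub>C 'e. \<forall>t. norm (apply_bcontfun u t - v) \<le> norm v / 2}"
  define cl where "cl t = max 0 (min 1 t)" for t :: real
  have cl: "cl t \<in> {0..1}" "t \<in> {0..1} \<Longrightarrow> cl t = t" for t by (auto simp: cl_def)
  define \<Phi> where "\<Phi> u = Bcontfun (\<lambda>t. picard v u (cl t))" for u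
  have \<Phi>: "apply_bcontfun (\<Phi> u) t = picard v u (cl t)" if "u \<in> S" for u t
  proof -
    have u: "\<And>t. norm (apply_bcontfun u t - v) \<le> norm v / 2" using that by (simp add: S_def)
    have "continuous_on {0..1} (picard v u)"
      by (metis continuous_on_eq_continuous_within has_vector_derivative_continuous picard_deriv[OF small_velocity(2)[OF v u]])
    then have "continuous_on UNIV (\<lambda>t. picard v u (cl t))"
      by (rule continuous_on_compose2) (auto simp: cl_def intro!: continuous_intros)
    moreover have "norm (picard v u (cl t)) \<le> 2 * \<rho>" for t
      by (rule small_velocity(2)[OF v picard_near(2)[OF v u cl(1)]])
    ultimately show ?thesis unfolding \<Phi>_def by (subst Bcontfun_inverse) (auto intro: bcontfun_normI)
  qed
  have "S = PiC UNIV (\<lambda>_. cball v (norm v / 2))"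
    by (auto simp: S_def mem_PiC_iff Pi_def dist_norm norm_minus_commute)
  then have "complete S"
    using closed_PiC[of UNIV "\<lambda>_. cball v (norm v / 2)"] by (simp add: complete_eq_closed)
  moreover have "const_bcontfun v \<in> S" by (simp add: S_def const_bcontfun.rep_eq)
  moreover have "\<Phi> ` S \<subseteq> S"
    using picard_near(2)[OF v _ cl(1)] by (auto simp: S_def \<Phi>[unfolded S_def])
  moreover have "dist (\<Phi> u) (\<Phi> w) \<le> 1/5 * dist u w" if "u \<in> S" "w \<in> S" for u w
  proof (rule dist_bound)
    fix t
    have "norm (apply_bcontfun u t) \<le> 2 * \<rho>" "norm (apply_bcontfun w t) \<le> 2 * \<rho>" for t
      using small_velocity(2)[OF v] that by (auto simp: S_def)
    from picard_diff[OF this cl(1)[of t], of v v]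
    show "dist (apply_bcontfun (\<Phi> u) t) (apply_bcontfun (\<Phi> w) t) \<le> 1/5 * dist u w"
      by (simp add: \<Phi> that dist_norm)
  qed
  ultimately have "\<exists>!u\<in>S. \<Phi> u = u"
    by (intro Banach_fix[of S "1/5"]) auto
  then obtain u where "u \<in> S" "\<Phi> u = u" by blast
  then show ?thesis using \<Phi>[of u] by (intro exI[of _ u]) (auto simp: S_def cl_def)
qed

definition sol :: "'e \<Rightarrow> (real \<Rightarrow>\<^sub>C 'e)" where
  "sol v = (SOME u. (\<forall>t. norm (apply_bcontfun u t - v) \<le> norm v / 2) \<and> (\<forall>t. apply_bcontfun u t = picard v u (max 0 (min 1 t))))"

definition vel :: "'e \<Rightarrow> real \<Rightarrow> 'e" where "vel v = apply_bcontfun (sol v)"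

definition traj :: "'e \<Rightarrow> real \<Rightarrow> 'e" where "traj v = pos (sol v)"

context
  fixes v :: 'e assumes v: "norm v \<le> \<rho>"
begin

lemma vel_near: "norm (vel v t - v) \<le> norm v / 2"
  and vel_eq_clamp: "vel v t = picard v (sol v) (max 0 (min 1 t))"
  using someI_ex[OF solution_exists[OF v]] by (auto simp: sol_def vel_def)

lemma vel_eq: "t \<in> {0..1} \<Longrightarrow> vel v t = picard v (sol v) t"
  using vel_eq_clamp by simp

lemmas vel_small = small_velocity[OF v vel_near]

lemma vel_near_sq: "t \<in> {0..1} \<Longrightarrow> norm (vel v t - v) \<le> 3 * K * (norm v)\<^sup>2"
  using picard_near(1)[OF v vel_near[unfolded vel_def]] vel_eq by simp

lemma vel_0: "vel v 0 = v" and traj_0: "traj v 0 = x0"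
  using vel_eq[of 0] by (auto simp: picard_0 traj_def pos_0)

lemma traj_deriv: "t \<in> {0..1} \<Longrightarrow> (traj v has_vector_derivative vel v t) (at t within {0..1})"
  unfolding traj_def vel_def by (rule pos_deriv)

lemma vel_deriv:
  assumes t: "t \<in> {0..1}"
  shows "(vel v has_vector_derivative - \<Gamma> (traj v t) (vel v t)) (at t within {0..1})"
  unfolding traj_def vel_def
  by (rule has_vector_derivative_transform[OF t _ picard_deriv[OF vel_small(2)[unfolded vel_def] t, of v]])
    (simp add: vel_eq[unfolded vel_def])

lemma traj_near: "t \<in> {0..1} \<Longrightarrow> norm (traj v t - x0) \<le> 3/2 * norm v * t"
  unfolding traj_def by (rule pos_near) (use vel_small in \<open>auto simp: vel_def\<close>)

lemma traj_in_cball: "t \<in> {0..1} \<Longrightarrow> traj v t \<in> cball x0 R"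
  unfolding traj_def by (rule pos_in_cball) (use vel_small in \<open>auto simp: vel_def\<close>)

lemma traj_near_sq:
  assumes t: "t \<in> {0..1}"
  shows "norm (traj v t - x0 - t *\<^sub>R v) \<le> 3 * K * (norm v)\<^sup>2 * t"
proof -
  have "((\<lambda>t. traj v t - x0 - t *\<^sub>R v) has_vector_derivative (vel v t - v)) (at t within {0..1})" if "t \<in> {0..1}" for t
    using that by (auto intro!: derivative_eq_intros traj_deriv)
  from vector_derivative_bound[OF this vel_near_sq, of 0 t] t show ?thesis
    by (simp add: traj_0)
qed

end

text \<open>The distance D of the two fixed points satisfies D \<le> |v - w| + D/5, hence D \<le>
  (5/4) |v - w|, and the contraction error D/5 becomes |v - w|/4.\<close>

lemma vel_lip:
  assumes v: "norm v \<le> \<rho>" and w: "norm w \<le> \<rho>" and t: "t \<in> {0..1}"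
  shows "norm (vel v t - vel w t - (v - w)) \<le> norm (v - w) / 4"
    and "norm (traj v t - traj w t - t *\<^sub>R (v - w)) \<le> norm (v - w) / 4 * t"
proof -
  define D where "D = dist (sol v) (sol w)"
  have 1: "norm (vel v t - vel w t - (v - w)) \<le> D / 5" for t
    unfolding vel_eq_clamp[OF v] vel_eq_clamp[OF w] D_def
    by (rule picard_diff) (use vel_small(2)[OF v] vel_small(2)[OF w] in \<open>auto simp: vel_def\<close>)
  have D0: "0 \<le> D" by (simp add: D_def)
  have "D \<le> 5/4 * norm (v - w)"
  proof -
    have "dist (apply_bcontfun (sol v) s) (apply_bcontfun (sol w) s) \<le> norm (v - w) + D / 5" for s
      using 1[of s] norm_triangle_ineq[of "v - w" "vel v s - vel w s - (v - w)"]
      by (simp add: dist_norm vel_def)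
    then have "D \<le> norm (v - w) + D / 5" unfolding D_def by (rule dist_bound)
    then show ?thesis by simp
  qed
  then have 2: "norm (vel v t - vel w t - (v - w)) \<le> norm (v - w) / 4" for t
    using 1[of t] by simp
  show "norm (vel v t - vel w t - (v - w)) \<le> norm (v - w) / 4" by (rule 2)
  show "norm (traj v t - traj w t - t *\<^sub>R (v - w)) \<le> norm (v - w) / 4 * t"
    unfolding traj_def by (rule pos_diff[OF _ t]) (use 2 in \<open>auto simp: vel_def\<close>)
qed

end

section \<open>The energy of geodesics\<close>

lemma bilinear_expand:
  fixes B :: "'e::euclidean_space \<Rightarrow> 'e \<Rightarrow> real"
  assumes "bilinear B"
  shows "B a b = (\<Sum>i\<in>Basis. \<Sum>j\<in>Basis. (a \<bullet> i) * (b \<bullet> j) * B i j)"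
proof -
  have "B a b = B (\<Sum>i\<in>Basis. (a \<bullet> i) *\<^sub>R i) (\<Sum>j\<in>Basis. (b \<bullet> j) *\<^sub>R j)"
    by (simp add: euclidean_representation)
  also have "\<dots> = (\<Sum>(i,j)\<in>Basis\<times>Basis. B ((a \<bullet> i) *\<^sub>R i) ((b \<bullet> j) *\<^sub>R j))"
    by (rule bilinear_sum[OF assms])
  also have "\<dots> = (\<Sum>i\<in>Basis. \<Sum>j\<in>Basis. (a \<bullet> i) * (b \<bullet> j) * B i j)"
    by (simp add: sum.cartesian_product[symmetric] bilinear_lmul[OF assms] bilinear_rmul[OF assms] mult_ac)
  finally show ?thesis .
qed

text \<open>Differentiability is given for the entries on basis vectors, so the product rule is
  applied to the expansion in components. The derivative is taken relative to \<Omega> in order to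
  cover closed balls as well as open chart images.\<close>

lemma bilinear_along_derivative:
  fixes G :: "'e::euclidean_space \<Rightarrow> 'e \<Rightarrow> 'e \<Rightarrow> real"
  assumes G: "\<And>x. x \<in> \<Omega> \<Longrightarrow> bilinear (G x)"
    and DG: "\<And>h. bilinear (D h)"
    and der: "\<And>i j. i \<in> Basis \<Longrightarrow> j \<in> Basis \<Longrightarrow> ((\<lambda>y. G y i j) has_derivative (\<lambda>h. D h i j)) (at (\<sigma> t) within \<Omega>)"
    and \<sigma>: "(\<sigma> has_vector_derivative \<sigma>') (at t within S)" and \<sigma>S: "\<sigma> ` S \<subseteq> \<Omega>" and t: "t \<in> S"
    and a: "(a has_vector_derivative a') (at t within S)" and b: "(b has_vector_derivative b') (at t within S)"
  shows "((\<lambda>s. G (\<sigma> s) (a s) (b s)) has_real_derivative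
     (D \<sigma>' (a t) (b t) + G (\<sigma> t) a' (b t) + G (\<sigma> t) (a t) b')) (at t within S)"
proof -
  have st: "\<sigma> t \<in> \<Omega>" using \<sigma>S t by auto
  have Gij: "((\<lambda>s. G (\<sigma> s) i j) has_real_derivative D \<sigma>' i j) (at t within S)" if "i \<in> Basis" "j \<in> Basis" for i j
  proof -
    have "((\<lambda>s. G (\<sigma> s) i j) has_derivative (\<lambda>h. D (h *\<^sub>R \<sigma>') i j)) (at t within S)"
      using has_derivative_in_compose[OF \<sigma>[unfolded has_vector_derivative_def]
          has_derivative_subset[OF der[OF that] \<sigma>S]] .
    moreover have "(\<lambda>h. D (h *\<^sub>R \<sigma>') i j) = (*) (D \<sigma>' i j)"
      using linear_scale[OF has_derivative_linear[OF der[OF that]], of _ \<sigma>'] by (auto simp: fun_eq_iff mult.commute)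
    ultimately show ?thesis by (simp add: has_field_derivative_def)
  qed
  have comp: "((\<lambda>s. f s \<bullet> i) has_real_derivative f' \<bullet> i) (at t within S)"
    if "(f has_vector_derivative f') (at t within S)" for f f' i
    using bounded_linear.has_vector_derivative[OF bounded_linear_inner_left that, of i]
    by (simp add: has_real_derivative_iff_has_vector_derivative)
  have "((\<lambda>s. \<Sum>i\<in>Basis. \<Sum>j\<in>Basis. (a s \<bullet> i) * (b s \<bullet> j) * G (\<sigma> s) i j) has_real_derivative
     (\<Sum>i\<in>Basis. \<Sum>j\<in>Basis. ((a' \<bullet> i) * (b t \<bullet> j) + (b' \<bullet> j) * (a t \<bullet> i)) * G (\<sigma> t) i j +
        D \<sigma>' i j * ((a t \<bullet> i) * (b t \<bullet> j)))) (at t within S)"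
    by (intro DERIV_sum DERIV_mult comp a b Gij)
  then have "((\<lambda>s. G (\<sigma> s) (a s) (b s)) has_real_derivative
     (\<Sum>i\<in>Basis. \<Sum>j\<in>Basis. ((a' \<bullet> i) * (b t \<bullet> j) + (b' \<bullet> j) * (a t \<bullet> i)) * G (\<sigma> t) i j +
        D \<sigma>' i j * ((a t \<bullet> i) * (b t \<bullet> j)))) (at t within S)"
    unfolding has_real_derivative_iff_has_vector_derivative
    by (rule has_vector_derivative_transform[OF t, rotated])
      (use \<sigma>S in \<open>auto intro!: bilinear_expand G\<close>)
  moreover have "(\<Sum>i\<in>Basis. \<Sum>j\<in>Basis. ((a' \<bullet> i) * (b t \<bullet> j) + (b' \<bullet> j) * (a t \<bullet> i)) * G (\<sigma> t) i j +
        D \<sigma>' i j * ((a t \<bullet> i) * (b t \<bullet> j))) =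
     D \<sigma>' (a t) (b t) + G (\<sigma> t) a' (b t) + G (\<sigma> t) (a t) b'"
    unfolding bilinear_expand[OF G[OF st], of a'] bilinear_expand[OF G[OF st], of "a t"]
      bilinear_expand[OF DG, of \<sigma>' "a t"]
    by (simp add: sum.distrib[symmetric] algebra_simps)
  ultimately show ?thesis by simp
qed

text \<open>\<open>DG x h\<close> is the derivative of the metric in direction \<open>h\<close>.
  \<open>G_taylor\<close> is the form in which Lipschitz continuity of this derivative is used, and
  \<open>spray_G\<close> defines the spray with its index lowered, so that no inverse metric
  appears.\<close>

locale local_geodesic = local_spray x0 R K \<Gamma>
  for x0 :: "'e::euclidean_space" and R K :: real and \<Gamma> :: "'e \<Rightarrow> 'e \<Rightarrow> 'e" +
  fixes G :: "'e \<Rightarrow> 'e \<Rightarrow> 'e \<Rightarrow> real" and DG :: "'e \<Rightarrow> 'e \<Rightarrow> 'e \<Rightarrow> 'e \<Rightarrow> real"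
  assumes G_bilinear: "x \<in> cball x0 R \<Longrightarrow> bilinear (G x)"
    and G_sym: "x \<in> cball x0 R \<Longrightarrow> G x u v = G x v u"
    and G_bound: "x \<in> cball x0 R \<Longrightarrow> \<bar>G x u v\<bar> \<le> K * norm u * norm v"
    and DG_bilinear: "x \<in> cball x0 R \<Longrightarrow> bilinear (DG x h)"
    and DG_linear: "x \<in> cball x0 R \<Longrightarrow> linear (\<lambda>h. DG x h u v)"
    and DG_sym: "x \<in> cball x0 R \<Longrightarrow> DG x h u v = DG x h v u"
    and DG_bound: "x \<in> cball x0 R \<Longrightarrow> \<bar>DG x h u v\<bar> \<le> K * norm h * norm u * norm v"
    and G_taylor: "x \<in> cball x0 R \<Longrightarrow> y \<in> cball x0 R \<Longrightarrow>
      \<bar>G y u v - G x u v - DG x (y - x) u v\<bar> \<le> K * (norm (y - x))\<^sup>2 * norm u * norm v"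
    and spray_G: "x \<in> cball x0 R \<Longrightarrow> G x (\<Gamma> x u) w = DG x u u w - DG x w u u / 2"
begin

lemma G_has_derivative:
  assumes x: "x \<in> cball x0 R"
  shows "((\<lambda>y. G y u v) has_derivative (\<lambda>h. DG x h u v)) (at x within cball x0 R)"
  unfolding has_derivative_within_alt
proof (intro conjI allI impI)
  show "bounded_linear (\<lambda>h. DG x h u v)"
    using DG_linear[OF x] linear_conv_bounded_linear by blast
  fix e :: real assume e: "e > 0"
  define C where "C = K * norm u * norm v + 1"
  have C: "C > 0" using K by (auto simp: C_def intro: add_nonneg_pos)
  show "\<exists>d>0. \<forall>y\<in>cball x0 R. norm (y - x) < d \<longrightarrow> norm (G y u v - G x u v - DG x (y - x) u v) \<le> e * norm (y - x)"
  proof (intro exI[of _ "e / C"] conjI ballI impI)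
    fix y assume y: "y \<in> cball x0 R" "norm (y - x) < e / C"
    have "norm (G y u v - G x u v - DG x (y - x) u v) \<le> (K * norm u * norm v) * (norm (y - x))\<^sup>2"
      using G_taylor[OF x y(1), of u v] by (simp add: mult_ac)
    also have "\<dots> \<le> C * (norm (y - x))\<^sup>2" by (intro mult_right_mono) (auto simp: C_def)
    also have "\<dots> = (C * norm (y - x)) * norm (y - x)" by (simp add: power2_eq_square)
    also have "\<dots> \<le> e * norm (y - x)"
      using y(2) C by (intro mult_right_mono) (auto simp: field_simps)
    finally show "norm (G y u v - G x u v - DG x (y - x) u v) \<le> e * norm (y - x)" .
  qed (use e C in simp)
qed

lemma G_lipschitz:
  assumes x: "x \<in> cball x0 R" and y: "y \<in> cball x0 R"
  shows "\<bar>G y u v - G x u v\<bar> \<le> K * (1 + 2 * R) * norm (y - x) * norm u * norm v"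
proof -
  have "norm (y - x) \<le> 2 * R"
    using x y dist_triangle[of y x x0] by (simp add: dist_norm norm_minus_commute)
  then have "K * (norm (y - x))\<^sup>2 * norm u * norm v \<le> K * (2 * R * norm (y - x)) * norm u * norm v"
    using K by (intro mult_right_mono mult_left_mono) (auto simp: power2_eq_square mult_right_mono)
  moreover have "\<bar>DG x (y - x) u v\<bar> \<le> K * norm (y - x) * norm u * norm v" by (rule DG_bound[OF x])
  ultimately have "\<bar>G y u v - G x u v\<bar> \<le> K * norm (y - x) * norm u * norm v + K * (2 * R * norm (y - x)) * norm u * norm v"
    using G_taylor[OF x y, of u v] by linarith
  also have "\<dots> = K * (1 + 2 * R) * norm (y - x) * norm u * norm v" by (simp add: algebra_simps)
  finally show ?thesis .
qed

lemma G_along_derivative: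
  assumes \<sigma>: "(\<sigma> has_vector_derivative \<sigma>') (at t within S)" and \<sigma>S: "\<sigma> ` S \<subseteq> cball x0 R" and t: "t \<in> S"
    and a: "(a has_vector_derivative a') (at t within S)" and b: "(b has_vector_derivative b') (at t within S)"
  shows "((\<lambda>s. G (\<sigma> s) (a s) (b s)) has_real_derivative
     (DG (\<sigma> t) \<sigma>' (a t) (b t) + G (\<sigma> t) a' (b t) + G (\<sigma> t) (a t) b')) (at t within S)"
proof -
  have st: "\<sigma> t \<in> cball x0 R" using \<sigma>S t by auto
  show ?thesis
    by (rule bilinear_along_derivative[OF G_bilinear DG_bilinear[OF st] G_has_derivative[OF st] \<sigma> \<sigma>S t a b])
qed

text \<open>With the velocity as test vector, \<open>spray_G\<close> gives half of the derivative of
  the metric along the velocity; the two acceleration terms together cancel that derivative.\<close>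

lemma energy_constant:
  assumes v: "norm v \<le> \<rho>" and t: "t \<in> {0..1}"
  shows "G (traj v t) (vel v t) (vel v t) = G x0 v v"
proof -
  let ?E = "\<lambda>t. G (traj v t) (vel v t) (vel v t)"
  have "(?E has_real_derivative 0) (at t within {0..1})" if t: "t \<in> {0..1}" for t
  proof -
    let ?x = "traj v t" and ?u = "vel v t"
    have x: "?x \<in> cball x0 R" by (rule traj_in_cball[OF v t])
    have "(?E has_real_derivative (DG ?x ?u ?u ?u + G ?x (- \<Gamma> ?x ?u) ?u + G ?x ?u (- \<Gamma> ?x ?u))) (at t within {0..1})"
      by (rule G_along_derivative) (use traj_in_cball[OF v] traj_deriv[OF v] vel_deriv[OF v] t in auto)
    moreover have "G ?x (- \<Gamma> ?x ?u) ?u = - (DG ?x ?u ?u ?u / 2)"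
      using spray_G[OF x, of ?u ?u] by (simp add: bilinear_lneg[OF G_bilinear[OF x]])
    moreover have "G ?x ?u (- \<Gamma> ?x ?u) = - (DG ?x ?u ?u ?u / 2)"
      using spray_G[OF x, of ?u ?u] G_sym[OF x] by (simp add: bilinear_lneg[OF G_bilinear[OF x]] bilinear_rneg[OF G_bilinear[OF x]])
    ultimately show ?thesis by simp
  qed
  then have "\<exists>c. \<forall>t\<in>{0..1}. ?E t = c"
    by (intro has_field_derivative_zero_constant) auto
  then have "?E t = ?E 0" using t by auto
  then show ?thesis by (simp add: vel_0[OF v] traj_0[OF v])
qed

text \<open>Gauss lemma without differentiating the exponential map: the energy functional has a geodesic
  as critical point up to the boundary term, and nearby geodesics are \<open>C\<^sup>1\<close>-close.\<close>

lemma energy_first_variation: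
  assumes v: "norm v \<le> \<rho>" and w: "norm w \<le> \<rho>"
  shows "\<bar>G x0 w w - G x0 v v - 2 * G (traj v 1) (vel v 1) (traj w 1 - traj v 1)\<bar> \<le> 40 * K * (norm (w - v))\<^sup>2"
proof -
  define d where "d = norm (w - v)"
  define \<sigma> \<tau> u z where "\<sigma> = traj v" and "\<tau> = traj w" and "u = vel v" and "z = vel w"
  define \<xi> \<eta> where "\<xi> t = \<tau> t - \<sigma> t" and "\<eta> t = z t - u t" for t
  \<comment> \<open>By the geodesic equation of \<sigma>, twice
    \<open>G (\<sigma> t) (u t) (\<xi> t)\<close> grows at the rate of the energy difference, up to
    errors quadratic in \<open>d\<close>. \<Psi> measures the discrepancy and vanishes at 0 because
    both geodesics start at \<open>x0\<close>.\<close>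
  define \<Psi> where "\<Psi> t = 2 * G (\<sigma> t) (u t) (\<xi> t) - t * (G x0 w w - G x0 v v)" for t
  define \<Psi>' where "\<Psi>' t = DG (\<sigma> t) (\<xi> t) (u t) (u t) + 2 * G (\<sigma> t) (u t) (\<eta> t) - (G x0 w w - G x0 v v)" for t
  have d0: "0 \<le> d" by (simp add: d_def)
  have der: "(\<Psi> has_vector_derivative \<Psi>' t) (at t within {0..1})" if t: "t \<in> {0..1}" for t
  proof -
    have x: "\<sigma> t \<in> cball x0 R" unfolding \<sigma>_def by (rule traj_in_cball[OF v t])
    have "(\<xi> has_vector_derivative \<eta> t) (at t within {0..1})"
      unfolding \<xi>_def \<eta>_def \<sigma>_def \<tau>_def u_def z_def
      by (intro has_vector_derivative_diff traj_deriv v w t)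
    then have "((\<lambda>t. G (\<sigma> t) (u t) (\<xi> t)) has_real_derivative
       (DG (\<sigma> t) (u t) (u t) (\<xi> t) + G (\<sigma> t) (- \<Gamma> (\<sigma> t) (u t)) (\<xi> t) + G (\<sigma> t) (u t) (\<eta> t))) (at t within {0..1})"
      unfolding \<sigma>_def u_def
      by (intro G_along_derivative traj_deriv vel_deriv v t) (use traj_in_cball[OF v] in auto)
    moreover have "G (\<sigma> t) (- \<Gamma> (\<sigma> t) (u t)) (\<xi> t) = - DG (\<sigma> t) (u t) (u t) (\<xi> t) + DG (\<sigma> t) (\<xi> t) (u t) (u t) / 2"
      using spray_G[OF x] by (simp add: bilinear_lneg[OF G_bilinear[OF x]])
    ultimately have "((\<lambda>t. G (\<sigma> t) (u t) (\<xi> t)) has_real_derivative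
       (DG (\<sigma> t) (\<xi> t) (u t) (u t) / 2 + G (\<sigma> t) (u t) (\<eta> t))) (at t within {0..1})" by simp
    then have "(\<Psi> has_real_derivative \<Psi>' t) (at t within {0..1})"
      unfolding \<Psi>_def \<Psi>'_def by (auto intro!: derivative_eq_intros simp: algebra_simps)
    then show ?thesis by (simp add: has_real_derivative_iff_has_vector_derivative)
  qed
  have bound: "norm (\<Psi>' t) \<le> 40 * K * d\<^sup>2" if t: "t \<in> {0..1}" for t
  proof -
    have x: "\<sigma> t \<in> cball x0 R" unfolding \<sigma>_def by (rule traj_in_cball[OF v t])
    have y: "\<tau> t \<in> cball x0 R" unfolding \<tau>_def by (rule traj_in_cball[OF w t])
    note bx = G_bilinear[OF x] and bDx = DG_bilinear[OF x]
    have u2: "norm (u t) \<le> 2" and z2: "norm (z t) \<le> 2"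
      using vel_small(2)[OF v, of t] vel_small(2)[OF w, of t] rho by (auto simp: u_def z_def)
    have \<eta>: "norm (\<eta> t) \<le> 2 * d"
    proof -
      have "\<eta> t = (w - v) + (vel w t - vel v t - (w - v))" by (simp add: \<eta>_def z_def u_def)
      then have "norm (\<eta> t) \<le> norm (w - v) + norm (vel w t - vel v t - (w - v))" by (metis norm_triangle_ineq)
      then show ?thesis using vel_lip(1)[OF w v t] norm_ge_zero[of "w - v"] unfolding d_def by linarith
    qed
    have \<xi>: "norm (\<xi> t) \<le> 2 * d"
    proof -
      have "\<xi> t = t *\<^sub>R (w - v) + (traj w t - traj v t - t *\<^sub>R (w - v))" by (simp add: \<xi>_def \<tau>_def \<sigma>_def)
      then have "norm (\<xi> t) \<le> norm (t *\<^sub>R (w - v)) + norm (traj w t - traj v t - t *\<^sub>R (w - v))" by (metis norm_triangle_ineq)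
      also have "\<dots> \<le> t * d + d / 4 * t" using vel_lip(2)[OF w v t] t by (simp add: d_def mult.commute)
      also have "\<dots> \<le> 2 * d" using t mult_right_mono[of t 1 d] d0 by (simp add: mult.commute)
      finally show ?thesis .
    qed
    have eq: "\<tau> t - \<sigma> t = \<xi> t" "z t = u t + \<eta> t" by (auto simp: \<xi>_def \<eta>_def)
    have E: "G x0 w w = G (\<tau> t) (z t) (z t)" "G x0 v v = G (\<sigma> t) (u t) (u t)"
      using energy_constant[OF v t] energy_constant[OF w t] by (auto simp: \<sigma>_def \<tau>_def u_def z_def)
    have 1: "\<bar>G (\<tau> t) (z t) (z t) - G (\<sigma> t) (z t) (z t) - DG (\<sigma> t) (\<xi> t) (z t) (z t)\<bar> \<le> 16 * K * d\<^sup>2"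
    proof -
      have "\<bar>G (\<tau> t) (z t) (z t) - G (\<sigma> t) (z t) (z t) - DG (\<sigma> t) (\<xi> t) (z t) (z t)\<bar> \<le> K * (norm (\<xi> t))\<^sup>2 * norm (z t) * norm (z t)"
        using G_taylor[OF x y] by (simp add: eq(1))
      also have "\<dots> \<le> K * (2 * d)\<^sup>2 * 2 * 2"
        using \<xi> z2 K d0 by (intro mult_mono power_mono) auto
      finally show ?thesis by (simp add: power2_eq_square)
    qed
    have 2: "\<bar>DG (\<sigma> t) (\<xi> t) (z t) (z t) - DG (\<sigma> t) (\<xi> t) (u t) (u t)\<bar> \<le> 16 * K * d\<^sup>2"
    proof -
      have "DG (\<sigma> t) (\<xi> t) (z t) (z t) - DG (\<sigma> t) (\<xi> t) (u t) (u t) =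
          DG (\<sigma> t) (\<xi> t) (\<eta> t) (z t) + DG (\<sigma> t) (\<xi> t) (u t) (\<eta> t)"
        by (simp add: eq(2) bilinear_ladd[OF bDx] bilinear_radd[OF bDx])
      moreover have "\<bar>DG (\<sigma> t) (\<xi> t) (\<eta> t) (z t)\<bar> \<le> K * (2 * d) * (2 * d) * 2"
        by (rule order_trans[OF DG_bound[OF x]]) (use \<xi> \<eta> z2 K d0 in \<open>intro mult_mono; auto\<close>)
      moreover have "\<bar>DG (\<sigma> t) (\<xi> t) (u t) (\<eta> t)\<bar> \<le> K * (2 * d) * 2 * (2 * d)"
        by (rule order_trans[OF DG_bound[OF x]]) (use \<xi> \<eta> u2 K d0 in \<open>intro mult_mono; auto\<close>)
      ultimately show ?thesis by (simp add: power2_eq_square)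
    qed
    have 3: "G (\<sigma> t) (z t) (z t) - G (\<sigma> t) (u t) (u t) = 2 * G (\<sigma> t) (u t) (\<eta> t) + G (\<sigma> t) (\<eta> t) (\<eta> t)"
      using G_sym[OF x, of "\<eta> t" "u t"] by (simp add: eq(2) bilinear_ladd[OF bx] bilinear_radd[OF bx])
    have 4: "\<bar>G (\<sigma> t) (\<eta> t) (\<eta> t)\<bar> \<le> 4 * K * d\<^sup>2"
    proof -
      have "\<bar>G (\<sigma> t) (\<eta> t) (\<eta> t)\<bar> \<le> K * (2 * d) * (2 * d)"
        by (rule order_trans[OF G_bound[OF x]]) (use \<eta> K d0 in \<open>intro mult_mono; auto\<close>)
      then show ?thesis by (simp add: power2_eq_square)
    qed
    have "0 \<le> K * d\<^sup>2" using K by simp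
    \<comment> \<open>The errors from 1, 2 and 4 add up to 16 + 16 + 4 = 36 multiples of
      \<open>K * d\<^sup>2\<close>.\<close>
    then have "\<bar>\<Psi>' t\<bar> \<le> 40 * K * d\<^sup>2" using 1 2 3 4 unfolding \<Psi>'_def E by linarith
    then show ?thesis by simp
  qed
  have "norm (\<Psi> 1 - \<Psi> 0) \<le> 40 * K * d\<^sup>2 * \<bar>1 - 0\<bar>"
    by (rule vector_derivative_bound[OF der bound]) auto
  moreover have "\<Psi> 0 = 0"
    using R G_bilinear[of x0] by (simp add: \<Psi>_def \<xi>_def \<tau>_def \<sigma>_def traj_0[OF v] traj_0[OF w] bilinear_rzero)
  ultimately show ?thesis
    by (simp add: \<Psi>_def d_def \<xi>_def \<sigma>_def \<tau>_def u_def abs_minus_commute)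
qed

end

section \<open>Symmetry of second derivatives\<close>

text \<open>Two applications of the mean value theorem express the second difference of
  \<open>f\<close> over a small parallelogram as a mixed derivative at a nearby point, in either
  order of differentiation; continuity of both mixed derivatives at \<open>x\<close> identifies the
  limits.\<close>

lemma real_second_derivative_symmetric:
  fixes f :: "'a::euclidean_space \<Rightarrow> real"
  assumes S: "open S" "x \<in> S"
    and f: "\<And>y. y \<in> S \<Longrightarrow> (f has_derivative f' y) (at y)"
    and fu: "\<And>y. y \<in> S \<Longrightarrow> ((\<lambda>y. f' y u) has_derivative fu y) (at y)"
    and fv: "\<And>y. y \<in> S \<Longrightarrow> ((\<lambda>y. f' y v) has_derivative fv y) (at y)"
    and cu: "isCont (\<lambda>y. fu y v) x" and cv: "isCont (\<lambda>y. fv y u) x"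
  shows "fu x v = fv x u"
proof -
  have line: "((\<lambda>s. h (p + s *\<^sub>R w)) has_real_derivative h' w) (at s)"
    if "(h has_derivative h') (at (p + s *\<^sub>R w))" for h :: "'a \<Rightarrow> real" and h' p w s
  proof -
    have "((\<lambda>s. p + s *\<^sub>R w) has_derivative (\<lambda>r. r *\<^sub>R w)) (at s)"
      by (auto intro!: derivative_eq_intros)
    from has_derivative_compose[OF this that]
    have "((\<lambda>s. h (p + s *\<^sub>R w)) has_derivative (\<lambda>r. h' (r *\<^sub>R w))) (at s)" .
    moreover have "(\<lambda>r. h' (r *\<^sub>R w)) = (*) (h' w)"
      using linear_scale[OF has_derivative_linear[OF that]] by (auto simp: fun_eq_iff mult.commute)
    ultimately show ?thesis by (simp add: has_field_derivative_def)
  qed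
  obtain e where e: "e > 0" "ball x e \<subseteq> S" using S openE by blast
  define C where "C = norm u + norm v + 1"
  have C: "C > 0" by (simp add: C_def add_nonneg_pos)
  have mixed: "\<exists>\<theta> \<theta>'. 0 \<le> \<theta> \<and> \<theta> \<le> h \<and> 0 \<le> \<theta>' \<and> \<theta>' \<le> h \<and>
      f (x + h *\<^sub>R u + h *\<^sub>R v) - f (x + h *\<^sub>R u) - f (x + h *\<^sub>R v) + f x = h * h * fu' (x + \<theta> *\<^sub>R u + \<theta>' *\<^sub>R v) v"
    if h: "0 < h" "h * C < e" and nrm: "norm u + norm v < C"
      and fu': "\<And>y. y \<in> S \<Longrightarrow> ((\<lambda>y. f' y u) has_derivative fu' y) (at y)" for h u v fu'
  proof -
    have inS: "x + s *\<^sub>R u + t *\<^sub>R v \<in> S" if "0 \<le> s" "s \<le> h" "0 \<le> t" "t \<le> h" for s t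
    proof -
      have "norm (s *\<^sub>R u + t *\<^sub>R v) \<le> s * norm u + t * norm v"
        using that norm_triangle_ineq[of "s *\<^sub>R u" "t *\<^sub>R v"] by simp
      also have "\<dots> \<le> h * norm u + h * norm v" using that by (intro add_mono mult_right_mono) auto
      also have "\<dots> \<le> h * C" using h nrm by (simp add: distrib_left[symmetric])
      finally have "norm (s *\<^sub>R u + t *\<^sub>R v) < e" using h by simp
      then have "x + s *\<^sub>R u + t *\<^sub>R v \<in> ball x e"
        unfolding mem_ball dist_commute[of x] by (simp add: dist_norm add.assoc)
      then show ?thesis using e by blast
    qed
    define a where "a s = f ((x + h *\<^sub>R v) + s *\<^sub>R u) - f (x + s *\<^sub>R u)" for s
    have "\<exists>z>0. z < h \<and> a h - a 0 = (h - 0) * (f' ((x + h *\<^sub>R v) + z *\<^sub>R u) u - f' (x + z *\<^sub>R u) u)"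
    proof (rule MVT2[OF h(1)])
      fix s assume s: "0 \<le> s" "s \<le> h"
      have "(x + h *\<^sub>R v) + s *\<^sub>R u \<in> S" "x + s *\<^sub>R u \<in> S"
        using inS[of s h] inS[of s 0] s h by (auto simp: algebra_simps)
      then show "(a has_real_derivative f' ((x + h *\<^sub>R v) + s *\<^sub>R u) u - f' (x + s *\<^sub>R u) u) (at s)"
        unfolding a_def by (intro DERIV_diff line f)
    qed
    then obtain \<theta> where \<theta>: "0 < \<theta>" "\<theta> < h" "a h - a 0 = h * (f' ((x + h *\<^sub>R v) + \<theta> *\<^sub>R u) u - f' (x + \<theta> *\<^sub>R u) u)"
      by auto
    define b where "b t = f' ((x + \<theta> *\<^sub>R u) + t *\<^sub>R v) u" for t
    have "\<exists>z>0. z < h \<and> b h - b 0 = (h - 0) * (fu' ((x + \<theta> *\<^sub>R u) + z *\<^sub>R v) v)"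
    proof (rule MVT2[OF h(1)])
      fix t assume t: "0 \<le> t" "t \<le> h"
      have "x + \<theta> *\<^sub>R u + t *\<^sub>R v \<in> S"
        using inS[of \<theta> t] t \<theta> by auto
      then show "(b has_real_derivative fu' ((x + \<theta> *\<^sub>R u) + t *\<^sub>R v) v) (at t)"
        unfolding b_def by (intro line fu')
    qed
    then obtain \<theta>' where \<theta>': "0 < \<theta>'" "\<theta>' < h" "b h - b 0 = h * fu' ((x + \<theta> *\<^sub>R u) + \<theta>' *\<^sub>R v) v"
      by auto
    have "f (x + h *\<^sub>R u + h *\<^sub>R v) - f (x + h *\<^sub>R u) - f (x + h *\<^sub>R v) + f x = a h - a 0"
      by (simp add: a_def algebra_simps)
    also have "\<dots> = h * (b h - b 0)" using \<theta>(3) by (simp add: b_def algebra_simps)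
    also have "\<dots> = h * h * fu' (x + \<theta> *\<^sub>R u + \<theta>' *\<^sub>R v) v" using \<theta>'(3) by simp
    finally show ?thesis using \<theta> \<theta>' by (intro exI[of _ \<theta>] exI[of _ \<theta>']) auto
  qed
  have close: "\<exists>d>0. \<forall>\<theta> \<theta>' h. 0 \<le> \<theta> \<and> \<theta> \<le> h \<and> 0 \<le> \<theta>' \<and> \<theta>' \<le> h \<and> h < d \<longrightarrow> \<bar>F (x + \<theta> *\<^sub>R u + \<theta>' *\<^sub>R v) - F x\<bar> < r"
    if Fc: "isCont F x" "r > 0" "norm u + norm v < C" for F :: "'a \<Rightarrow> real" and r u v
  proof -
    obtain d where d: "d > 0" "\<And>y. dist y x < d \<Longrightarrow> dist (F y) (F x) < r"
      using Fc(1,2) unfolding continuous_at_eps_delta by blast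
    have "\<bar>F (x + \<theta> *\<^sub>R u + \<theta>' *\<^sub>R v) - F x\<bar> < r" if \<theta>: "0 \<le> \<theta>" "\<theta> \<le> h" "0 \<le> \<theta>'" "\<theta>' \<le> h" "h < d / C" for \<theta> \<theta>' h
    proof -
      have "norm (\<theta> *\<^sub>R u + \<theta>' *\<^sub>R v) \<le> \<theta> * norm u + \<theta>' * norm v"
        using \<theta> norm_triangle_ineq[of "\<theta> *\<^sub>R u" "\<theta>' *\<^sub>R v"] by simp
      also have "\<dots> \<le> h * norm u + h * norm v" using \<theta> by (intro add_mono mult_right_mono) auto
      also have "\<dots> = h * (norm u + norm v)" by (simp add: distrib_left)
      also have "\<dots> \<le> h * C" using \<theta> \<open>norm u + norm v < C\<close> by (intro mult_left_mono) auto
      also have "\<dots> < d" using \<theta>(5) C by (simp add: pos_less_divide_eq)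
      finally have "dist (x + \<theta> *\<^sub>R u + \<theta>' *\<^sub>R v) x < d" by (simp add: dist_norm add.assoc)
      from d(2)[OF this] show ?thesis by (simp add: dist_real_def)
    qed
    then show ?thesis using d(1) C by (intro exI[of _ "d / C"]) auto
  qed
  have "\<bar>fu x v - fv x u\<bar> \<le> 2 * r" if r: "r > 0" for r
  proof -
    have n1: "norm u + norm v < C" and n2: "norm v + norm u < C" by (auto simp: C_def)
    obtain d1 where d1: "d1 > 0" "\<And>\<theta> \<theta>' h. 0 \<le> \<theta> \<and> \<theta> \<le> h \<and> 0 \<le> \<theta>' \<and> \<theta>' \<le> h \<and> h < d1 \<Longrightarrow> \<bar>fu (x + \<theta> *\<^sub>R u + \<theta>' *\<^sub>R v) v - fu x v\<bar> < r"
      using close[OF cu r n1] by blast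
    obtain d2 where d2: "d2 > 0" "\<And>\<theta> \<theta>' h. 0 \<le> \<theta> \<and> \<theta> \<le> h \<and> 0 \<le> \<theta>' \<and> \<theta>' \<le> h \<and> h < d2 \<Longrightarrow> \<bar>fv (x + \<theta> *\<^sub>R v + \<theta>' *\<^sub>R u) u - fv x u\<bar> < r"
      using close[OF cv r n2] by blast
    define h where "h = min (min d1 d2) (e / C) / 2"
    have m: "0 < min (min d1 d2) (e / C)" using d1(1) d2(1) e(1) C by simp
    moreover have "min (min d1 d2) (e / C) \<le> d1" "min (min d1 d2) (e / C) \<le> d2" "min (min d1 d2) (e / C) \<le> e / C"
      by auto
    ultimately have h: "0 < h" "h < d1" "h < d2" "h < e / C" by (auto simp only: h_def)
    then have hC: "h * C < e" using C by (simp add: pos_less_divide_eq)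
    obtain \<theta> \<theta>' where 1: "0 \<le> \<theta>" "\<theta> \<le> h" "0 \<le> \<theta>'" "\<theta>' \<le> h"
      "f (x + h *\<^sub>R u + h *\<^sub>R v) - f (x + h *\<^sub>R u) - f (x + h *\<^sub>R v) + f x = h * h * fu (x + \<theta> *\<^sub>R u + \<theta>' *\<^sub>R v) v"
      using mixed[OF h(1) hC n1 fu] by blast
    obtain \<eta> \<eta>' where 2: "0 \<le> \<eta>" "\<eta> \<le> h" "0 \<le> \<eta>'" "\<eta>' \<le> h"
      "f (x + h *\<^sub>R v + h *\<^sub>R u) - f (x + h *\<^sub>R v) - f (x + h *\<^sub>R u) + f x = h * h * fv (x + \<eta> *\<^sub>R v + \<eta>' *\<^sub>R u) u"
      using mixed[OF h(1) hC n2 fv] by blast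
    have "x + h *\<^sub>R v + h *\<^sub>R u = x + h *\<^sub>R u + h *\<^sub>R v" by simp
    then have "h * h * fu (x + \<theta> *\<^sub>R u + \<theta>' *\<^sub>R v) v = h * h * fv (x + \<eta> *\<^sub>R v + \<eta>' *\<^sub>R u) u"
      using 1(5) 2(5) by (simp only:)
    then have "fu (x + \<theta> *\<^sub>R u + \<theta>' *\<^sub>R v) v = fv (x + \<eta> *\<^sub>R v + \<eta>' *\<^sub>R u) u" using h(1) by simp
    moreover have "\<bar>fu (x + \<theta> *\<^sub>R u + \<theta>' *\<^sub>R v) v - fu x v\<bar> < r" using d1(2)[of \<theta> h \<theta>'] 1 h by blast
    moreover have "\<bar>fv (x + \<eta> *\<^sub>R v + \<eta>' *\<^sub>R u) u - fv x u\<bar> < r" using d2(2)[of \<eta> h \<eta>'] 2 h by blast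
    ultimately show ?thesis by linarith
  qed
  from this[of "r / 2" for r] have "\<bar>fu x v - fv x u\<bar> \<le> 0 + r" if "r > 0" for r
    using that by simp
  then have "\<bar>fu x v - fv x u\<bar> \<le> 0" by (rule field_le_epsilon)
  then show ?thesis by simp
qed

lemma second_derivative_symmetric:
  fixes f :: "'a::euclidean_space \<Rightarrow> 'b::euclidean_space"
  assumes S: "open S" "x \<in> S" and f: "Ck_on 2 S f"
  shows "frechet_derivative (\<lambda>y. frechet_derivative f (at y) v) (at x) u =
         frechet_derivative (\<lambda>y. frechet_derivative f (at y) u) (at x) v"
proof (rule euclidean_eqI)
  fix i :: 'b assume "i \<in> Basis"
  have d1: "\<And>y. y \<in> S \<Longrightarrow> (f has_derivative frechet_derivative f (at y)) (at y)"
    and d2: "\<And>y w. y \<in> S \<Longrightarrow> ((\<lambda>y. frechet_derivative f (at y) w) has_derivative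
          frechet_derivative (\<lambda>y. frechet_derivative f (at y) w) (at y)) (at y)"
    and d3: "\<And>w z. continuous_on S (\<lambda>y. frechet_derivative (\<lambda>y. frechet_derivative f (at y) w) (at y) z)"
    using f by (auto simp: numeral_2_eq_2 frechet_derivative_works)
  have c: "isCont (\<lambda>y. frechet_derivative (\<lambda>y. frechet_derivative f (at y) w) (at y) z \<bullet> i) x" for w z
    using d3 S by (intro continuous_intros) (simp add: continuous_on_eq_continuous_at)
  show "frechet_derivative (\<lambda>y. frechet_derivative f (at y) v) (at x) u \<bullet> i =
        frechet_derivative (\<lambda>y. frechet_derivative f (at y) u) (at x) v \<bullet> i"
    by (rule real_second_derivative_symmetric[where f = "\<lambda>y. f y \<bullet> i" and f' = "\<lambda>y w. frechet_derivative f (at y) w \<bullet> i", OF S])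
      (auto intro!: has_derivative_inner_left d1 d2 c)
qed

section \<open>Calculus in charts\<close>

locale lorentz_manifold =
  fixes A :: "('m::{t2_space, second_countable_topology}, 'e::euclidean_space) chart set"
    and g :: "('m, 'e) metric"
  assumes atlas: "smooth_atlas A" and metric: "C11_lorentz_metric A g"
begin

definition overlap :: "('m, 'e) chart \<Rightarrow> ('m, 'e) chart \<Rightarrow> 'e set" where
  "overlap c c' = snd c ` (fst c \<inter> fst c')"

definition trans :: "('m, 'e) chart \<Rightarrow> ('m, 'e) chart \<Rightarrow> 'e \<Rightarrow> 'e" where
  "trans c c' = snd c' \<circ> chart_inv c"

definition dtrans :: "('m, 'e) chart \<Rightarrow> ('m, 'e) chart \<Rightarrow> 'e \<Rightarrow> 'e \<Rightarrow> 'e" where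
  "dtrans c c' x v = frechet_derivative (trans c c') (at x) v"

text \<open>The first vector is the direction of differentiation, the second is the argument of the
  first derivative.\<close>

definition ddtrans :: "('m, 'e) chart \<Rightarrow> ('m, 'e) chart \<Rightarrow> 'e \<Rightarrow> 'e \<Rightarrow> 'e \<Rightarrow> 'e" where
  "ddtrans c c' x w v = frechet_derivative (\<lambda>y. dtrans c c' y v) (at x) w"

lemma transition_deriv_eq: "transition_deriv c c' p = dtrans c c' (snd c p)"
  by (auto simp: transition_deriv_def dtrans_def trans_def)

context
  fixes c assumes c: "c \<in> A"
begin

lemma chart: "is_chart c"
  using atlas c by (auto simp: smooth_atlas_def)

lemma open_chart_dom: "open (fst c)" and open_chart_image: "open (snd c ` fst c)"
  using chart by (auto simp: is_chart_def)

lemma chart_hom: "homeomorphism (fst c) (snd c ` fst c) (snd c) (chart_inv c)"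
  using chart by (auto simp: is_chart_def)

lemma chart_inv_left: "p \<in> fst c \<Longrightarrow> chart_inv c (snd c p) = p"
  by (rule homeomorphism_apply1[OF chart_hom])

lemma chart_inv_right: "x \<in> snd c ` fst c \<Longrightarrow> snd c (chart_inv c x) = x"
  by (rule homeomorphism_apply2[OF chart_hom])

lemma chart_inv_in: "x \<in> snd c ` fst c \<Longrightarrow> chart_inv c x \<in> fst c"
  using homeomorphism_image2[OF chart_hom] by blast

lemma continuous_on_chart: "continuous_on (fst c) (snd c)"
  by (rule homeomorphism_cont1[OF chart_hom])

lemma continuous_on_chart_inv: "continuous_on (snd c ` fst c) (chart_inv c)"
  by (rule homeomorphism_cont2[OF chart_hom])

lemma open_chart_image_subset:
  assumes "open U" "U \<subseteq> fst c" shows "open (snd c ` U)"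
proof -
  have "snd c ` U = (snd c ` fst c) \<inter> chart_inv c -` U"
    using assms(2) chart_inv_left chart_inv_right chart_inv_in by (force simp: image_iff)
  then show ?thesis
    using continuous_open_preimage[OF continuous_on_chart_inv open_chart_image assms(1)] by (simp add: Int_commute)
qed

lemma open_chart_inv_image:
  assumes "open U" "U \<subseteq> snd c ` fst c" shows "open (chart_inv c ` U)"
proof -
  have "chart_inv c ` U = fst c \<inter> snd c -` U"
  proof (intro equalityI subsetI)
    fix q assume "q \<in> fst c \<inter> snd c -` U"
    then show "q \<in> chart_inv c ` U" using chart_inv_left[of q] by force
  qed (use assms(2) chart_inv_right chart_inv_in in auto)
  then show ?thesis
    using continuous_open_preimage[OF continuous_on_chart open_chart_dom assms(1)] by simp
qed

context
  fixes c' assumes c': "c' \<in> A"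
begin

lemma open_overlap: "open (overlap c c')"
  unfolding overlap_def
  by (rule open_chart_image_subset) (use c' atlas in \<open>auto simp: open_chart_dom smooth_atlas_def is_chart_def\<close>)

lemma overlapI: "p \<in> fst c \<Longrightarrow> p \<in> fst c' \<Longrightarrow> snd c p \<in> overlap c c'"
  by (auto simp: overlap_def)

lemma overlapD: "x \<in> overlap c c' \<Longrightarrow> x \<in> snd c ` fst c \<and> chart_inv c x \<in> fst c \<and> chart_inv c x \<in> fst c'"
  by (auto simp: overlap_def chart_inv_left)

lemma trans_smooth: "Ck_on k (overlap c c') (trans c c')"
  using atlas c c' unfolding smooth_atlas_def smooth_on_def overlap_def trans_def by blast

lemma trans_has_derivative: "x \<in> overlap c c' \<Longrightarrow> (trans c c' has_derivative dtrans c c' x) (at x)"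
  using trans_smooth[of 1] frechet_derivative_works[of "trans c c'" "at x"]
  by (auto simp: dtrans_def[abs_def])

lemma dtrans_has_derivative:
  "x \<in> overlap c c' \<Longrightarrow> ((\<lambda>y. dtrans c c' y v) has_derivative (\<lambda>w. ddtrans c c' x w v)) (at x)"
  using trans_smooth[of 2] frechet_derivative_works[of "\<lambda>y. dtrans c c' y v" "at x"]
  by (auto simp: dtrans_def[abs_def] ddtrans_def[abs_def] numeral_2_eq_2)

lemma dtrans_linear: "x \<in> overlap c c' \<Longrightarrow> linear (dtrans c c' x)"
  using trans_has_derivative has_derivative_linear by blast

lemma ddtrans_sym: "x \<in> overlap c c' \<Longrightarrow> ddtrans c c' x u v = ddtrans c c' x v u"
  unfolding ddtrans_def dtrans_def
  by (rule second_derivative_symmetric[OF open_overlap _ trans_smooth])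

lemma dtrans_expand: "x \<in> overlap c c' \<Longrightarrow> dtrans c c' x v = (\<Sum>i\<in>Basis. (v \<bullet> i) *\<^sub>R dtrans c c' x i)"
  using linear_sum[OF dtrans_linear, of x "\<lambda>i. (v \<bullet> i) *\<^sub>R i" Basis] linear_scale[OF dtrans_linear, of x]
  by (simp add: euclidean_representation)

lemma ddtrans_expand:
  assumes x: "x \<in> overlap c c'"
  shows "ddtrans c c' x w v = (\<Sum>i\<in>Basis. (v \<bullet> i) *\<^sub>R ddtrans c c' x w i)"
proof -
  have "((\<lambda>y. \<Sum>i\<in>Basis. (v \<bullet> i) *\<^sub>R dtrans c c' y i) has_derivative
      (\<lambda>w. \<Sum>i\<in>Basis. (v \<bullet> i) *\<^sub>R ddtrans c c' x w i)) (at x)"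
    by (intro has_derivative_sum has_derivative_scaleR_right dtrans_has_derivative x)
  then have "((\<lambda>y. dtrans c c' y v) has_derivative (\<lambda>w. \<Sum>i\<in>Basis. (v \<bullet> i) *\<^sub>R ddtrans c c' x w i)) (at x)"
    by (rule has_derivative_transform_within_open[OF _ open_overlap x]) (simp add: dtrans_expand[symmetric])
  from has_derivative_unique[OF this dtrans_has_derivative[OF x]] show ?thesis by metis
qed

lemma trans_in: "x \<in> overlap c c' \<Longrightarrow> trans c c' x \<in> overlap c' c"
  by (auto simp: trans_def overlap_def chart_inv_left)

text \<open>The second term is the inhomogeneous part in the transformation of accelerations. The
  derivative is known for each basis vector, and the expansion in them holds on the overlap, hence
  the restriction to times near \<open>t\<close>.\<close>

lemma dtrans_along_derivative:
  assumes \<sigma>: "(\<sigma> has_vector_derivative \<sigma>') (at t within S)" and u: "(u has_vector_derivative u') (at t within S)"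
    and t: "t \<in> S" and x: "\<sigma> t \<in> overlap c c'"
  shows "((\<lambda>s. dtrans c c' (\<sigma> s) (u s)) has_vector_derivative
      (dtrans c c' (\<sigma> t) u' + ddtrans c c' (\<sigma> t) \<sigma>' (u t))) (at t within S)"
proof -
  have comp: "((\<lambda>s. u s \<bullet> i) has_real_derivative u' \<bullet> i) (at t within S)" for i
    using bounded_linear.has_vector_derivative[OF bounded_linear_inner_left u, of i]
    by (simp add: has_real_derivative_iff_has_vector_derivative)
  have di: "((\<lambda>s. dtrans c c' (\<sigma> s) i) has_vector_derivative ddtrans c c' (\<sigma> t) \<sigma>' i) (at t within S)" for i
  proof -
    have "((\<lambda>s. dtrans c c' (\<sigma> s) i) has_derivative (\<lambda>h. ddtrans c c' (\<sigma> t) (h *\<^sub>R \<sigma>') i)) (at t within S)"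
      using has_derivative_compose[OF \<sigma>[unfolded has_vector_derivative_def] dtrans_has_derivative[OF x]] .
    then show ?thesis
      unfolding has_vector_derivative_def
      using linear_scale[OF has_derivative_linear[OF dtrans_has_derivative[OF x]]] by simp
  qed
  have sd: "((\<lambda>s. \<Sum>i\<in>Basis. (u s \<bullet> i) *\<^sub>R dtrans c c' (\<sigma> s) i) has_vector_derivative
     (\<Sum>i\<in>Basis. (u t \<bullet> i) *\<^sub>R ddtrans c c' (\<sigma> t) \<sigma>' i + (u' \<bullet> i) *\<^sub>R dtrans c c' (\<sigma> t) i)) (at t within S)"
    by (intro has_vector_derivative_sum has_vector_derivative_scaleR comp di)
  have se: "(\<Sum>i\<in>Basis. (u t \<bullet> i) *\<^sub>R ddtrans c c' (\<sigma> t) \<sigma>' i + (u' \<bullet> i) *\<^sub>R dtrans c c' (\<sigma> t) i) =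
      dtrans c c' (\<sigma> t) u' + ddtrans c c' (\<sigma> t) \<sigma>' (u t)"
    unfolding dtrans_expand[OF x, of u'] ddtrans_expand[OF x, of \<sigma>' "u t"] by (simp add: sum.distrib add.commute)
  obtain d where d: "d > 0" "\<And>s. s \<in> S \<Longrightarrow> dist s t < d \<Longrightarrow> \<sigma> s \<in> overlap c c'"
  proof -
    have "(\<sigma> \<longlongrightarrow> \<sigma> t) (at t within S)"
      using has_vector_derivative_continuous[OF \<sigma>] by (simp add: continuous_within)
    then have "\<forall>\<^sub>F s in at t within S. \<sigma> s \<in> overlap c c'"
      using open_overlap x by (rule topological_tendstoD)
    then obtain d where "d > 0" "\<forall>s\<in>S. s \<noteq> t \<and> dist s t < d \<longrightarrow> \<sigma> s \<in> overlap c c'"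
      unfolding eventually_at by blast
    then show thesis using that[of d] x by metis
  qed
  show ?thesis
    using sd unfolding se has_vector_derivative_def
    by (rule has_derivative_transform_within[OF _ d(1) t]) (rule dtrans_expand[OF d(2), symmetric])
qed

lemma trans_along_derivative:
  assumes \<sigma>: "(\<sigma> has_vector_derivative \<sigma>') (at t within S)" and x: "\<sigma> t \<in> overlap c c'"
  shows "((\<lambda>s. trans c c' (\<sigma> s)) has_vector_derivative dtrans c c' (\<sigma> t) \<sigma>') (at t within S)"
  using has_derivative_compose[OF \<sigma>[unfolded has_vector_derivative_def] trans_has_derivative[OF x]]
    linear_scale[OF dtrans_linear[OF x]]
  by (simp add: has_vector_derivative_def)

end

lemma dtrans_id: "x \<in> snd c ` fst c \<Longrightarrow> dtrans c c x v = v"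
proof -
  assume x: "x \<in> snd c ` fst c"
  have "(trans c c has_derivative id) (at x)"
    by (rule has_derivative_transform_within_open[OF has_derivative_id open_chart_image x])
      (simp add: trans_def chart_inv_right)
  moreover have "(trans c c has_derivative dtrans c c x) (at x)"
    using x by (intro trans_has_derivative c) (auto simp: overlap_def)
  ultimately show ?thesis by (metis has_derivative_unique id_apply)
qed

end

text \<open>The chain rule for chart changes. With \<open>c'' = c\<close> it inverts a change of
  charts, and it makes \<open>tvec_of\<close> a compatible family.\<close>

lemma dtrans_comp:
  assumes c: "c \<in> A" "c' \<in> A" "c'' \<in> A" and p: "p \<in> fst c" "p \<in> fst c'" "p \<in> fst c''"
  shows "dtrans c' c'' (snd c' p) (dtrans c c' (snd c p) v) = dtrans c c'' (snd c p) v"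
proof -
  let ?D = "overlap c c' \<inter> overlap c c''"
  have "open ?D" by (intro open_Int open_overlap c)
  have "snd c p \<in> ?D" by (intro IntI overlapI c p)
  have eq: "trans c c' (snd c p) = snd c' p" by (simp add: trans_def chart_inv_left[OF c(1) p(1)])
  have "((\<lambda>x. trans c' c'' (trans c c' x)) has_derivative
      (\<lambda>v. dtrans c' c'' (snd c' p) (dtrans c c' (snd c p) v))) (at (snd c p))"
    using has_derivative_compose[OF trans_has_derivative[OF c(1,2) overlapI[OF c(1,2) p(1,2)]],
        of "trans c' c''" "dtrans c' c'' (snd c' p)"]
      trans_has_derivative[OF c(2,3) overlapI[OF c(2,3) p(2,3)]] eq by simp
  then have "(trans c c'' has_derivative
      (\<lambda>v. dtrans c' c'' (snd c' p) (dtrans c c' (snd c p) v))) (at (snd c p))"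
  proof (rule has_derivative_transform_within_open[OF _ \<open>open ?D\<close> \<open>snd c p \<in> ?D\<close>])
    fix x assume "x \<in> ?D"
    then show "trans c' c'' (trans c c' x) = trans c c'' x"
      using overlapD[OF c(1,2), of x] by (simp add: trans_def chart_inv_left[OF c(2)])
  qed
  from has_derivative_unique[OF this trans_has_derivative[OF c(1,3) overlapI[OF c(1,3) p(1,3)]]]
  show ?thesis by metis
qed

section \<open>Tangent vectors and their coordinates\<close>

lemma charts_at_iff: "c \<in> charts_at A p \<longleftrightarrow> c \<in> A \<and> p \<in> fst c"
  by (auto simp: charts_at_def)

lemma dtrans_inverse:
  assumes "c \<in> charts_at A p" "c' \<in> charts_at A p"
  shows "dtrans c' c (snd c' p) (dtrans c c' (snd c p) v) = v"
  using assms dtrans_comp[of c c' c p v] dtrans_id[of c "snd c p" v] by (auto simp: charts_at_iff)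

lemma tvec_of_tangent:
  assumes c: "c \<in> charts_at A p" shows "tvec_of A c p e \<in> tangent_space A p"
  using c dtrans_comp[of c _ _ p e] by (auto simp: tangent_space_def tvec_of_def transition_deriv_eq charts_at_iff)

lemma tvec_of_coord:
  assumes c: "c \<in> charts_at A p" shows "tvec_of A c p e c = e"
  using c dtrans_id[of c "snd c p" e] by (auto simp: tvec_of_def transition_deriv_eq charts_at_iff)

lemma tvec_of_tangent_coord:
  assumes c: "c \<in> charts_at A p" and v: "v \<in> tangent_space A p" shows "tvec_of A c p (v c) = v"
proof
  fix c'
  have "v c' = transition_deriv c c' p (v c)" if "c' \<in> charts_at A p"
    using v c that unfolding tangent_space_def by blast
  moreover have "v c' = 0" if "c' \<notin> charts_at A p" using v that unfolding tangent_space_def by blast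
  ultimately show "tvec_of A c p (v c) c' = v c'" unfolding tvec_of_def by presburger
qed

lemma tvec_of_change:
  assumes c: "c \<in> charts_at A p" "c' \<in> charts_at A p"
  shows "tvec_of A c' p (dtrans c c' (snd c p) e) = tvec_of A c p e"
  using c dtrans_comp[of c c' _ p e] by (auto simp: tvec_of_def fun_eq_iff transition_deriv_eq charts_at_iff)

lemma tvec_of_eq_zero_iff:
  assumes c: "c \<in> charts_at A p" shows "tvec_of A c p e = (\<lambda>c. 0) \<longleftrightarrow> e = 0"
proof
  assume "tvec_of A c p e = (\<lambda>c. 0)"
  then show "e = 0" using tvec_of_coord[OF c, of e] by simp
next
  assume "e = 0"
  then show "tvec_of A c p e = (\<lambda>c. 0)"
    using c linear_0[OF dtrans_linear[OF _ _ overlapI]] by (auto simp: tvec_of_def fun_eq_iff transition_deriv_eq charts_at_iff)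
qed

section \<open>The metric, its derivative and the Christoffel symbols in a chart\<close>

abbreviation G where "G \<equiv> local_metric A g"
abbreviation DG where "DG \<equiv> metric_deriv A g"
abbreviation \<Gamma> where "\<Gamma> \<equiv> christoffel A g"

lemma metric_eq_G:
  assumes c: "c \<in> charts_at A p" and v: "v \<in> tangent_space A p" "w \<in> tangent_space A p"
  shows "g p v w = G c (snd c p) (v c) (w c)"
  using c by (simp add: local_metric_def charts_at_iff chart_inv_left tvec_of_tangent_coord[OF c] v)

lemma G_transform:
  assumes c: "c \<in> A" "c' \<in> A" and x: "x \<in> overlap c c'"
  shows "G c x u v = G c' (trans c c' x) (dtrans c c' x u) (dtrans c c' x v)"
proof -
  have p: "chart_inv c x \<in> fst c" "chart_inv c x \<in> fst c'" "snd c (chart_inv c x) = x"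
    using overlapD[OF c x] chart_inv_right[OF c(1)] by auto
  have "chart_inv c' (trans c c' x) = chart_inv c x"
    using p chart_inv_left[OF c(2)] by (simp add: trans_def)
  then show ?thesis
    using tvec_of_change[of c "chart_inv c x" c'] p c by (simp add: local_metric_def charts_at_iff)
qed

context
  fixes c assumes c: "c \<in> A"
begin

lemma G_lorentz: "x \<in> snd c ` fst c \<Longrightarrow> lorentz_form (G c x)"
  using metric c by (auto simp: C11_lorentz_metric_def)

lemma G_bilinear: "x \<in> snd c ` fst c \<Longrightarrow> bilinear (G c x)"
  using G_lorentz by (auto simp: lorentz_form_def)

lemma G_sym: "x \<in> snd c ` fst c \<Longrightarrow> G c x u v = G c x v u"
  using G_lorentz by (auto simp: lorentz_form_def)

lemma G_C11:
  assumes "i \<in> Basis" "j \<in> Basis"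
  shows "x \<in> snd c ` fst c \<Longrightarrow> (\<lambda>x. G c x i j) differentiable (at x)"
    "locally_lipschitz_on (snd c ` fst c) (\<lambda>x. DG c x w i j)"
  using metric c assms by (auto simp: C11_lorentz_metric_def C11_on_def metric_deriv_def)

text \<open>Regularity is postulated for the entries on basis vectors; bilinearity of the metric
  carries it to all arguments and shows that the derivative is again a form in them.\<close>

lemma DG_expand:
  assumes x: "x \<in> snd c ` fst c"
  shows "((\<lambda>y. G c y u v) has_derivative (\<lambda>w. \<Sum>i\<in>Basis. \<Sum>j\<in>Basis. (u \<bullet> i) * (v \<bullet> j) * DG c x w i j)) (at x)"
proof -
  have "((\<lambda>y. G c y i j) has_derivative (\<lambda>w. DG c x w i j)) (at x)" if "i \<in> Basis" "j \<in> Basis" for i j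
    using G_C11(1)[OF that x] by (simp add: frechet_derivative_works metric_deriv_def[abs_def])
  then have "((\<lambda>y. \<Sum>i\<in>Basis. \<Sum>j\<in>Basis. (u \<bullet> i) * (v \<bullet> j) * G c y i j) has_derivative
      (\<lambda>w. \<Sum>i\<in>Basis. \<Sum>j\<in>Basis. (u \<bullet> i) * (v \<bullet> j) * DG c x w i j)) (at x)"
    by (intro has_derivative_sum has_derivative_mult_right) auto
  then show ?thesis
    by (rule has_derivative_transform_within_open[OF _ open_chart_image[OF c] x])
      (simp add: bilinear_expand[OF G_bilinear, symmetric])
qed

lemma DG_eq:
  assumes x: "x \<in> snd c ` fst c"
  shows "DG c x w u v = (\<Sum>i\<in>Basis. \<Sum>j\<in>Basis. (u \<bullet> i) * (v \<bullet> j) * DG c x w i j)"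
  using fun_cong[OF frechet_derivative_at[OF DG_expand[OF x, of u v], symmetric], of w]
  by (simp only: metric_deriv_def)

lemma G_has_derivative:
  assumes x: "x \<in> snd c ` fst c" shows "((\<lambda>y. G c y u v) has_derivative (\<lambda>w. DG c x w u v)) (at x)"
proof -
  have "(\<lambda>w. DG c x w u v) = (\<lambda>w. \<Sum>i\<in>Basis. \<Sum>j\<in>Basis. (u \<bullet> i) * (v \<bullet> j) * DG c x w i j)"
    by (intro ext DG_eq[OF x])
  then show ?thesis using DG_expand[OF x, of u v] by (simp only:)
qed

lemma DG_linear: "x \<in> snd c ` fst c \<Longrightarrow> linear (\<lambda>w. DG c x w u v)"
  using G_has_derivative has_derivative_linear by blast

lemma DG_bilinear:
  assumes x: "x \<in> snd c ` fst c" shows "bilinear (DG c x w)"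
proof -
  define M where "M i j = DG c x w i j" for i j
  have "DG c x w = (\<lambda>u v. \<Sum>i\<in>Basis. \<Sum>j\<in>Basis. (u \<bullet> i) * (v \<bullet> j) * M i j)"
    unfolding M_def by (intro ext DG_eq[OF x])
  moreover have "bilinear (\<lambda>u v::'e. \<Sum>i\<in>Basis. \<Sum>j\<in>Basis. (u \<bullet> i) * (v \<bullet> j) * M i j)"
    unfolding bilinear_def
    by (auto intro!: linearI simp: inner_add_left distrib_left distrib_right sum.distrib sum_distrib_left mult_ac)
  ultimately show ?thesis by simp
qed

lemma DG_sym:
  assumes x: "x \<in> snd c ` fst c" shows "DG c x w u v = DG c x w v u"
proof -
  have "((\<lambda>y. G c y u v) has_derivative (\<lambda>w. DG c x w v u)) (at x)"
    by (rule has_derivative_transform_within_open[OF G_has_derivative[OF x, of v u] open_chart_image[OF c] x]) (rule G_sym)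
  from has_derivative_unique[OF this G_has_derivative[OF x]] show ?thesis by metis
qed

text \<open>The right-hand side is linear in \<open>w\<close>, so \<open>lorentz_form_riesz\<close>
  justifies the definite description.\<close>

lemma christoffel_eq:
  assumes x: "x \<in> snd c ` fst c"
  shows "G c x (\<Gamma> c x u v) w = 1/2 * (DG c x u v w + DG c x v u w - DG c x w u v)"
proof -
  have "linear (\<lambda>w. 1/2 * (DG c x u v w + DG c x v u w - DG c x w u v))"
    by (intro linearI)
      (auto simp: bilinear_radd[OF DG_bilinear[OF x]] bilinear_rmul[OF DG_bilinear[OF x]]
        linear_add[OF DG_linear[OF x]] linear_scale[OF DG_linear[OF x]] algebra_simps)
  from theI'[OF lorentz_form_riesz[OF G_lorentz[OF x] this]] show ?thesis
    unfolding christoffel_def by blast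
qed

lemma spray_eq: "x \<in> snd c ` fst c \<Longrightarrow> G c x (\<Gamma> c x u u) w = DG c x u u w - DG c x w u u / 2"
  by (simp add: christoffel_eq)

lemma spray_unique:
  assumes x: "x \<in> snd c ` fst c" and z: "\<And>w. G c x z w = DG c x u u w - DG c x w u u / 2"
  shows "z = \<Gamma> c x u u"
proof -
  have "z - \<Gamma> c x u u = 0"
    by (rule lorentz_form_nondegenerate[OF G_lorentz[OF x]])
      (simp add: bilinear_lsub[OF G_bilinear[OF x]] z spray_eq[OF x])
  then show ?thesis by simp
qed

end

text \<open>The transformation law \<open>G_transform\<close> is differentiated along the line
  through \<open>x\<close> in direction \<open>w\<close>; the two extra terms come from the varying
  derivative of the chart change.\<close>

lemma DG_transform:
  assumes c: "c \<in> A" "c' \<in> A" and x: "x \<in> overlap c c'"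
  defines "y \<equiv> trans c c' x" and "T \<equiv> dtrans c c' x" and "D \<equiv> ddtrans c c' x"
  shows "DG c x w a b = DG c' y (T w) (T a) (T b) + G c' y (D w a) (T b) + G c' y (T a) (D w b)"
proof -
  define S where "S = {s. x + s *\<^sub>R w \<in> overlap c c'}"
  have "open S"
    unfolding S_def using continuous_open_vimage[OF open_overlap[OF c], of "\<lambda>s. x + s *\<^sub>R w"]
    by (auto simp: vimage_def intro!: continuous_intros)
  have S0: "0 \<in> S" using x by (simp add: S_def)
  have line: "((\<lambda>s. x + s *\<^sub>R w) has_vector_derivative w) (at 0 within S)"
    by (auto intro!: derivative_eq_intros)
  have xi: "x \<in> snd c ` fst c" using overlapD[OF c x] by simp
  have yi: "y \<in> snd c' ` fst c'" using overlapD[OF c(2,1) trans_in[OF c x]] by (simp add: y_def)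
  have 1: "((\<lambda>s. G c (x + s *\<^sub>R w) a b) has_real_derivative DG c x w a b) (at 0 within S)"
    using has_derivative_compose[OF line[unfolded has_vector_derivative_def], of "\<lambda>y. G c y a b" "\<lambda>w. DG c x w a b"]
      G_has_derivative[OF c(1) xi, of a b] linear_scale[OF DG_linear[OF c(1) xi, of a b]]
    by (simp add: has_field_derivative_def mult_commute_abs mult.commute)
  have 2: "((\<lambda>s. G c' (trans c c' (x + s *\<^sub>R w)) (dtrans c c' (x + s *\<^sub>R w) a) (dtrans c c' (x + s *\<^sub>R w) b))
      has_real_derivative (DG c' y (T w) (T a) (T b) + G c' y (D w a) (T b) + G c' y (T a) (D w b))) (at 0 within S)"
  proof -
    have 1: "((\<lambda>s. trans c c' (x + s *\<^sub>R w)) has_vector_derivative T w) (at 0 within S)"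
      using trans_along_derivative[OF c line] x by (simp add: T_def)
    have 2: "((\<lambda>s. dtrans c c' (x + s *\<^sub>R w) a) has_vector_derivative D w a) (at 0 within S)" for a
      using dtrans_along_derivative[OF c line has_vector_derivative_const[of a] S0] x linear_0[OF dtrans_linear[OF c x]]
      by (simp add: D_def)
    have img: "(\<lambda>s. trans c c' (x + s *\<^sub>R w)) ` S \<subseteq> snd c' ` fst c'"
      using overlapD[OF c(2,1) trans_in[OF c]] by (auto simp: S_def)
    show ?thesis
      using bilinear_along_derivative[where \<Omega> = "snd c' ` fst c'" and G="G c'" and D="DG c' y" and t=0 and S=S,
          OF G_bilinear[OF c(2)] DG_bilinear[OF c(2) yi] _ 1 img S0 2 2]
        has_derivative_at_withinI[OF G_has_derivative[OF c(2) yi]]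
      by (simp add: y_def T_def)
  qed
  have eq: "((\<lambda>s. G c' (trans c c' (x + s *\<^sub>R w)) (dtrans c c' (x + s *\<^sub>R w) a) (dtrans c c' (x + s *\<^sub>R w) b))
      has_real_derivative d) (at 0 within S) \<longleftrightarrow> ((\<lambda>s. G c (x + s *\<^sub>R w) a b) has_real_derivative d) (at 0 within S)" for d
    by (rule has_field_derivative_cong_eventually)
      (auto simp: eventually_at_filter S_def G_transform[OF c] x)
  show ?thesis
    using DERIV_unique[OF 1[unfolded at_within_open[OF S0 \<open>open S\<close>]]
        2[unfolded eq, unfolded at_within_open[OF S0 \<open>open S\<close>]]] .
qed

text \<open>The symmetry of the second derivative makes the two mixed terms cancel.\<close>

lemma spray_transform:
  assumes c: "c \<in> A" "c' \<in> A" and x: "x \<in> overlap c c'"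
  shows "dtrans c c' x (\<Gamma> c x u u) = \<Gamma> c' (trans c c' x) (dtrans c c' x u) (dtrans c c' x u) + ddtrans c c' x u u"
proof -
  define y where "y = trans c c' x"
  have xi: "x \<in> snd c ` fst c" using overlapD[OF c x] by simp
  have yo: "y \<in> overlap c' c" using trans_in[OF c x] by (simp add: y_def)
  have yi: "y \<in> snd c' ` fst c'" using overlapD[OF c(2,1) yo] by simp
  note bl = G_bilinear[OF c(2) yi]
  have inv: "dtrans c c' x (dtrans c' c y w) = w" for w
  proof -
    have p: "chart_inv c x \<in> fst c" "chart_inv c x \<in> fst c'" "snd c (chart_inv c x) = x"
      using overlapD[OF c x] chart_inv_right[OF c(1)] by auto
    then show ?thesis
      using dtrans_inverse[of c' "chart_inv c x" c w] c by (simp add: charts_at_iff y_def trans_def)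
  qed
  have "dtrans c c' x (\<Gamma> c x u u) - ddtrans c c' x u u = \<Gamma> c' y (dtrans c c' x u) (dtrans c c' x u)"
  proof (rule spray_unique[OF c(2) yi])
    fix w'
    define w where "w = dtrans c' c y w'"
    have w': "w' = dtrans c c' x w" by (simp add: w_def inv)
    have "G c' y (dtrans c c' x (\<Gamma> c x u u)) w' = G c x (\<Gamma> c x u u) w"
      by (simp add: w' G_transform[OF c x] y_def)
    also have "\<dots> = DG c x u u w - DG c x w u u / 2" by (rule spray_eq[OF c(1) xi])
    finally show "G c' y (dtrans c c' x (\<Gamma> c x u u) - ddtrans c c' x u u) w' =
       DG c' y (dtrans c c' x u) (dtrans c c' x u) w' - DG c' y w' (dtrans c c' x u) (dtrans c c' x u) / 2"
      using DG_transform[OF c x, of u u w] DG_transform[OF c x, of w u u] ddtrans_sym[OF c x, of u w]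
        G_sym[OF c(2) yi, of "ddtrans c c' x w u" "dtrans c c' x u"]
      by (simp add: bilinear_lsub[OF bl] w'[symmetric] y_def[symmetric] add_divide_distrib)
  qed
  then show ?thesis by (simp add: y_def algebra_simps)
qed

end

section \<open>Local bounds for the metric and the Christoffel symbols\<close>

lemma common_lipschitz_ball:
  fixes F :: "'i \<Rightarrow> 'a::euclidean_space \<Rightarrow> 'b::euclidean_space"
  assumes "finite I" "open \<Omega>" "x \<in> \<Omega>" and F: "\<And>i. i \<in> I \<Longrightarrow> locally_lipschitz_on \<Omega> (F i)"
  shows "\<exists>r>0. \<exists>L. cball x r \<subseteq> \<Omega> \<and> 0 \<le> L \<and> (\<forall>i\<in>I. L-lipschitz_on (cball x r) (F i))"
  using \<open>finite I\<close> F
proof (induction I)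
  case empty
  obtain r where "r > 0" "cball x r \<subseteq> \<Omega>" using \<open>open \<Omega>\<close> \<open>x \<in> \<Omega>\<close> open_contains_cball by blast
  then show ?case by (intro exI[of _ r] conjI exI[of _ 0]) auto
next
  case (insert i I)
  then obtain r L where r: "r > 0" "cball x r \<subseteq> \<Omega>" "0 \<le> L" "\<forall>i\<in>I. L-lipschitz_on (cball x r) (F i)" by blast
  obtain e L' where e: "e > 0" "L'-lipschitz_on (\<Omega> \<inter> ball x e) (F i)"
    using insert.prems[of i] \<open>x \<in> \<Omega>\<close> unfolding locally_lipschitz_on_def by blast
  define s where "s = min r (e/2)"
  have s: "s > 0" "cball x s \<subseteq> cball x r" "cball x s \<subseteq> \<Omega> \<inter> ball x e"
    using r e by (auto simp: s_def)
  have "(max L L')-lipschitz_on (cball x s) (F i)"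
    by (rule lipschitz_on_mono[OF e(2) s(3)]) simp
  moreover have "(max L L')-lipschitz_on (cball x s) (F j)" if "j \<in> I" for j
    by (rule lipschitz_on_mono[OF r(4)[rule_format, OF that] s(2)]) simp
  ultimately show ?case
    using s r by (intro exI[of _ s] conjI exI[of _ "max L L'"]) auto
qed

lemma bilinear_form_bound:
  fixes u v :: "'e::euclidean_space"
  assumes "\<And>i j. i \<in> Basis \<Longrightarrow> j \<in> Basis \<Longrightarrow> \<bar>T i j\<bar> \<le> M" "0 \<le> M"
  shows "\<bar>\<Sum>i\<in>Basis. \<Sum>j\<in>Basis. (u \<bullet> i) * (v \<bullet> j) * T i j\<bar> \<le> real DIM('e) ^ 2 * M * norm u * norm v"
proof -
  have "\<bar>\<Sum>i\<in>Basis. \<Sum>j\<in>Basis. (u \<bullet> i) * (v \<bullet> j) * T i j\<bar> \<le> (\<Sum>i\<in>Basis. \<Sum>j\<in>Basis. \<bar>(u \<bullet> i) * (v \<bullet> j) * T i j\<bar>)"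
    by (intro order_trans[OF sum_abs] sum_mono sum_abs)
  also have "\<dots> \<le> (\<Sum>i\<in>(Basis::'e set). \<Sum>j\<in>(Basis::'e set). norm u * norm v * M)"
    unfolding abs_mult by (intro sum_mono mult_mono assms Basis_le_norm) auto
  also have "\<dots> = real DIM('e) ^ 2 * M * norm u * norm v" by (simp add: power2_eq_square mult_ac)
  finally show ?thesis .
qed

lemma trilinear_form_bound:
  fixes h u v :: "'e::euclidean_space"
  assumes T: "\<And>k i j. k \<in> Basis \<Longrightarrow> i \<in> Basis \<Longrightarrow> j \<in> Basis \<Longrightarrow> \<bar>T k i j\<bar> \<le> M" "0 \<le> M"
  shows "\<bar>\<Sum>k\<in>Basis. (h \<bullet> k) * (\<Sum>i\<in>Basis. \<Sum>j\<in>Basis. (u \<bullet> i) * (v \<bullet> j) * T k i j)\<bar>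
    \<le> real DIM('e) ^ 3 * M * norm h * norm u * norm v"
proof -
  have "\<bar>\<Sum>k\<in>Basis. (h \<bullet> k) * (\<Sum>i\<in>Basis. \<Sum>j\<in>Basis. (u \<bullet> i) * (v \<bullet> j) * T k i j)\<bar>
    \<le> (\<Sum>k\<in>Basis. \<bar>h \<bullet> k\<bar> * \<bar>\<Sum>i\<in>Basis. \<Sum>j\<in>Basis. (u \<bullet> i) * (v \<bullet> j) * T k i j\<bar>)"
    by (rule order_trans[OF sum_abs]) (simp add: abs_mult)
  also have "\<dots> \<le> (\<Sum>k\<in>(Basis::'e set). norm h * (real DIM('e) ^ 2 * M * norm u * norm v))"
    by (intro sum_mono mult_mono bilinear_form_bound T Basis_le_norm) auto
  also have "\<dots> = real DIM('e) ^ 3 * M * norm h * norm u * norm v" by (simp add: power2_eq_square power3_eq_cube mult_ac)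
  finally show ?thesis .
qed

context lorentz_manifold
begin

context
  fixes c assumes c: "c \<in> A"
begin

lemma DG_expand3:
  assumes x: "x \<in> snd c ` fst c"
  shows "DG c x h u v = (\<Sum>k\<in>Basis. (h \<bullet> k) * (\<Sum>i\<in>Basis. \<Sum>j\<in>Basis. (u \<bullet> i) * (v \<bullet> j) * DG c x k i j))"
proof -
  have "DG c x h u v = DG c x (\<Sum>k\<in>Basis. (h \<bullet> k) *\<^sub>R k) u v" by (simp add: euclidean_representation)
  also have "\<dots> = (\<Sum>k\<in>Basis. (h \<bullet> k) * DG c x k u v)"
    using linear_sum[OF DG_linear[OF c x, of u v], of "\<lambda>k. (h \<bullet> k) *\<^sub>R k" Basis] linear_scale[OF DG_linear[OF c x, of u v]]
    by simp
  also have "\<dots> = (\<Sum>k\<in>Basis. (h \<bullet> k) * (\<Sum>i\<in>Basis. \<Sum>j\<in>Basis. (u \<bullet> i) * (v \<bullet> j) * DG c x k i j))"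
    by (intro sum.cong refl arg_cong2[where f="(*)"] DG_eq[OF c x])
  finally show ?thesis .
qed

text \<open>The finitely many entries of the derivative share one Lipschitz constant on a small
  ball. Expansion in components and the mean value inequality turn this into all the uniform
  bounds.\<close>

lemma local_metric_bounds:
  assumes x0: "x0 \<in> snd c ` fst c"
  obtains R M where "R > 0" "M \<ge> 1" "cball x0 R \<subseteq> snd c ` fst c"
    "\<And>x u v. x \<in> cball x0 R \<Longrightarrow> \<bar>G c x u v\<bar> \<le> M * norm u * norm v"
    "\<And>x y u v. x \<in> cball x0 R \<Longrightarrow> y \<in> cball x0 R \<Longrightarrow> \<bar>G c y u v - G c x u v\<bar> \<le> M * norm (y - x) * norm u * norm v"
    "\<And>x h u v. x \<in> cball x0 R \<Longrightarrow> \<bar>DG c x h u v\<bar> \<le> M * norm h * norm u * norm v"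
    "\<And>x y h u v. x \<in> cball x0 R \<Longrightarrow> y \<in> cball x0 R \<Longrightarrow>
        \<bar>DG c y h u v - DG c x h u v\<bar> \<le> M * norm (y - x) * norm h * norm u * norm v"
    "\<And>x y u v. x \<in> cball x0 R \<Longrightarrow> y \<in> cball x0 R \<Longrightarrow>
        \<bar>G c y u v - G c x u v - DG c x (y - x) u v\<bar> \<le> M * (norm (y - x))\<^sup>2 * norm u * norm v"
proof -
  let ?\<Omega> = "snd c ` fst c" and ?B = "Basis :: 'e set"
  define F where "F = (\<lambda>(k, i, j) x. DG c x k i j)"
  have "\<exists>r>0. \<exists>L. cball x0 r \<subseteq> ?\<Omega> \<and> 0 \<le> L \<and> (\<forall>q\<in>?B \<times> ?B \<times> ?B. L-lipschitz_on (cball x0 r) (F q))"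
    by (rule common_lipschitz_ball[OF _ open_chart_image[OF c] x0]) (auto simp: F_def G_C11(2)[OF c])
  then obtain R L where R: "R > 0" "cball x0 R \<subseteq> ?\<Omega>" and L: "0 \<le> L"
    "\<And>q. q \<in> ?B \<times> ?B \<times> ?B \<Longrightarrow> L-lipschitz_on (cball x0 R) (F q)" by blast
  have in\<Omega>: "x \<in> ?\<Omega>" if "x \<in> cball x0 R" for x using R that by blast
  have x0R: "x0 \<in> cball x0 R" using R by simp
  have DGL: "\<bar>DG c y k i j - DG c x k i j\<bar> \<le> L * norm (y - x)"
    if "k \<in> ?B" "i \<in> ?B" "j \<in> ?B" "x \<in> cball x0 R" "y \<in> cball x0 R" for k i j x y
    using lipschitz_onD[OF L(2)[of "(k, i, j)"] that(5,4)] that(1-3) by (simp add: F_def dist_norm)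
  define M0 where "M0 = (\<Sum>k\<in>?B. \<Sum>i\<in>?B. \<Sum>j\<in>?B. \<bar>DG c x0 k i j\<bar>) + L * R"
  have M0: "0 \<le> M0" using L R by (auto simp: M0_def intro!: add_nonneg_nonneg sum_nonneg)
  have DGb: "\<bar>DG c x k i j\<bar> \<le> M0" if kij: "k \<in> ?B" "i \<in> ?B" "j \<in> ?B" and x: "x \<in> cball x0 R" for k i j x
  proof -
    have "\<bar>DG c x0 k i j\<bar> \<le> (\<Sum>j\<in>?B. \<bar>DG c x0 k i j\<bar>)"
      using kij by (intro member_le_sum) auto
    also have "\<dots> \<le> (\<Sum>i\<in>?B. \<Sum>j\<in>?B. \<bar>DG c x0 k i j\<bar>)"
      using kij by (intro member_le_sum[of _ _ "\<lambda>i. \<Sum>j\<in>?B. \<bar>DG c x0 k i j\<bar>"]) (auto intro: sum_nonneg)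
    also have "\<dots> \<le> (\<Sum>k\<in>?B. \<Sum>i\<in>?B. \<Sum>j\<in>?B. \<bar>DG c x0 k i j\<bar>)"
      using kij by (intro member_le_sum[of _ _ "\<lambda>k. \<Sum>i\<in>?B. \<Sum>j\<in>?B. \<bar>DG c x0 k i j\<bar>"]) (auto intro: sum_nonneg)
    finally have "\<bar>DG c x0 k i j\<bar> \<le> (\<Sum>k\<in>?B. \<Sum>i\<in>?B. \<Sum>j\<in>?B. \<bar>DG c x0 k i j\<bar>)" .
    moreover have "\<bar>DG c x k i j - DG c x0 k i j\<bar> \<le> L * R"
      using DGL[OF kij x0R x] x L(1) mult_left_mono[of "norm (x - x0)" R L]
      by (simp add: dist_norm norm_minus_commute)
    ultimately show ?thesis unfolding M0_def by linarith
  qed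
  define N where "N = real DIM('e)"
  have N: "0 \<le> N" by (simp add: N_def)
  define M3 where "M3 = N ^ 3 * M0"
  define L3 where "L3 = N ^ 3 * L"
  have DGb3: "\<bar>DG c x h u v\<bar> \<le> M3 * norm h * norm u * norm v" if x: "x \<in> cball x0 R" for x h u v
    unfolding DG_expand3[OF in\<Omega>[OF x], of h u v] M3_def N_def
    by (rule trilinear_form_bound) (use DGb x M0 in auto)
  have DGL3: "\<bar>DG c y h u v - DG c x h u v\<bar> \<le> L3 * norm (y - x) * norm h * norm u * norm v"
    if x: "x \<in> cball x0 R" and y: "y \<in> cball x0 R" for x y h u v
  proof -
    have "DG c y h u v - DG c x h u v =
       (\<Sum>k\<in>?B. (h \<bullet> k) * (\<Sum>i\<in>?B. \<Sum>j\<in>?B. (u \<bullet> i) * (v \<bullet> j) * (DG c y k i j - DG c x k i j)))"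
      unfolding DG_expand3[OF in\<Omega>[OF x], of h u v] DG_expand3[OF in\<Omega>[OF y], of h u v]
      by (simp add: right_diff_distrib sum_subtractf)
    also have "\<bar>\<dots>\<bar> \<le> N ^ 3 * (L * norm (y - x)) * norm h * norm u * norm v"
      unfolding N_def by (rule trilinear_form_bound) (use DGL x y L in auto)
    finally show ?thesis by (simp add: L3_def mult_ac)
  qed
  have M3: "0 \<le> M3" and L3: "0 \<le> L3" using M0 L N by (auto simp: M3_def L3_def)
  have GL: "\<bar>G c y u v - G c x u v\<bar> \<le> M3 * norm (y - x) * norm u * norm v"
    if x: "x \<in> cball x0 R" and y: "y \<in> cball x0 R" for x y u v
  proof -
    have "norm (G c y u v - G c x u v) \<le> (M3 * norm u * norm v) * norm (y - x)"
    proof (rule differentiable_bound[OF convex_cball[of x0 R] _ _ y x])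
      show "((\<lambda>x. G c x u v) has_derivative (\<lambda>h. DG c z h u v)) (at z within cball x0 R)" if "z \<in> cball x0 R" for z
        by (rule has_derivative_at_withinI[OF G_has_derivative[OF c in\<Omega>[OF that]]])
      show "onorm (\<lambda>h. DG c z h u v) \<le> M3 * norm u * norm v" if "z \<in> cball x0 R" for z
        using DGb3[OF that, of _ u v] by (intro onorm_le) (simp add: mult_ac)
    qed
    then show ?thesis by (simp add: mult_ac)
  qed
  have taylor: "\<bar>G c y u v - G c x u v - DG c x (y - x) u v\<bar> \<le> L3 * (norm (y - x))\<^sup>2 * norm u * norm v"
    if x: "x \<in> cball x0 R" and y: "y \<in> cball x0 R" for x y u v
  proof -
    have seg: "closed_segment x y \<subseteq> cball x0 R" by (rule closed_segment_subset[OF x y convex_cball])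
    have lin: "linear (\<lambda>h. DG c x h u v)" by (rule DG_linear[OF c in\<Omega>[OF x]])
    \<comment> \<open>The mean value inequality on the segment, for the metric minus its linear part
      at \<open>x\<close>: the derivative of this difference is \<open>DG\<close> at the moving
      point minus \<open>DG\<close> at \<open>x\<close>.\<close>
    have "norm ((G c y u v - DG c x y u v) - (G c x u v - DG c x x u v)) \<le> (L3 * norm (y - x) * norm u * norm v) * norm (y - x)"
    proof (rule differentiable_bound[OF convex_closed_segment[of x y], where f' = "\<lambda>z h. DG c z h u v - DG c x h u v"])
      fix z assume z: "z \<in> closed_segment x y"
      then have zR: "z \<in> cball x0 R" using seg by blast
      show "((\<lambda>z. G c z u v - DG c x z u v) has_derivative (\<lambda>h. DG c z h u v - DG c x h u v)) (at z within closed_segment x y)"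
        by (intro has_derivative_diff has_derivative_at_withinI[OF G_has_derivative[OF c in\<Omega>[OF zR]]]
            linear_imp_has_derivative lin)
      show "onorm (\<lambda>h. DG c z h u v - DG c x h u v) \<le> L3 * norm (y - x) * norm u * norm v"
      proof (rule onorm_le)
        fix h
        have "norm (DG c z h u v - DG c x h u v) \<le> L3 * norm (z - x) * norm h * norm u * norm v"
          using DGL3[OF x zR] by simp
        also have "\<dots> \<le> L3 * norm (y - x) * norm h * norm u * norm v"
          using segment_bound(1)[OF z] L3 by (intro mult_right_mono mult_left_mono) (auto simp: norm_minus_commute)
        finally show "norm (DG c z h u v - DG c x h u v) \<le> L3 * norm (y - x) * norm u * norm v * norm h"
          by (simp add: mult_ac)
      qed
    qed auto
    then show ?thesis by (simp add: linear_diff[OF lin] power2_eq_square mult_ac algebra_simps)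
  qed
  define G0 where "G0 = (\<Sum>i\<in>?B. \<Sum>j\<in>?B. \<bar>G c x0 i j\<bar>)"
  have G0: "0 \<le> G0" by (auto simp: G0_def intro: sum_nonneg)
  have Gb: "\<bar>G c x u v\<bar> \<le> (N\<^sup>2 * G0 + M3 * R) * norm u * norm v" if x: "x \<in> cball x0 R" for x u v
  proof -
    have "\<bar>G c x0 u v\<bar> \<le> N\<^sup>2 * G0 * norm u * norm v"
      unfolding bilinear_expand[OF G_bilinear[OF c x0], of u v] N_def
    proof (rule bilinear_form_bound[OF _ G0])
      fix i j assume ij: "i \<in> ?B" "j \<in> ?B"
      have "\<bar>G c x0 i j\<bar> \<le> (\<Sum>j\<in>?B. \<bar>G c x0 i j\<bar>)"
        using ij by (intro member_le_sum) auto
      also have "\<dots> \<le> G0" unfolding G0_def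
        using ij by (intro member_le_sum[of _ _ "\<lambda>i. \<Sum>j\<in>?B. \<bar>G c x0 i j\<bar>"]) (auto intro: sum_nonneg)
      finally show "\<bar>G c x0 i j\<bar> \<le> G0" .
    qed
    moreover have "\<bar>G c x u v - G c x0 u v\<bar> \<le> M3 * norm (x - x0) * norm u * norm v" by (rule GL[OF x0R x])
    moreover have "M3 * norm (x - x0) * norm u * norm v \<le> M3 * R * norm u * norm v"
      using x M3 by (intro mult_right_mono mult_left_mono) (auto simp: dist_norm norm_minus_commute)
    ultimately have "\<bar>G c x u v\<bar> \<le> N\<^sup>2 * G0 * norm u * norm v + M3 * R * norm u * norm v" by linarith
    then show ?thesis by (simp add: algebra_simps)
  qed
  define M where "M = 1 + M3 + L3 + (N\<^sup>2 * G0 + M3 * R)"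
  have p: "0 \<le> N\<^sup>2 * G0 + M3 * R" using G0 M3 R by simp
  have le: "M3 \<le> M" "L3 \<le> M" "N\<^sup>2 * G0 + M3 * R \<le> M" "1 \<le> M" using M3 L3 p by (auto simp: M_def)
  show thesis
  proof (rule that[of R M])
    show "\<bar>G c x u v\<bar> \<le> M * norm u * norm v" if "x \<in> cball x0 R" for x u v
      by (rule order_trans[OF Gb[OF that]]) (intro mult_right_mono le; simp)
    show "\<bar>G c y u v - G c x u v\<bar> \<le> M * norm (y - x) * norm u * norm v" if "x \<in> cball x0 R" "y \<in> cball x0 R" for x y u v
      by (rule order_trans[OF GL[OF that]]) (intro mult_right_mono le; simp)
    show "\<bar>DG c x h u v\<bar> \<le> M * norm h * norm u * norm v" if "x \<in> cball x0 R" for x h u v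
      by (rule order_trans[OF DGb3[OF that]]) (intro mult_right_mono le; simp)
    show "\<bar>DG c y h u v - DG c x h u v\<bar> \<le> M * norm (y - x) * norm h * norm u * norm v"
      if "x \<in> cball x0 R" "y \<in> cball x0 R" for x y h u v
      by (rule order_trans[OF DGL3[OF that]]) (intro mult_right_mono le; simp)
    show "\<bar>G c y u v - G c x u v - DG c x (y - x) u v\<bar> \<le> M * (norm (y - x))\<^sup>2 * norm u * norm v"
      if "x \<in> cball x0 R" "y \<in> cball x0 R" for x y u v
      by (rule order_trans[OF taylor[OF that]]) (intro mult_right_mono le; simp)
  qed (use R le in auto)
qed

text \<open>The Christoffel symbols are available only with a lowered index. Bounds on them
  therefore come from a uniform lower bound for the operation of lowering an index near
  \<open>x0\<close>.\<close>

lemma local_geodesic_exists: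
  assumes x0: "x0 \<in> snd c ` fst c"
  obtains R K where "cball x0 R \<subseteq> snd c ` fst c" "local_geodesic x0 R K (\<lambda>x u. \<Gamma> c x u u) (G c) (DG c)"
proof -
  obtain R1 M where R1p: "R1 > 0" and M: "M \<ge> 1" and R1s: "cball x0 R1 \<subseteq> snd c ` fst c"
    and Gb: "\<And>x u v. x \<in> cball x0 R1 \<Longrightarrow> \<bar>G c x u v\<bar> \<le> M * norm u * norm v"
    and GL: "\<And>x y u v. x \<in> cball x0 R1 \<Longrightarrow> y \<in> cball x0 R1 \<Longrightarrow> \<bar>G c y u v - G c x u v\<bar> \<le> M * norm (y - x) * norm u * norm v"
    and Db: "\<And>x h u v. x \<in> cball x0 R1 \<Longrightarrow> \<bar>DG c x h u v\<bar> \<le> M * norm h * norm u * norm v"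
    and DL: "\<And>x y h u v. x \<in> cball x0 R1 \<Longrightarrow> y \<in> cball x0 R1 \<Longrightarrow>
        \<bar>DG c y h u v - DG c x h u v\<bar> \<le> M * norm (y - x) * norm h * norm u * norm v"
    and taylor: "\<And>x y u v. x \<in> cball x0 R1 \<Longrightarrow> y \<in> cball x0 R1 \<Longrightarrow>
        \<bar>G c y u v - G c x u v - DG c x (y - x) u v\<bar> \<le> M * (norm (y - x))\<^sup>2 * norm u * norm v"
    by (rule local_metric_bounds[OF x0]) (rule that; assumption)
  note R1 = R1p R1s
  let ?B = "Basis :: 'e set"
  define N where "N = real DIM('e)"
  have N: "N \<ge> 1" using DIM_positive[where 'a='e] unfolding N_def by linarith
  define \<phi> where "\<phi> z = (\<Sum>i\<in>?B. G c x0 z i *\<^sub>R i)" for z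
  note bl0 = G_bilinear[OF c x0]
  have lin: "linear \<phi>"
    unfolding \<phi>_def
    by (intro linear_compose_sum ballI linearI)
      (auto simp: bilinear_ladd[OF bl0] bilinear_lmul[OF bl0] scaleR_add_left)
  have "inj \<phi>"
    unfolding linear_injective_0[OF lin]
  proof (intro allI impI)
    fix z assume z: "\<phi> z = 0"
    have "G c x0 z w = 0" for w
    proof -
      have "G c x0 z j = \<phi> z \<bullet> j" if "j \<in> ?B" for j
        using that by (simp add: \<phi>_def inner_sum_left inner_Basis if_distrib[of "(*) _"] cong: if_cong)
      then have "G c x0 z j = 0" if "j \<in> ?B" for j using z that by simp
      moreover have "G c x0 z w = G c x0 z (\<Sum>j\<in>?B. (w \<bullet> j) *\<^sub>R j)" by (simp add: euclidean_representation)
      moreover have "\<dots> = (\<Sum>j\<in>?B. (w \<bullet> j) * G c x0 z j)"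
        using bl0 by (simp add: bilinear_def linear_sum linear_scale)
      ultimately show ?thesis by simp
    qed
    then show "z = 0" by (rule lorentz_form_nondegenerate[OF G_lorentz[OF c x0]])
  qed
  then obtain m where m: "m > 0" "\<And>z. m * norm z \<le> norm (\<phi> z)"
    using linear_inj_bounded_below_pos[OF lin] by metis
  define R where "R = min R1 (m / (2 * N * M))"
  have R: "R > 0" "R \<le> R1" "R \<le> m / (2 * N * M)" using R1 m N M by (auto simp: R_def)
  have in1: "x \<in> cball x0 R1" and in\<Omega>: "x \<in> snd c ` fst c" if "x \<in> cball x0 R" for x
    using that R R1 by auto
  \<comment> \<open>Quantitative nondegeneracy: at \<open>x0\<close> lowering the index expands
    lengths by at least the factor \<open>m\<close>, and the radius R \<le> m / (2 N M) limits the
    loss at nearby points to half of it.\<close>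
  have below: "norm z \<le> 2 / m * (N * b)" if x: "x \<in> cball x0 R" and b: "\<And>w. norm w = 1 \<Longrightarrow> \<bar>G c x z w\<bar> \<le> b" for x z b
  proof -
    have "m * norm z \<le> norm (\<phi> z)" by (rule m)
    also have "\<dots> \<le> (\<Sum>i\<in>?B. \<bar>G c x0 z i\<bar>)"
      unfolding \<phi>_def by (rule sum_norm_le) simp
    also have "\<dots> \<le> (\<Sum>i\<in>?B. b + M * R * norm z)"
    proof (rule sum_mono)
      fix i assume i: "i \<in> ?B"
      have "\<bar>G c x z i - G c x0 z i\<bar> \<le> M * norm (x - x0) * norm z * norm i"
        using GL[OF _ in1[OF x]] R1 by simp
      also have "\<dots> \<le> M * R * norm z"
        using x i M by (auto simp: dist_norm norm_minus_commute intro!: mult_right_mono mult_left_mono)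
      finally show "\<bar>G c x0 z i\<bar> \<le> b + M * R * norm z" using b[of i] i by simp
    qed
    also have "\<dots> = N * b + (N * M * R) * norm z" by (simp add: N_def algebra_simps)
    also have "\<dots> \<le> N * b + m / 2 * norm z"
      using R(3) N M by (intro add_left_mono mult_right_mono) (auto simp: field_simps)
    finally have "m / 2 * norm z \<le> N * b" by (simp add: algebra_simps)
    then show ?thesis using m(1) by (simp add: field_simps)
  qed
  define C where "C = 2 / m * (N * (2 * M))"
  have C: "C \<ge> 0" using m N M by (simp add: C_def)
  have bound: "norm (\<Gamma> c x u u) \<le> C * (norm u)\<^sup>2" if x: "x \<in> cball x0 R" for x u
  proof -
    have "norm (\<Gamma> c x u u) \<le> 2 / m * (N * (2 * M * (norm u)\<^sup>2))"
    proof (rule below[OF x])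
      fix w :: 'e assume w: "norm w = 1"
      have "\<bar>DG c x u u w\<bar> \<le> M * (norm u)\<^sup>2" "\<bar>DG c x w u u\<bar> \<le> M * (norm u)\<^sup>2"
        using Db[OF in1[OF x], of u u w] Db[OF in1[OF x], of w u u] w by (auto simp: power2_eq_square mult_ac)
      then show "\<bar>G c x (\<Gamma> c x u u) w\<bar> \<le> 2 * M * (norm u)\<^sup>2"
        unfolding spray_eq[OF c in\<Omega>[OF x]] by linarith
    qed
    then show ?thesis by (simp add: C_def mult_ac)
  qed
  define C' where "C' = 2 / m * (N * (M * C + 2 * M))"
  have C': "C' \<ge> 0" using m N M C by (simp add: C'_def)
  have lip: "norm (\<Gamma> c x u u - \<Gamma> c y v v) \<le> C' * (norm (x - y) * (norm u)\<^sup>2 + norm (u - v) * (norm u + norm v))"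
    if x: "x \<in> cball x0 R" and y: "y \<in> cball x0 R" for x y u v
  proof -
    define z1 z2 where "z1 = \<Gamma> c x u u" and "z2 = \<Gamma> c y v v"
    define P where "P = norm (x - y) * (norm u)\<^sup>2"
    define Q where "Q = norm (u - v) * (norm u + norm v)"
    have PQ: "0 \<le> P" "0 \<le> Q" by (auto simp: P_def Q_def)
    note bly = G_bilinear[OF c in\<Omega>[OF y]] and bDy = DG_bilinear[OF c in\<Omega>[OF y]] and lDy = DG_linear[OF c in\<Omega>[OF y]]
    have "norm (z1 - z2) \<le> 2 / m * (N * ((M * C + 2 * M) * (P + Q)))"
    proof (rule below[OF y])
      fix w :: 'e assume w: "norm w = 1"
      \<comment> \<open>The two sprays solve lowered equations at different base points. Moving the
        first one to \<open>y\<close> costs a variation of the metric, which is controlled by the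
        bound on the spray already obtained.\<close>
      have e1: "G c y (z1 - z2) w = (G c y z1 w - G c x z1 w) +
         ((DG c x u u w - DG c x w u u / 2) - (DG c y v v w - DG c y w v v / 2))"
        using spray_eq[OF c in\<Omega>[OF x], of u w] spray_eq[OF c in\<Omega>[OF y], of v w]
        by (simp add: bilinear_lsub[OF bly] z1_def z2_def)
      have b1: "\<bar>G c y z1 w - G c x z1 w\<bar> \<le> M * C * P"
      proof -
        have "\<bar>G c y z1 w - G c x z1 w\<bar> \<le> M * norm (x - y) * norm z1"
          using GL[OF in1[OF x] in1[OF y], of z1 w] w by (simp add: norm_minus_commute)
        also have "\<dots> \<le> M * norm (x - y) * (C * (norm u)\<^sup>2)"
          using bound[OF x, of u] M by (intro mult_left_mono) (auto simp: z1_def)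
        finally show ?thesis by (simp add: P_def mult_ac)
      qed
      have e2: "DG c x u u w - DG c y v v w = (DG c x u u w - DG c y u u w) + (DG c y (u - v) u w + DG c y v (u - v) w)"
        using linear_diff[OF lDy, of u v u w] by (simp add: bilinear_lsub[OF bDy])
      have b2: "\<bar>DG c x u u w - DG c y u u w\<bar> \<le> M * P"
        using DL[OF in1[OF y] in1[OF x], of u u w] w by (simp add: P_def power2_eq_square mult_ac)
      have b3: "\<bar>DG c y (u - v) u w\<bar> \<le> M * (norm (u - v) * norm u)" "\<bar>DG c y v (u - v) w\<bar> \<le> M * (norm (u - v) * norm v)"
        using Db[OF in1[OF y], of "u - v" u w] Db[OF in1[OF y], of v "u - v" w] w by (auto simp: mult_ac)
      have Q: "M * (norm (u - v) * norm u) + M * (norm (u - v) * norm v) = M * Q" by (simp add: Q_def algebra_simps)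
      have e3: "DG c x w u u - DG c y w v v = (DG c x w u u - DG c y w u u) + (DG c y w (u - v) u + DG c y w v (u - v))"
        by (simp add: bilinear_lsub[OF bDy] bilinear_rsub[OF bDy])
      have b4: "\<bar>DG c x w u u - DG c y w u u\<bar> \<le> M * P"
        using DL[OF in1[OF y] in1[OF x], of w u u] w by (simp add: P_def power2_eq_square mult_ac)
      have b5: "\<bar>DG c y w (u - v) u\<bar> \<le> M * (norm (u - v) * norm u)" "\<bar>DG c y w v (u - v)\<bar> \<le> M * (norm (u - v) * norm v)"
        using Db[OF in1[OF y], of w "u - v" u] Db[OF in1[OF y], of w v "u - v"] w by (auto simp: mult_ac)
      have MPQ: "0 \<le> M * P" "0 \<le> M * Q" "0 \<le> M * C * Q" using M PQ C by auto
      have a2: "\<bar>DG c x u u w - DG c y v v w\<bar> \<le> M * P + M * Q" using e2 b2 b3 Q by linarith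
      have a3: "\<bar>DG c x w u u - DG c y w v v\<bar> \<le> M * P + M * Q" using e3 b4 b5 Q by linarith
      have "\<bar>G c y (z1 - z2) w\<bar> \<le> M * C * P + 2 * (M * P) + 2 * (M * Q)"
        using b1 a2 a3 MPQ(1,2) unfolding e1 by linarith
      also have "\<dots> \<le> (M * C + 2 * M) * (P + Q)" using MPQ by (simp add: algebra_simps)
      finally show "\<bar>G c y (z1 - z2) w\<bar> \<le> (M * C + 2 * M) * (P + Q)" .
    qed
    then show ?thesis by (simp add: C'_def z1_def z2_def P_def Q_def mult.assoc)
  qed
  define K where "K = M + C + C'"
  have K: "M \<le> K" "C \<le> K" "C' \<le> K" "1 \<le> K" using M C C' by (auto simp: K_def)
  show thesis
  proof (rule that[of R K])
    show "cball x0 R \<subseteq> snd c ` fst c" using in\<Omega> by blast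
    show "local_geodesic x0 R K (\<lambda>x u. \<Gamma> c x u u) (G c) (DG c)"
    proof (intro local_geodesic.intro local_spray.intro local_geodesic_axioms.intro)
      fix x y u v h w assume x: "x \<in> cball x0 R"
      show "bilinear (G c x)" by (rule G_bilinear[OF c in\<Omega>[OF x]])
      show "G c x u v = G c x v u" by (rule G_sym[OF c in\<Omega>[OF x]])
      show "bilinear (DG c x h)" by (rule DG_bilinear[OF c in\<Omega>[OF x]])
      show "linear (\<lambda>h. DG c x h u v)" by (rule DG_linear[OF c in\<Omega>[OF x]])
      show "DG c x h u v = DG c x h v u" by (rule DG_sym[OF c in\<Omega>[OF x]])
      show "G c x (\<Gamma> c x u u) w = DG c x u u w - DG c x w u u / 2" by (rule spray_eq[OF c in\<Omega>[OF x]])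
      show "\<bar>G c x u v\<bar> \<le> K * norm u * norm v"
        by (rule order_trans[OF Gb[OF in1[OF x]]]) (intro mult_right_mono K; simp)
      show "\<bar>DG c x h u v\<bar> \<le> K * norm h * norm u * norm v"
        by (rule order_trans[OF Db[OF in1[OF x]]]) (intro mult_right_mono K; simp)
      show "norm (\<Gamma> c x u u) \<le> K * (norm u)\<^sup>2"
        by (rule order_trans[OF bound[OF x]]) (intro mult_right_mono K; simp)
      assume y: "y \<in> cball x0 R"
      show "\<bar>G c y u v - G c x u v - DG c x (y - x) u v\<bar> \<le> K * (norm (y - x))\<^sup>2 * norm u * norm v"
        by (rule order_trans[OF taylor[OF in1[OF x] in1[OF y]]]) (intro mult_right_mono K; simp)
      show "norm (\<Gamma> c x u u - \<Gamma> c y v v) \<le> K * (norm (x - y) * (norm u)\<^sup>2 + norm (u - v) * (norm u + norm v))"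
        by (rule order_trans[OF lip[OF x y]]) (intro mult_right_mono K; simp)
    qed (use R K in auto)
  qed
qed

end

end

section \<open>Geodesics on the manifold\<close>

context lorentz_manifold
begin

text \<open>The geodesic equation as a first-order system on phase space, the form to which the
  uniqueness lemmas apply. Velocities are bounded near a point, so the quadratic estimates of the
  spray become Lipschitz estimates.\<close>

lemma spray_field_locally_lipschitz:
  assumes c: "c \<in> A"
  shows "locally_lipschitz_on ((snd c ` fst c) \<times> UNIV) (\<lambda>(x, u). (u, - \<Gamma> c x u u))"
  unfolding locally_lipschitz_on_def
proof
  fix z :: "'e \<times> 'e" assume "z \<in> (snd c ` fst c) \<times> UNIV"
  then obtain x0 u0 where z: "z = (x0, u0)" "x0 \<in> snd c ` fst c" by auto
  obtain R K where RK: "cball x0 R \<subseteq> snd c ` fst c" "local_geodesic x0 R K (\<lambda>x u. \<Gamma> c x u u) (G c) (DG c)"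
    using local_geodesic_exists[OF c z(2)] .
  interpret local_geodesic x0 R K "\<lambda>x u. \<Gamma> c x u u" "G c" "DG c" by (rule RK(2))
  define b where "b = norm u0 + 1"
  have b: "b \<ge> 0" by (simp add: b_def)
  define L where "L = 1 + K * (b\<^sup>2 + 2 * b)"
  have L: "0 \<le> L" using K b by (simp add: L_def)
  have "L-lipschitz_on ((snd c ` fst c) \<times> UNIV \<inter> ball z (min R 1)) (\<lambda>(x, u). (u, - \<Gamma> c x u u))"
  proof (rule lipschitz_onI[OF _ L])
    fix y y' assume y: "y \<in> (snd c ` fst c) \<times> UNIV \<inter> ball z (min R 1)" "y' \<in> (snd c ` fst c) \<times> UNIV \<inter> ball z (min R 1)"
    obtain x u x' u' where e: "y = (x, u)" "y' = (x', u')" by (cases y, cases y') auto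
    have near: "a \<in> cball x0 R \<and> norm w \<le> b" if "(a, w) \<in> ball z (min R 1)" for a w
    proof -
      have d: "norm ((a, w) - (x0, u0)) < min R 1" 
        using that unfolding z mem_ball dist_commute[of "(x0, u0)"] by (simp only: dist_norm)
      have "norm (a - x0) \<le> norm ((a, w) - (x0, u0))" "norm (w - u0) \<le> norm ((a, w) - (x0, u0))"
        using norm_fst_le[of "a - x0" "w - u0"] norm_snd_le[of "w - u0" "a - x0"] by auto
      then have "norm (a - x0) \<le> R" "norm (w - u0) \<le> 1" using d by auto
      then show ?thesis using norm_triangle_sub[of w u0] by (simp add: b_def dist_norm norm_minus_commute)
    qed
    have xu: "x \<in> cball x0 R" "norm u \<le> b" "x' \<in> cball x0 R" "norm u' \<le> b"
      using near[of x u] near[of x' u'] y unfolding e by auto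
    have dx: "norm (x - x') \<le> dist y y'" "norm (u - u') \<le> dist y y'"
      using norm_fst_le[of "x - x'" "u - u'"] norm_snd_le[of "u - u'" "x - x'"] by (auto simp: e dist_norm)
    have "norm (\<Gamma> c x u u - \<Gamma> c x' u' u') \<le> K * (norm (x - x') * (norm u)\<^sup>2 + norm (u - u') * (norm u + norm u'))"
      by (rule spray_lip[OF xu(1,3)])
    also have "\<dots> \<le> K * (dist y y' * b\<^sup>2 + dist y y' * (b + b))"
      using K dx xu b by (intro mult_left_mono add_mono mult_mono power_mono) auto
    finally have 1: "norm (\<Gamma> c x u u - \<Gamma> c x' u' u') \<le> K * (b\<^sup>2 + 2 * b) * dist y y'" by (simp add: algebra_simps)
    have "dist (case y of (x, u) \<Rightarrow> (u, - \<Gamma> c x u u)) (case y' of (x, u) \<Rightarrow> (u, - \<Gamma> c x u u))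
        = norm (u - u', - (\<Gamma> c x u u - \<Gamma> c x' u' u'))"
      by (simp add: e dist_norm)
    also have "\<dots> \<le> norm (u - u') + norm (- (\<Gamma> c x u u - \<Gamma> c x' u' u'))" by (rule norm_Pair_le)
    also have "\<dots> \<le> dist y y' + K * (b\<^sup>2 + 2 * b) * dist y y'" using 1 dx by (simp add: norm_minus_commute)
    also have "\<dots> = L * dist y y'" by (simp add: L_def algebra_simps)
    finally show "dist (case y of (x, u) \<Rightarrow> (u, - \<Gamma> c x u u)) (case y' of (x, u) \<Rightarrow> (u, - \<Gamma> c x u u)) \<le> L * dist y y'" .
  qed
  then show "\<exists>e>0. \<exists>L. L-lipschitz_on ((snd c ` fst c) \<times> UNIV \<inter> ball z e) (\<lambda>(x, u). (u, - \<Gamma> c x u u))"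
    using R by (intro exI[of _ "min R 1"] conjI exI[of _ L]) auto
qed

lemma chart_around: obtains c where "c \<in> A" "q \<in> fst c"
proof -
  have "(\<Union>c\<in>A. fst c) = UNIV" using atlas by (simp add: smooth_atlas_def)
  then have "q \<in> (\<Union>c\<in>A. fst c)" by (simp only: UNIV_I)
  then show thesis using that by blast
qed

lemma eventually_in_chart:
  assumes "continuous_on S \<gamma>" "t \<in> S" "\<gamma> t \<in> fst c" "c \<in> A"
  obtains d where "d > 0" "\<And>s. s \<in> S \<Longrightarrow> dist s t < d \<Longrightarrow> \<gamma> s \<in> fst c"
proof -
  have "(\<gamma> \<longlongrightarrow> \<gamma> t) (at t within S)" using assms by (auto simp: continuous_on_def)
  then have "\<forall>\<^sub>F s in at t within S. \<gamma> s \<in> fst c"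
    using open_chart_dom[OF assms(4)] assms(3) by (rule topological_tendstoD)
  then obtain d where "d > 0" "\<forall>s\<in>S. s \<noteq> t \<and> dist s t < d \<longrightarrow> \<gamma> s \<in> fst c"
    unfolding eventually_at by blast
  then show thesis using that[of d] assms(3) by metis
qed

lemma vector_derivative_unique_Icc:
  fixes f :: "real \<Rightarrow> 'e"
  assumes "a < b" "t \<in> {a..b}" "(f has_vector_derivative u) (at t within {a..b})" "(f has_vector_derivative w) (at t within {a..b})"
  shows "u = w"
  by (rule vector_derivative_unique_within_closed_interval[of a b t f]) (use assms in auto)

text \<open>By the chain rule, a derivative in one chart already gives a velocity in the sense of
  all charts. Conditions imposed on velocities thus become usable in a single chart.\<close>

lemma has_velocity_tvec_of:
  assumes cont: "continuous_on S \<gamma>" and t: "t \<in> S" and c: "c \<in> charts_at A (\<gamma> t)"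
    and der: "((snd c \<circ> \<gamma>) has_vector_derivative w) (at t within S)"
  shows "has_velocity A S \<gamma> (tvec_of A c (\<gamma> t) w) t"
  unfolding has_velocity_def
proof (intro conjI ballI tvec_of_tangent[OF c])
  fix c' assume c': "c' \<in> charts_at A (\<gamma> t)"
  have cA: "c \<in> A" "\<gamma> t \<in> fst c" "c' \<in> A" "\<gamma> t \<in> fst c'" using c c' by (auto simp: charts_at_iff)
  obtain d where d: "d > 0" "\<And>s. s \<in> S \<Longrightarrow> dist s t < d \<Longrightarrow> \<gamma> s \<in> fst c"
    using eventually_in_chart[OF cont t cA(2,1)] by blast
  have "((\<lambda>s. trans c c' ((snd c \<circ> \<gamma>) s)) has_vector_derivative dtrans c c' ((snd c \<circ> \<gamma>) t) w) (at t within S)"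
    by (rule trans_along_derivative[OF cA(1,3) der]) (simp add: overlapI[OF cA(1,3,2,4)])
  then have "((snd c' \<circ> \<gamma>) has_vector_derivative dtrans c c' ((snd c \<circ> \<gamma>) t) w) (at t within S)"
    unfolding has_vector_derivative_def
    by (rule has_derivative_transform_within[OF _ d(1) t]) (simp add: trans_def chart_inv_left[OF cA(1) d(2)])
  then show "((snd c' \<circ> \<gamma>) has_vector_derivative tvec_of A c (\<gamma> t) w c') (at t within S)"
    using c' by (simp add: tvec_of_def transition_deriv_eq)
qed

lemma velocity_unique:
  assumes "a < b" "t \<in> {a..b}" "has_velocity A {a..b} \<gamma> v t" "c \<in> charts_at A (\<gamma> t)"
    "((snd c \<circ> \<gamma>) has_vector_derivative w) (at t within {a..b})"
  shows "v c = w"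
  using vector_derivative_unique_Icc[OF assms(1,2) _ assms(5), of "v c"] assms(3,4) by (simp add: has_velocity_def)

text \<open>The second derivative of the chart change enters both the transformed acceleration and
  the transformed spray; the two contributions cancel, so a solution in one chart is a solution in
  every other.\<close>

lemma geodesic_on_chart_inv:
  assumes c: "c \<in> A" and img: "\<sigma> ` S \<subseteq> snd c ` fst c"
    and \<sigma>: "\<And>t. t \<in> S \<Longrightarrow> (\<sigma> has_vector_derivative u t) (at t within S)"
    and u: "\<And>t. t \<in> S \<Longrightarrow> (u has_vector_derivative - \<Gamma> c (\<sigma> t) (u t) (u t)) (at t within S)"
  shows "geodesic_on A g S (chart_inv c \<circ> \<sigma>)"
  unfolding geodesic_on_def
proof (intro conjI ballI)
  have "continuous_on S \<sigma>"
    using has_vector_derivative_continuous[OF \<sigma>] by (simp add: continuous_on_eq_continuous_within)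
  then show "continuous_on S (chart_inv c \<circ> \<sigma>)"
    using continuous_on_compose continuous_on_subset[OF continuous_on_chart_inv[OF c] img] by blast
  fix c' assume c': "c' \<in> A"
  show "\<exists>x'. \<forall>t\<in>S. (chart_inv c \<circ> \<sigma>) t \<in> fst c' \<longrightarrow>
      ((snd c' \<circ> (chart_inv c \<circ> \<sigma>)) has_vector_derivative x' t) (at t within S) \<and>
      (x' has_vector_derivative - \<Gamma> c' (snd c' ((chart_inv c \<circ> \<sigma>) t)) (x' t) (x' t)) (at t within S)"
  proof (intro exI[of _ "\<lambda>t. dtrans c c' (\<sigma> t) (u t)"] ballI impI)
    fix t assume t: "t \<in> S" "(chart_inv c \<circ> \<sigma>) t \<in> fst c'"
    have x: "\<sigma> t \<in> overlap c c'"
      using overlapI[OF c c' chart_inv_in[OF c]] img t chart_inv_right[OF c] by (metis comp_apply image_subset_iff)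
    have eq: "snd c' \<circ> (chart_inv c \<circ> \<sigma>) = (\<lambda>s. trans c c' (\<sigma> s))" by (auto simp: trans_def)
    have "dtrans c c' (\<sigma> t) (- \<Gamma> c (\<sigma> t) (u t) (u t)) + ddtrans c c' (\<sigma> t) (u t) (u t) =
       - \<Gamma> c' (trans c c' (\<sigma> t)) (dtrans c c' (\<sigma> t) (u t)) (dtrans c c' (\<sigma> t) (u t))"
      using spray_transform[OF c c' x, of "u t"] linear_neg[OF dtrans_linear[OF c c' x]] by simp
    then show "((snd c' \<circ> (chart_inv c \<circ> \<sigma>)) has_vector_derivative dtrans c c' (\<sigma> t) (u t)) (at t within S) \<and>
      ((\<lambda>t. dtrans c c' (\<sigma> t) (u t)) has_vector_derivative
         - \<Gamma> c' (snd c' ((chart_inv c \<circ> \<sigma>) t)) (dtrans c c' (\<sigma> t) (u t)) (dtrans c c' (\<sigma> t) (u t))) (at t within S)"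
      using trans_along_derivative[OF c c' \<sigma>[OF t(1)] x] dtrans_along_derivative[OF c c' \<sigma>[OF t(1)] u[OF t(1)] t(1) x]
      unfolding eq by (simp add: trans_def)
  qed
qed

text \<open>Continuation, with the uniqueness step carried out on phase space in a chart around the
  current point. This makes the definite description in \<open>exp_map\<close> well defined.\<close>

lemma geodesic_unique:
  assumes 1: "geodesic_from A g p v \<gamma>1" and 2: "geodesic_from A g p v \<gamma>2" and t: "t \<in> {0..1}"
  shows "\<gamma>1 t = \<gamma>2 t"
proof (rule interval_eq_continuation[where a=0 and b=1, OF _ _ _ _ t])
  have go: "geodesic_on A g {0..1} \<gamma>1" "geodesic_on A g {0..1} \<gamma>2" and start: "\<gamma>1 0 = p" "\<gamma>2 0 = p"
    and vel: "has_velocity A {0..1} \<gamma>1 v 0" "has_velocity A {0..1} \<gamma>2 v 0"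
    using 1 2 by (auto simp: geodesic_from_def)
  show cont: "continuous_on {0..1} \<gamma>1" "continuous_on {0..1} \<gamma>2" using go by (auto simp: geodesic_on_def)
  show "\<gamma>1 0 = \<gamma>2 0" using start by simp
  fix T :: real assume T: "0 \<le> T" "T < 1" and eq: "\<forall>s\<in>{0..T}. \<gamma>1 s = \<gamma>2 s"
  have T01: "T \<in> {0..1}" using T by simp
  have eqT: "\<gamma>1 T = \<gamma>2 T" using eq T by simp
  obtain c where c: "c \<in> A" "\<gamma>1 T \<in> fst c" by (rule chart_around)
  then have c2: "\<gamma>2 T \<in> fst c" using eqT by simp
  obtain x1 where x1: "\<And>t. t \<in> {0..1} \<Longrightarrow> \<gamma>1 t \<in> fst c \<Longrightarrow> ((snd c \<circ> \<gamma>1) has_vector_derivative x1 t) (at t within {0..1}) \<and>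
        (x1 has_vector_derivative - \<Gamma> c (snd c (\<gamma>1 t)) (x1 t) (x1 t)) (at t within {0..1})"
    using go(1) c(1) unfolding geodesic_on_def by blast
  obtain x2 where x2: "\<And>t. t \<in> {0..1} \<Longrightarrow> \<gamma>2 t \<in> fst c \<Longrightarrow> ((snd c \<circ> \<gamma>2) has_vector_derivative x2 t) (at t within {0..1}) \<and>
        (x2 has_vector_derivative - \<Gamma> c (snd c (\<gamma>2 t)) (x2 t) (x2 t)) (at t within {0..1})"
    using go(2) c(1) unfolding geodesic_on_def by blast
  \<comment> \<open>The velocities must agree before uniqueness can be restarted: at time 0 by the
    initial condition, later because both are the left derivative of the same curve.\<close>
  have xT: "x1 T = x2 T"
  proof (cases "T = 0")
    case True
    have "v c = x1 0" using velocity_unique[OF _ _ vel(1), of c "x1 0"] x1[of 0] c True by (simp add: charts_at_iff)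
    moreover have "v c = x2 0" using velocity_unique[OF _ _ vel(2), of c "x2 0"] x2[of 0] c c2 True by (simp add: charts_at_iff)
    ultimately show ?thesis using True by simp
  next
    case False
    then have T0: "0 < T" using T by simp
    have sub: "{0..T} \<subseteq> {0..1}" using T by auto
    have d1: "((snd c \<circ> \<gamma>1) has_vector_derivative x1 T) (at T within {0..T})"
      using has_vector_derivative_within_subset[OF conjunct1[OF x1[OF T01 c(2)]] sub] .
    have d2: "((snd c \<circ> \<gamma>2) has_vector_derivative x2 T) (at T within {0..T})"
      using has_vector_derivative_within_subset[OF conjunct1[OF x2[OF T01 c2]] sub] .
    have d3: "((snd c \<circ> \<gamma>1) has_vector_derivative x2 T) (at T within {0..T})"
      by (rule has_vector_derivative_transform[OF _ _ d2]) (use T eq in auto)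
    show ?thesis by (rule vector_derivative_unique_Icc[OF T0 _ d1 d3]) (use T in simp)
  qed
  obtain d1 where d1: "d1 > 0" "\<And>s. s \<in> {0..1} \<Longrightarrow> dist s T < d1 \<Longrightarrow> \<gamma>1 s \<in> fst c"
    using eventually_in_chart[OF cont(1) T01 c(2,1)] by blast
  obtain d2 where d2: "d2 > 0" "\<And>s. s \<in> {0..1} \<Longrightarrow> dist s T < d2 \<Longrightarrow> \<gamma>2 s \<in> fst c"
    using eventually_in_chart[OF cont(2) T01 c2 c(1)] by blast
  define b where "b = T + min (min (d1/2) (d2/2)) (1 - T)"
  have b: "T < b" "b \<le> 1" "b - T < d1" "b - T < d2" using d1(1) d2(1) T by (auto simp: b_def)
  have sub: "{T..b} \<subseteq> {0..1}" using T b by auto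
  let ?H = "\<lambda>(x, u). (u, - \<Gamma> c x u u)"
  define z1 z2 where "z1 s = (snd c (\<gamma>1 s), x1 s)" and "z2 s = (snd c (\<gamma>2 s), x2 s)" for s
  have z1: "(z1 has_vector_derivative ?H (z1 t)) (at t within {T..b})" if "t \<in> {T..b}" for t
  proof -
    have "\<gamma>1 t \<in> fst c" using d1(2)[of t] that b sub by (auto simp: dist_real_def)
    then have "(z1 has_vector_derivative (x1 t, - \<Gamma> c (snd c (\<gamma>1 t)) (x1 t) (x1 t))) (at t within {0..1})"
      using x1[of t] that sub unfolding z1_def by (intro has_vector_derivative_Pair) (auto simp: comp_def)
    then show ?thesis by (simp add: z1_def has_vector_derivative_within_subset[OF _ sub])
  qed
  have z2: "(z2 has_vector_derivative ?H (z2 t)) (at t within {T..b})" if "t \<in> {T..b}" for t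
  proof -
    have "\<gamma>2 t \<in> fst c" using d2(2)[of t] that b sub by (auto simp: dist_real_def)
    then have "(z2 has_vector_derivative (x2 t, - \<Gamma> c (snd c (\<gamma>2 t)) (x2 t) (x2 t))) (at t within {0..1})"
      using x2[of t] that sub unfolding z2_def by (intro has_vector_derivative_Pair) (auto simp: comp_def)
    then show ?thesis by (simp add: z2_def has_vector_derivative_within_subset[OF _ sub])
  qed
  have "\<exists>d>0. \<forall>s\<in>{T..T+d}\<inter>{..b}. z1 s = z2 s"
    by (rule ode_unique_step[OF spray_field_locally_lipschitz[OF c(1)] open_Times[OF open_chart_image[OF c(1)] open_UNIV] z1 z2 b(1)])
      (use xT eqT c in \<open>auto simp: z1_def z2_def\<close>)
  then obtain d where d: "d > 0" "\<forall>s\<in>{T..T+d}\<inter>{..b}. z1 s = z2 s" by blast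
  have "\<gamma>1 s = \<gamma>2 s" if s: "s \<in> {T..T + min d (b - T)} \<inter> {..1}" for s
  proof -
    have "s \<in> {T..T+d} \<inter> {..b}" using s by auto
    then have "snd c (\<gamma>1 s) = snd c (\<gamma>2 s)" using d(2) by (simp add: z1_def z2_def)
    moreover have "\<gamma>1 s \<in> fst c" "\<gamma>2 s \<in> fst c" using d1(2)[of s] d2(2)[of s] s b T by (auto simp: dist_real_def)
    ultimately show ?thesis using chart_inv_left[OF c(1)] by metis
  qed
  then show "\<exists>d>0. \<forall>s\<in>{T..T+d}\<inter>{..1}. \<gamma>1 s = \<gamma>2 s"
    using d(1) b(1) by (intro exI[of _ "min d (b - T)"]) auto
qed

lemma exp_map_eq:
  assumes "geodesic_from A g p v \<gamma>" shows "exp_map A g p v = \<gamma> 1"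
  unfolding exp_map_def
proof (rule the_equality)
  show "\<exists>\<gamma>'. geodesic_from A g p v \<gamma>' \<and> \<gamma> 1 = \<gamma>' 1" using assms by blast
  fix q assume "\<exists>\<gamma>'. geodesic_from A g p v \<gamma>' \<and> q = \<gamma>' 1"
  then obtain \<gamma>' where "geodesic_from A g p v \<gamma>'" "q = \<gamma>' 1" by blast
  then show "q = \<gamma> 1" using geodesic_unique[OF _ assms, of \<gamma>' 1] by simp
qed

text \<open>In a chart the velocity is itself differentiable, hence continuous and locally
  bounded.\<close>

lemma geodesic_locally_lipschitz:
  assumes geo: "geodesic_on A g {0..1} \<gamma>"
  shows "locally_lipschitz_curve A {0..1} \<gamma>"
  unfolding locally_lipschitz_curve_def
proof (intro ballI)
  fix t c assume t: "t \<in> {0..1::real}" and "c \<in> charts_at A (\<gamma> t)"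
  then have c: "c \<in> A" "\<gamma> t \<in> fst c" by (auto simp: charts_at_iff)
  have cont: "continuous_on {0..1} \<gamma>" using geo by (simp add: geodesic_on_def)
  obtain x' where x': "\<And>t. t \<in> {0..1} \<Longrightarrow> \<gamma> t \<in> fst c \<Longrightarrow> ((snd c \<circ> \<gamma>) has_vector_derivative x' t) (at t within {0..1}) \<and>
        (x' has_vector_derivative - \<Gamma> c (snd c (\<gamma> t)) (x' t) (x' t)) (at t within {0..1})"
    using geo c(1) unfolding geodesic_on_def by blast
  obtain d1 where d1: "d1 > 0" "\<And>s. s \<in> {0..1} \<Longrightarrow> dist s t < d1 \<Longrightarrow> \<gamma> s \<in> fst c"
    using eventually_in_chart[OF cont t c(2,1)] by blast
  have "continuous (at t within {0..1}) x'"
    using x'[OF t c(2)] has_vector_derivative_continuous by blast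
  then obtain d2 where d2: "d2 > 0" "\<And>s. s \<in> {0..1} \<Longrightarrow> dist s t < d2 \<Longrightarrow> dist (x' s) (x' t) < 1"
    unfolding continuous_within_eps_delta using zero_less_one by blast
  define e where "e = min d1 d2"
  define B where "B = norm (x' t) + 1"
  let ?S = "{0..1} \<inter> ball t e"
  have S: "\<gamma> s \<in> fst c" "norm (x' s) \<le> B" if "s \<in> ?S" for s
  proof -
    have "dist s t < d1" "dist s t < d2" "s \<in> {0..1}" using that by (auto simp: e_def dist_commute)
    then show "\<gamma> s \<in> fst c" "norm (x' s) \<le> B"
      using d1(2)[of s] d2(2)[of s] norm_triangle_sub[of "x' s" "x' t"] by (auto simp: B_def dist_norm)
  qed
  have "B-lipschitz_on ?S (snd c \<circ> \<gamma>)"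
  proof (rule lipschitz_onI)
    fix r s assume rs: "r \<in> ?S" "s \<in> ?S"
    have "norm ((snd c \<circ> \<gamma>) r - (snd c \<circ> \<gamma>) s) \<le> B * norm (r - s)"
    proof (rule differentiable_bound[of ?S _ "\<lambda>t h. h *\<^sub>R x' t"])
      show "convex ?S" by (intro convex_Int convex_ball) simp
      fix q assume q: "q \<in> ?S"
      show "((snd c \<circ> \<gamma>) has_derivative (\<lambda>h. h *\<^sub>R x' q)) (at q within ?S)"
        using has_vector_derivative_within_subset[OF conjunct1[OF x'[OF _ S(1)[OF q]]], of ?S] q
        by (simp add: has_vector_derivative_def)
      show "onorm (\<lambda>h. h *\<^sub>R x' q) \<le> B"
      proof (rule onorm_le)
        show "norm (h *\<^sub>R x' q) \<le> B * norm h" for h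
          using mult_right_mono[OF S(2)[OF q], of "norm h"] by (simp add: mult.commute)
      qed
    qed (use rs in auto)
    then show "dist ((snd c \<circ> \<gamma>) r) ((snd c \<circ> \<gamma>) s) \<le> B * dist r s" by (simp add: dist_norm)
  qed (simp add: B_def)
  then show "\<exists>e>0. \<exists>L. \<gamma> ` ({0..1} \<inter> ball t e) \<subseteq> fst c \<and> L-lipschitz_on ({0..1} \<inter> ball t e) (snd c \<circ> \<gamma>)"
    using d1(1) d2(1) S(1) by (intro exI[of _ e] conjI exI[of _ B]) (auto simp: e_def)
qed

lemma lipschitz_curve_continuous:
  assumes lip: "locally_lipschitz_curve A S \<gamma>" shows "continuous_on S \<gamma>"
  unfolding continuous_on_eq_continuous_within
proof
  fix t assume t: "t \<in> S"
  obtain c where c: "c \<in> A" "\<gamma> t \<in> fst c" by (rule chart_around)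
  then have "c \<in> charts_at A (\<gamma> t)" by (simp add: charts_at_iff)
  then obtain e L where e: "e > 0" "\<gamma> ` (S \<inter> ball t e) \<subseteq> fst c" "L-lipschitz_on (S \<inter> ball t e) (snd c \<circ> \<gamma>)"
    using lip[unfolded locally_lipschitz_curve_def, rule_format, OF t] by blast
  have "continuous_on (S \<inter> ball t e) (chart_inv c \<circ> (snd c \<circ> \<gamma>))"
    by (rule continuous_on_compose[OF lipschitz_on_continuous_on[OF e(3)] continuous_on_subset[OF continuous_on_chart_inv[OF c(1)]]])
      (use e(2) in auto)
  then have "continuous_on (S \<inter> ball t e) \<gamma>"
    by (rule continuous_on_eq) (use e(2) chart_inv_left[OF c(1)] in \<open>auto simp: image_subset_iff\<close>)
  then have "continuous (at t within (S \<inter> ball t e)) \<gamma>"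
    using t e(1) by (simp add: continuous_on_eq_continuous_within)
  then show "continuous (at t within S) \<gamma>"
    using at_within_nhd[of t "ball t e" S "S \<inter> ball t e"] e(1) by auto
qed

end

section \<open>Causal curves near a point\<close>

lemma lipschitz_on_mult_bounded:
  fixes f g :: "'a::metric_space \<Rightarrow> real"
  assumes f: "L-lipschitz_on S f" "\<And>x. x \<in> S \<Longrightarrow> \<bar>f x\<bar> \<le> A" and g: "M-lipschitz_on S g" "\<And>x. x \<in> S \<Longrightarrow> \<bar>g x\<bar> \<le> B"
    and "0 \<le> A" "0 \<le> B"
  shows "(A * M + B * L)-lipschitz_on S (\<lambda>x. f x * g x)"
proof (rule lipschitz_onI)
  fix x y assume xy: "x \<in> S" "y \<in> S"
  have "f x * g x - f y * g y = f x * (g x - g y) + g y * (f x - f y)" by (simp add: algebra_simps)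
  then have "\<bar>f x * g x - f y * g y\<bar> \<le> \<bar>f x\<bar> * \<bar>g x - g y\<bar> + \<bar>g y\<bar> * \<bar>f x - f y\<bar>"
    by (metis abs_mult abs_triangle_ineq)
  also have "\<dots> \<le> A * (M * dist x y) + B * (L * dist x y)"
    using f(2)[OF xy(1)] g(2)[OF xy(2)] lipschitz_onD[OF f(1) xy] lipschitz_onD[OF g(1) xy] \<open>0 \<le> A\<close> \<open>0 \<le> B\<close>
    by (intro add_mono mult_mono) (auto simp: dist_real_def)
  finally show "dist (f x * g x) (f y * g y) \<le> (A * M + B * L) * dist x y"
    by (simp add: dist_real_def algebra_simps)
qed (use assms lipschitz_on_nonneg[OF f(1)] lipschitz_on_nonneg[OF g(1)] in simp)

text \<open>The radius \<open>r\<close> and the constant \<open>\<kappa>\<close> bound the causal cones around \<open>x0\<close> uniformly away from the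
  hyperplane \<open>\<tau> = 0\<close>.\<close>

locale local_cone = local_geodesic x0 R K \<Gamma> G DG
  for x0 :: "'e::euclidean_space" and R K :: real and \<Gamma> :: "'e \<Rightarrow> 'e \<Rightarrow> 'e"
    and G :: "'e \<Rightarrow> 'e \<Rightarrow> 'e \<Rightarrow> real" and DG :: "'e \<Rightarrow> 'e \<Rightarrow> 'e \<Rightarrow> 'e \<Rightarrow> real" +
  fixes T :: 'e and \<kappa> r :: real
  assumes r: "0 < r" "r \<le> R" and \<kappa>: "0 < \<kappa>"
    and G_lorentz: "x \<in> cball x0 r \<Longrightarrow> lorentz_form (G x)"
    and T_timelike: "x \<in> cball x0 r \<Longrightarrow> G x T T < 0"
    and cone: "x \<in> cball x0 r \<Longrightarrow> G x w w \<le> 0 \<Longrightarrow> \<kappa> * norm w \<le> \<bar>G x0 T w\<bar>"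
    and cone_sign: "x \<in> cball x0 r \<Longrightarrow> G x w w \<le> 0 \<Longrightarrow> w \<noteq> 0 \<Longrightarrow> G x T w < 0 \<longleftrightarrow> G x0 T w < 0"
begin

text \<open>The lowered vector \<open>T\<close> at \<open>x0\<close>, with the sign that makes it
  positive on future-directed causal vectors.\<close>

definition \<tau> :: "'e \<Rightarrow> real" where "\<tau> w = - G x0 T w"
definition B :: real where "B = K * norm T"
definition L :: real where "L = K * (1 + 2 * R)"
text \<open>The coefficient in \<open>tau_beta_near\<close>: 3 L |T| comes from moving the base
  point of the metric and 24 K B from the gap between the final velocity and the position vector.
  The factor 1/\<kappa>^2 converts squared lengths into squared time coordinates.
  \<open>C\<^sub>3\<close> below plays the same part for the velocity of the curve.\<close>

definition C\<^sub>2 :: real where "C\<^sub>2 = (3 * L * norm T + 24 * K * B) / \<kappa>\<^sup>2"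
definition C\<^sub>3 :: real where "C\<^sub>3 = L * norm T / \<kappa>\<^sup>2"
text \<open>Chosen so that \<open>(1 + C\<^sub>3 * h) / (1 - C\<^sub>2 * h) \<le> 1 + C\<^sub>4 *
  h\<close> as long as \<open>C\<^sub>2 * h \<le> 1/2\<close>.\<close>

definition C\<^sub>4 :: real where "C\<^sub>4 = 2 * C\<^sub>2 + 2 * C\<^sub>3"
text \<open>The four entries ensure in turn that geodesics exist up to time 1, that they stay in the
  ball of radius \<open>r\<close>, that causal ones keep their time orientation, and that
  \<open>C\<^sub>2 * h t \<le> 1/2\<close> along the curves considered.\<close>

definition \<delta> :: real where "\<delta> = min (min \<rho> (2/3 * r)) (min (\<kappa> / (3 * K * B + 1)) (1 / (3 * C\<^sub>2 * B + 1)))"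

lemma x0_in: "x0 \<in> cball x0 R" "x0 \<in> cball x0 r"
  using R r by auto

lemma constants_nonneg: "0 \<le> B" "0 \<le> L" "0 \<le> C\<^sub>2" "0 \<le> C\<^sub>3" "0 \<le> C\<^sub>4"
proof -
  show B: "0 \<le> B" and L: "0 \<le> L" using K R by (auto simp: B_def L_def)
  then show C2: "0 \<le> C\<^sub>2" and C3: "0 \<le> C\<^sub>3" using K by (auto simp: C\<^sub>2_def C\<^sub>3_def)
  then show "0 \<le> C\<^sub>4" by (simp add: C\<^sub>4_def)
qed

lemma delta: "\<delta> > 0" "\<delta> \<le> \<rho>" "3/2 * \<delta> \<le> r" "3 * K * B * \<delta> < \<kappa>" "C\<^sub>2 * (B * (3/2 * \<delta>)) \<le> 1/2"
proof -
  have p: "0 < 3 * K * B + 1" "0 < 3 * C\<^sub>2 * B + 1"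
    using K constants_nonneg by (auto intro!: add_nonneg_pos)
  show pos: "\<delta> > 0" using rho(1) r \<kappa> p by (simp add: \<delta>_def)
  show "\<delta> \<le> \<rho>" by (simp add: \<delta>_def)
  have "\<delta> \<le> 2/3 * r" unfolding \<delta>_def by (simp only: min_le_iff_disj order_refl simp_thms)
  then show "3/2 * \<delta> \<le> r" by simp
  have "\<delta> \<le> \<kappa> / (3 * K * B + 1)" by (simp add: \<delta>_def)
  then have "\<delta> * (3 * K * B + 1) \<le> \<kappa>" using p(1) by (simp add: pos_le_divide_eq)
  then have "3 * K * B * \<delta> + \<delta> \<le> \<kappa>" by (simp add: algebra_simps)
  then show "3 * K * B * \<delta> < \<kappa>" using pos by linarith
  have "\<delta> \<le> 1 / (3 * C\<^sub>2 * B + 1)" by (simp add: \<delta>_def)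
  then have "\<delta> * (3 * C\<^sub>2 * B + 1) \<le> 1" using p(2) by (simp add: pos_le_divide_eq)
  then have "3 * C\<^sub>2 * B * \<delta> + \<delta> \<le> 1" by (simp add: algebra_simps)
  then have "3 * C\<^sub>2 * B * \<delta> \<le> 1" using pos by linarith
  moreover have "C\<^sub>2 * (B * (3/2 * \<delta>)) = 3 * C\<^sub>2 * B * \<delta> / 2" by simp
  ultimately show "C\<^sub>2 * (B * (3/2 * \<delta>)) \<le> 1/2" by linarith
qed

lemma tau_linear: "linear \<tau>"
  using G_bilinear[OF x0_in(1)] unfolding \<tau>_def bilinear_def by (auto intro: linear_compose_neg)

lemma tau_bound: "\<bar>\<tau> w\<bar> \<le> B * norm w"
  using G_bound[OF x0_in(1), of T w] by (simp add: \<tau>_def B_def)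

lemma tau_cone:
  assumes "x \<in> cball x0 r" "G x w w \<le> 0" "G x T w < 0"
  shows "\<kappa> * norm w \<le> \<tau> w" "0 < \<tau> w" "w \<noteq> 0"
proof -
  have "x \<in> cball x0 R" using assms(1) r by auto
  show "w \<noteq> 0" using assms(3) bilinear_rzero[OF G_bilinear[OF \<open>x \<in> cball x0 R\<close>]] by auto
  then have "G x0 T w < 0" using cone_sign[OF assms(1,2)] assms(3) by simp
  then show "0 < \<tau> w" "\<kappa> * norm w \<le> \<tau> w" using cone[OF assms(1,2)] by (auto simp: \<tau>_def)
qed

lemma traj_in_small_cball:
  assumes "norm v \<le> \<delta>" "t \<in> {0..1}" shows "traj v t \<in> cball x0 r"
proof -
  have "norm (traj v t - x0) \<le> 3/2 * norm v * t" using assms delta by (intro traj_near) auto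
  also have "\<dots> \<le> 3/2 * \<delta> * 1" using assms delta(1) by (intro mult_mono) auto
  finally show ?thesis using delta by (simp add: dist_norm norm_minus_commute)
qed

text \<open>Constant energy keeps the velocity causal. It stays future-directed because it changes
  by at most 3 K |v|^2, and in the time coordinate this is less than the margin \<kappa> |v| that
  \<open>v\<close> has.\<close>

lemma radial_geodesic_causal:
  assumes v: "norm v \<le> \<delta>" "G x0 v v \<le> 0" "0 < \<tau> v" and t: "t \<in> {0..1}"
  shows "G (traj v t) (vel v t) (vel v t) = G x0 v v" "G (traj v t) T (vel v t) < 0"
proof -
  have vr: "norm v \<le> \<rho>" using v delta by simp
  show E: "G (traj v t) (vel v t) (vel v t) = G x0 v v" by (rule energy_constant[OF vr t])
  have v0: "v \<noteq> 0" using v(3) linear_0[OF tau_linear] by auto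
  have u0: "vel v t \<noteq> 0" using vel_small(3)[OF vr, of t] v0 by auto
  have x: "traj v t \<in> cball x0 r" by (rule traj_in_small_cball[OF v(1) t])
  have "\<kappa> * norm v \<le> \<tau> v" using cone[OF x0_in(2) v(2)] v(3) by (simp add: \<tau>_def)
  moreover have "\<bar>\<tau> (vel v t - v)\<bar> < \<kappa> * norm v"
  proof -
    have "\<bar>\<tau> (vel v t - v)\<bar> \<le> B * (3 * K * (norm v)\<^sup>2)"
      using tau_bound[of "vel v t - v"] mult_left_mono[OF vel_near_sq[OF vr t] constants_nonneg(1)] by linarith
    also have "\<dots> = (3 * K * B * norm v) * norm v" by (simp add: power2_eq_square)
    also have "\<dots> \<le> (3 * K * B * \<delta>) * norm v"
      using v(1) K constants_nonneg(1) by (intro mult_right_mono mult_left_mono) auto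
    also have "\<dots> < \<kappa> * norm v" using delta(4) v0 by (intro mult_strict_right_mono) auto
    finally show ?thesis .
  qed
  ultimately have "0 < \<tau> (vel v t)" using linear_diff[OF tau_linear, of "vel v t" v] by linarith
  then have "G x0 T (vel v t) < 0" by (simp add: \<tau>_def)
  then show "G (traj v t) T (vel v t) < 0" using cone_sign[OF x _ u0] E v(2) by simp
qed

text \<open>\<open>\<beta>\<close> is the lift of \<open>x\<close> through the exponential map.\<close>

context
  fixes a b :: real and x \<beta> :: "real \<Rightarrow> 'e" and \<Lambda> :: real
  assumes ab: "a < b" and lip_x: "\<Lambda>-lipschitz_on {a..b} x" and lip_\<beta>: "\<Lambda>-lipschitz_on {a..b} \<beta>"
    and \<beta>: "\<And>t. t \<in> {a..b} \<Longrightarrow> norm (\<beta> t) \<le> \<delta>" and x\<beta>: "\<And>t. t \<in> {a..b} \<Longrightarrow> x t = traj (\<beta> t) 1"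
    and start: "\<beta> a = 0"
    and causal: "\<And>t w. a < t \<Longrightarrow> t < b \<Longrightarrow> (x has_vector_derivative w) (at t) \<Longrightarrow> G (x t) w w \<le> 0 \<and> G (x t) T w < 0"
begin

text \<open>\<open>h\<close> and \<open>Q\<close> are the functions \<tau> and q of the overview,
  read along the curve.\<close>

definition h :: "real \<Rightarrow> real" where "h t = \<tau> (x t - x0)"
definition Q :: "real \<Rightarrow> real" where "Q t = G x0 (\<beta> t) (\<beta> t)"

lemma beta_rho: "t \<in> {a..b} \<Longrightarrow> norm (\<beta> t) \<le> \<rho>"
  using \<beta> delta by fastforce

lemma curve_in: "t \<in> {a..b} \<Longrightarrow> x t \<in> cball x0 r"
  using x\<beta> traj_in_small_cball[OF \<beta>, of t 1] by simp

lemma curve_in_R: "t \<in> {a..b} \<Longrightarrow> x t \<in> cball x0 R"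
  using curve_in r by fastforce

lemma curve_start: "x a = x0"
proof -
  have "norm (x a - x0) \<le> 3/2 * norm (0::'e) * 1"
    using traj_near[of 0 1] rho(1) x\<beta>[of a] ab start by simp
  then show ?thesis by simp
qed

lemma beta_estimates:
  assumes t: "t \<in> {a..b}"
  shows "norm (x t - x0 - \<beta> t) \<le> 3 * K * (norm (\<beta> t))\<^sup>2" "norm (\<beta> t) \<le> 2 * norm (x t - x0)"
    "norm (x t - x0) \<le> 3/2 * norm (\<beta> t)"
proof -
  note br = beta_rho[OF t]
  show 1: "norm (x t - x0 - \<beta> t) \<le> 3 * K * (norm (\<beta> t))\<^sup>2"
    using traj_near_sq[OF br, of 1] x\<beta>[OF t] by simp
  show "norm (x t - x0) \<le> 3/2 * norm (\<beta> t)"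
    using traj_near[OF br, of 1] x\<beta>[OF t] by simp
  have "3 * K * (norm (\<beta> t))\<^sup>2 = (3 * K * norm (\<beta> t)) * norm (\<beta> t)" by (simp add: power2_eq_square)
  also have "\<dots> \<le> (3 * K * \<rho>) * norm (\<beta> t)" using br K by (intro mult_right_mono mult_left_mono) auto
  also have "\<dots> \<le> 1/2 * norm (\<beta> t)" using rho K by (intro mult_right_mono) auto
  finally have "norm (x t - x0 - \<beta> t) \<le> norm (\<beta> t) / 2" using 1 by simp
  moreover have "norm (\<beta> t) \<le> norm (x t - x0) + norm (x t - x0 - \<beta> t)"
    using norm_triangle_sub[of "\<beta> t" "x t - x0"] by (simp add: norm_minus_commute)
  ultimately show "norm (\<beta> t) \<le> 2 * norm (x t - x0)" by simp
qed

lemma h_lipschitz: "(B * \<Lambda>)-lipschitz_on {a..b} h"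
proof (rule lipschitz_onI)
  fix s t assume st: "s \<in> {a..b}" "t \<in> {a..b}"
  have "h s - h t = \<tau> (x s - x t)"
    using linear_diff[OF tau_linear] by (simp add: h_def)
  then have "\<bar>h s - h t\<bar> \<le> B * norm (x s - x t)" using tau_bound by metis
  also have "\<dots> \<le> B * (\<Lambda> * dist s t)"
    using lipschitz_onD[OF lip_x st] constants_nonneg by (intro mult_left_mono) (auto simp: dist_norm)
  finally show "dist (h s) (h t) \<le> B * \<Lambda> * dist s t" by (simp add: dist_real_def)
qed (use constants_nonneg lipschitz_on_nonneg[OF lip_x] in simp)

lemma h_derivative:
  assumes "(x has_vector_derivative w) (at t)" shows "(h has_real_derivative \<tau> w) (at t)"
proof -
  have "bounded_linear \<tau>" using tau_linear linear_conv_bounded_linear by blast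
  from bounded_linear.has_vector_derivative[OF this, of "\<lambda>t. x t - x0" w]
  have "((\<lambda>t. \<tau> (x t - x0)) has_vector_derivative \<tau> w) (at t)"
    using has_vector_derivative_diff[OF assms has_vector_derivative_const[of x0]] by simp
  then show ?thesis by (simp add: h_def[abs_def] has_real_derivative_iff_has_vector_derivative)
qed

lemma causal_velocity:
  assumes "a < t" "t < b" "(x has_vector_derivative w) (at t)"
  shows "\<kappa> * norm w \<le> \<tau> w" "0 < \<tau> w" "w \<noteq> 0"
proof -
  have "t \<in> {a..b}" using assms by simp
  note tc = tau_cone[OF curve_in[OF this] conjunct1[OF causal[OF assms]] conjunct2[OF causal[OF assms]]]
  show "\<kappa> * norm w \<le> \<tau> w" "0 < \<tau> w" "w \<noteq> 0" by (rule tc)+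
qed

lemma differentiable_ae:
  obtains N where "negligible N" "\<And>t. a < t \<Longrightarrow> t < b \<Longrightarrow> t \<notin> N \<Longrightarrow> \<exists>w. (x has_vector_derivative w) (at t)"
  using lipschitz_curve_vector_derivative_ae[OF lip_x ab] by blast

text \<open>One velocity in a given subinterval is enough to refute that the curve, or
  \<open>Q\<close>, is constant there.\<close>

lemma differentiable_point:
  assumes "a \<le> s" "s < t" "t \<le> b"
  obtains q w where "s < q" "q < t" "(x has_vector_derivative w) (at q)"
proof -
  obtain N where N: "negligible N" "\<And>t. a < t \<Longrightarrow> t < b \<Longrightarrow> t \<notin> N \<Longrightarrow> \<exists>w. (x has_vector_derivative w) (at t)"
    using differentiable_ae by blast
  have "\<not> negligible {s<..<t}" using assms negligible_interval(2)[of s t] box_eq_empty(1)[of s t] by auto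
  then have "\<not> {s<..<t} \<subseteq> N" using N(1) negligible_subset by blast
  then obtain q where "q \<in> {s<..<t}" "q \<notin> N" by blast
  then show thesis using N(2)[of q] that assms by auto
qed

lemma h_mono: "a \<le> s \<Longrightarrow> s \<le> t \<Longrightarrow> t \<le> b \<Longrightarrow> h s \<le> h t"
proof -
  assume st: "a \<le> s" "s \<le> t" "t \<le> b"
  obtain N where N: "negligible N" "\<And>t. a < t \<Longrightarrow> t < b \<Longrightarrow> t \<notin> N \<Longrightarrow> \<exists>w. (x has_vector_derivative w) (at t)"
    using differentiable_ae by blast
  have "- h t \<le> - h s"
  proof (rule lipschitz_nonincreasing[OF _ st(2) N(1)])
    show "(B * \<Lambda>)-lipschitz_on {s..t} (\<lambda>t. - h t)"
      using lipschitz_on_subset[OF h_lipschitz, of "{s..t}"] st by auto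
    fix q assume q: "s < q" "q < t" "q \<notin> N"
    then obtain w where w: "(x has_vector_derivative w) (at q)" using N(2) st by force
    show "\<exists>D\<le>0. ((\<lambda>t. - h t) has_real_derivative D) (at q)"
      using causal_velocity(2)[OF _ _ w] q st DERIV_minus[OF h_derivative[OF w]]
      by (intro exI[of _ "- \<tau> w"]) auto
  qed
  then show ?thesis by simp
qed

text \<open>The cone bound says that \<kappa> times the speed is at most the derivative of
  \<open>h\<close>. Pairing the displacement with the unit vector towards \<open>x t\<close> reduces
  the integrated form to a scalar function with nonpositive derivative almost everywhere.\<close>

lemma h_dominates:
  assumes t: "t \<in> {a..b}" shows "\<kappa> * norm (x t - x0) \<le> h t"
proof (cases "x t = x0")
  case False
  define e where "e = (x t - x0) /\<^sub>R norm (x t - x0)"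
  have e: "norm e = 1" "(x t - x0) \<bullet> e = norm (x t - x0)"
    using False by (auto simp: e_def dot_square_norm power2_eq_square)
  obtain N where N: "negligible N" "\<And>t. a < t \<Longrightarrow> t < b \<Longrightarrow> t \<notin> N \<Longrightarrow> \<exists>w. (x has_vector_derivative w) (at t)"
    using differentiable_ae by blast
  have lip: "\<Lambda>-lipschitz_on {a..b} (\<lambda>s. (x s - x0) \<bullet> e)"
  proof (rule lipschitz_onI)
    fix s q assume sq: "s \<in> {a..b}" "q \<in> {a..b}"
    have "\<bar>(x s - x0) \<bullet> e - (x q - x0) \<bullet> e\<bar> = \<bar>(x s - x q) \<bullet> e\<bar>" by (simp add: inner_diff_left)
    also have "\<dots> \<le> norm (x s - x q)" using Cauchy_Schwarz_ineq2[of "x s - x q" e] e by simp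
    also have "\<dots> \<le> \<Lambda> * dist s q" using lipschitz_onD[OF lip_x sq] by (simp add: dist_norm)
    finally show "dist ((x s - x0) \<bullet> e) ((x q - x0) \<bullet> e) \<le> \<Lambda> * dist s q" by (simp add: dist_real_def)
  qed (rule lipschitz_on_nonneg[OF lip_x])
  have "\<kappa> * ((x t - x0) \<bullet> e) - h t \<le> \<kappa> * ((x a - x0) \<bullet> e) - h a"
  proof (rule lipschitz_nonincreasing[where f="\<lambda>s. \<kappa> * ((x s - x0) \<bullet> e) - h s", OF _ _ N(1)])
    show "(\<kappa> * \<Lambda> + B * \<Lambda>)-lipschitz_on {a..t} (\<lambda>s. \<kappa> * ((x s - x0) \<bullet> e) - h s)"
      using t \<kappa> by (intro lipschitz_on_diff lipschitz_on_cmult_real_nonneg lipschitz_on_subset[OF lip] lipschitz_on_subset[OF h_lipschitz]) auto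
    fix q assume q: "a < q" "q < t" "q \<notin> N"
    then obtain w where w: "(x has_vector_derivative w) (at q)" using N(2) t by force
    have "((\<lambda>s. (x s - x0) \<bullet> e) has_real_derivative w \<bullet> e) (at q)"
      using bounded_linear.has_vector_derivative[OF bounded_linear_inner_left has_vector_derivative_diff[OF w has_vector_derivative_const[of x0]], of e]
      by (simp add: has_real_derivative_iff_has_vector_derivative)
    then have "((\<lambda>s. \<kappa> * ((x s - x0) \<bullet> e) - h s) has_real_derivative \<kappa> * (w \<bullet> e) - \<tau> w) (at q)"
      by (intro DERIV_diff DERIV_cmult h_derivative w)
    moreover have "\<kappa> * (w \<bullet> e) \<le> \<kappa> * norm w"
      using norm_cauchy_schwarz[of w e] e \<kappa> by (intro mult_left_mono) auto
    ultimately show "\<exists>D\<le>0. ((\<lambda>s. \<kappa> * ((x s - x0) \<bullet> e) - h s) has_real_derivative D) (at q)"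
      using causal_velocity(1)[OF _ _ w] q t by (intro exI[of _ "\<kappa> * (w \<bullet> e) - \<tau> w"]) auto
  qed (use t in auto)
  then show ?thesis using e curve_start linear_0[OF tau_linear] by (simp add: h_def)
qed (simp add: h_def linear_0[OF tau_linear])

text \<open>If \<open>h t\<close> were 0, the curve would rest at \<open>x0\<close> up to time
  \<open>t\<close> and have velocity 0 somewhere, against \<open>causal_velocity\<close>.\<close>

lemma h_pos: "a < t \<Longrightarrow> t \<le> b \<Longrightarrow> 0 < h t"
proof -
  assume t: "a < t" "t \<le> b"
  have "h t \<noteq> 0"
  proof
    assume h0: "h t = 0"
    have const: "x s = x0" if "s \<in> {a..t}" for s
    proof -
      have "\<kappa> * norm (x s - x0) \<le> 0" using h_mono[of s t] h_dominates[of s] h0 that t by auto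
      then show ?thesis using \<kappa> by (simp add: mult_le_0_iff)
    qed
    obtain q w where q: "a < q" "q < t" "(x has_vector_derivative w) (at q)"
      using differentiable_point[of a t] t by auto
    have "((\<lambda>_. x0) has_vector_derivative w) (at q)"
      by (rule has_vector_derivative_transform_within_open[OF q(3), of "{a<..<t}"]) (use q const in auto)
    then have "w = 0" using vector_derivative_unique_at[OF _ has_vector_derivative_const] by blast
    then show False using causal_velocity(3)[OF _ _ q(3)] q t by simp
  qed
  moreover have "0 \<le> h t" using h_dominates[of t] \<kappa> t by (smt (verit) atLeastAtMost_iff mult_nonneg_nonneg norm_ge_zero)
  ultimately show ?thesis by simp
qed

text \<open>The lift, the final velocity of the radial geodesic and the position vector agree up to
  O(|x - x0|^2), and \<open>h_dominates\<close> turns this into O(h^2).\<close>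

lemma tau_beta_near:
  assumes t: "t \<in> {a..b}"
  shows "\<bar>\<tau> (\<beta> t) - h t\<bar> \<le> C\<^sub>2 * (h t)\<^sup>2" "\<bar>- G (x t) T (vel (\<beta> t) 1) - h t\<bar> \<le> C\<^sub>2 * (h t)\<^sup>2" "C\<^sub>2 * h t \<le> 1/2"
proof -
  let ?n = "norm (x t - x0)" and ?P = "vel (\<beta> t) 1"
  note est = beta_estimates[OF t]
  have n: "\<kappa> * ?n \<le> h t" by (rule h_dominates[OF t])
  have bsq: "(norm (\<beta> t))\<^sup>2 \<le> 4 * ?n\<^sup>2" using power_mono[OF est(2), of 2] by (simp add: power_mult_distrib)
  have key: "(3 * L * norm T + 24 * K * B) * ?n\<^sup>2 \<le> C\<^sub>2 * (h t)\<^sup>2"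
  proof -
    have "(\<kappa> * ?n)\<^sup>2 \<le> (h t)\<^sup>2" using n \<kappa> by (intro power_mono) auto
    then have "C\<^sub>2 * (\<kappa>\<^sup>2 * ?n\<^sup>2) \<le> C\<^sub>2 * (h t)\<^sup>2"
      using constants_nonneg by (intro mult_left_mono) (auto simp: power_mult_distrib)
    then show ?thesis using \<kappa> by (simp add: C\<^sub>2_def)
  qed
  have Ln: "0 \<le> L * norm T * ?n\<^sup>2" "0 \<le> K * B * ?n\<^sup>2" using constants_nonneg K by auto
  have "\<bar>\<tau> (\<beta> t) - h t\<bar> = \<bar>\<tau> (x t - x0 - \<beta> t)\<bar>"
    by (simp add: h_def linear_diff[OF tau_linear] abs_minus_commute)
  also have "\<dots> \<le> B * (3 * K * (4 * ?n\<^sup>2))"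
    using tau_bound[of "x t - x0 - \<beta> t"] est(1) bsq K constants_nonneg
      mult_left_mono[OF order_trans[OF est(1) mult_left_mono[OF bsq, of "3 * K"]], of B] by auto
  also have "\<dots> = 12 * (K * B * ?n\<^sup>2)" by simp
  also have "\<dots> \<le> (3 * L * norm T + 24 * K * B) * ?n\<^sup>2" using Ln by (simp add: algebra_simps)
  finally show "\<bar>\<tau> (\<beta> t) - h t\<bar> \<le> C\<^sub>2 * (h t)\<^sup>2" using key by linarith
  have P1: "norm (?P - \<beta> t) \<le> 3 * K * (norm (\<beta> t))\<^sup>2" by (rule vel_near_sq[OF beta_rho[OF t]]) simp
  have P2: "norm ?P \<le> 3 * ?n" using vel_small(1)[OF beta_rho[OF t], of 1] est(2) by simp
  have "norm (?P - (x t - x0)) \<le> norm (?P - \<beta> t) + norm (x t - x0 - \<beta> t)"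
    by (metis norm_triangle_ineq4 diff_diff_eq2 diff_add_cancel add_diff_cancel_right diff_diff_add)
  also have "\<dots> \<le> 6 * K * (norm (\<beta> t))\<^sup>2" using P1 est(1) by simp
  also have "\<dots> \<le> 6 * K * (4 * ?n\<^sup>2)" using bsq K by (intro mult_left_mono) auto
  finally have P3: "norm (?P - (x t - x0)) \<le> 24 * K * ?n\<^sup>2" by simp
  have "- G (x t) T ?P - h t = - (G (x t) T ?P - G x0 T ?P) + \<tau> (?P - (x t - x0))"
    by (simp add: h_def linear_diff[OF tau_linear]) (simp add: \<tau>_def)
  then have "\<bar>- G (x t) T ?P - h t\<bar> \<le> \<bar>G (x t) T ?P - G x0 T ?P\<bar> + \<bar>\<tau> (?P - (x t - x0))\<bar>" by linarith
  also have "\<dots> \<le> L * ?n * norm T * (3 * ?n) + B * (24 * K * ?n\<^sup>2)"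
  proof (rule add_mono)
    have "\<bar>G (x t) T ?P - G x0 T ?P\<bar> \<le> L * ?n * norm T * norm ?P"
      using G_lipschitz[OF x0_in(1) curve_in_R[OF t]] by (simp add: L_def)
    also have "\<dots> \<le> L * ?n * norm T * (3 * ?n)" using P2 constants_nonneg by (intro mult_left_mono) auto
    finally show "\<bar>G (x t) T ?P - G x0 T ?P\<bar> \<le> L * ?n * norm T * (3 * ?n)" .
    show "\<bar>\<tau> (?P - (x t - x0))\<bar> \<le> B * (24 * K * ?n\<^sup>2)"
      using order_trans[OF tau_bound mult_left_mono[OF P3 constants_nonneg(1)]] .
  qed
  also have "\<dots> = (3 * L * norm T + 24 * K * B) * ?n\<^sup>2" by (simp add: power2_eq_square algebra_simps)
  finally show "\<bar>- G (x t) T ?P - h t\<bar> \<le> C\<^sub>2 * (h t)\<^sup>2" using key by linarith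
  have "h t \<le> B * ?n" using tau_bound[of "x t - x0"] by (simp add: h_def)
  also have "\<dots> \<le> B * (3/2 * \<delta>)" using est(3) \<beta>[OF t] constants_nonneg by (intro mult_left_mono) auto
  finally have "C\<^sub>2 * h t \<le> C\<^sub>2 * (B * (3/2 * \<delta>))" using constants_nonneg by (intro mult_left_mono)
  then show "C\<^sub>2 * h t \<le> 1/2" using delta by linarith
qed

lemma tau_beta_pos:
  assumes t: "a < t" "t \<le> b"
  shows "0 < \<tau> (\<beta> t)" "(1 - C\<^sub>2 * h t) * h t \<le> - G (x t) T (vel (\<beta> t) 1)" "G (x t) T (vel (\<beta> t) 1) < 0"
proof -
  have ti: "t \<in> {a..b}" using t by simp
  note n = tau_beta_near[OF ti] and hp = h_pos[OF t]
  have sq: "C\<^sub>2 * (h t)\<^sup>2 = (C\<^sub>2 * h t) * h t" by (simp add: power2_eq_square)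
  have "(C\<^sub>2 * h t) * h t \<le> 1/2 * h t" using n(3) hp by (intro mult_right_mono) auto
  then have "C\<^sub>2 * (h t)\<^sup>2 < h t" using hp sq by linarith
  then show "0 < \<tau> (\<beta> t)" "G (x t) T (vel (\<beta> t) 1) < 0" using n(1,2) by linarith+
  have "(1 - C\<^sub>2 * h t) * h t = h t - C\<^sub>2 * (h t)\<^sup>2" using sq by (simp add: algebra_simps)
  then show "(1 - C\<^sub>2 * h t) * h t \<le> - G (x t) T (vel (\<beta> t) 1)" using n(2) by linarith
qed

text \<open>The first variation compares the radial geodesics to \<open>x t\<close> and to
  \<open>x s\<close>. Its error is quadratic in the increment of the Lipschitz lift, so the
  difference quotient of \<open>Q\<close> converges although \<beta> may have no derivative at
  \<open>t\<close>.\<close>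

lemma Q_derivative:
  assumes t: "a < t" "t < b" and w: "(x has_vector_derivative w) (at t)"
  shows "(Q has_real_derivative 2 * G (x t) (vel (\<beta> t) 1) w) (at t)"
proof -
  have ti: "t \<in> {a..b}" using t by simp
  let ?P = "vel (\<beta> t) 1"
  have xt: "x t \<in> cball x0 R" by (rule curve_in_R[OF ti])
  have lin: "linear (G (x t) ?P)" using G_bilinear[OF xt] by (simp add: bilinear_def)
  then have bl: "bounded_linear (G (x t) ?P)" using linear_conv_bounded_linear by blast
  have "((\<lambda>s. G (x t) ?P (x s - x t)) has_vector_derivative G (x t) ?P w) (at t)"
    using bounded_linear.has_vector_derivative[OF bl has_vector_derivative_diff[OF w has_vector_derivative_const[of "x t"]]] by simp
  then have 1: "((\<lambda>s. 2 * G (x t) ?P (x s - x t)) has_real_derivative 2 * G (x t) ?P w) (at t)"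
    by (intro DERIV_cmult) (simp add: has_real_derivative_iff_has_vector_derivative)
  have 2: "((\<lambda>s. Q s - 2 * G (x t) ?P (x s - x t)) has_real_derivative 0) (at t)"
    unfolding has_field_derivative_def has_derivative_at_alt
  proof (intro conjI allI impI)
    show "bounded_linear ((*) (0::real))" by (rule bounded_linear_mult_right)
    fix e :: real assume e: "e > 0"
    define C where "C = 40 * K * \<Lambda>\<^sup>2 + 1"
    have C: "C > 0" using K by (auto simp: C_def intro!: add_nonneg_pos)
    define d where "d = min (min (t - a) (b - t)) (e / C)"
    show "\<exists>d>0. \<forall>s. norm (s - t) < d \<longrightarrow>
       norm (Q s - 2 * G (x t) ?P (x s - x t) - (Q t - 2 * G (x t) ?P (x t - x t)) - 0 * (s - t)) \<le> e * norm (s - t)"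
    proof (intro exI[of _ d] conjI allI impI)
      show "d > 0" using t e C by (simp add: d_def)
      fix s assume s: "norm (s - t) < d"
      then have si: "s \<in> {a..b}" "norm (s - t) < e / C" by (auto simp: d_def abs_less_iff)
      have "\<bar>Q s - Q t - 2 * G (x t) ?P (x s - x t)\<bar> \<le> 40 * K * (norm (\<beta> s - \<beta> t))\<^sup>2"
        using energy_first_variation[OF beta_rho[OF ti] beta_rho[OF si(1)]] x\<beta>[OF ti] x\<beta>[OF si(1)] by (simp add: Q_def)
      also have "\<dots> \<le> 40 * K * (\<Lambda> * norm (s - t))\<^sup>2"
        using lipschitz_onD[OF lip_\<beta> si(1) ti] K by (intro mult_left_mono power_mono) (auto simp: dist_norm)
      also have "\<dots> \<le> C * (norm (s - t))\<^sup>2" by (simp add: C_def power_mult_distrib algebra_simps)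
      also have "\<dots> = (C * norm (s - t)) * norm (s - t)" by (simp add: power2_eq_square)
      also have "\<dots> \<le> e * norm (s - t)" using si(2) C by (intro mult_right_mono) (auto simp: field_simps)
      finally show "norm (Q s - 2 * G (x t) ?P (x s - x t) - (Q t - 2 * G (x t) ?P (x t - x t)) - 0 * (s - t)) \<le> e * norm (s - t)"
        by (simp add: linear_0[OF lin])
    qed
  qed
  show ?thesis using DERIV_add[OF 2 1] by simp
qed

lemma Q_bound: "t \<in> {a..b} \<Longrightarrow> \<bar>Q t\<bar> \<le> 4 * K / \<kappa>\<^sup>2 * (h t)\<^sup>2"
proof -
  assume t: "t \<in> {a..b}"
  have "\<bar>Q t\<bar> \<le> K * (norm (\<beta> t))\<^sup>2"
    using G_bound[OF x0_in(1), of "\<beta> t" "\<beta> t"] by (simp add: Q_def power2_eq_square mult.assoc)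
  also have "\<dots> \<le> K * (2 * norm (x t - x0))\<^sup>2"
    using beta_estimates(2)[OF t] K by (intro mult_left_mono power_mono) auto
  also have "\<dots> = 4 * K / \<kappa>\<^sup>2 * (\<kappa> * norm (x t - x0))\<^sup>2" using \<kappa> by (simp add: power_mult_distrib)
  also have "\<dots> \<le> 4 * K / \<kappa>\<^sup>2 * (h t)\<^sup>2"
    using h_dominates[OF t] K \<kappa> by (intro mult_left_mono power_mono) auto
  finally show "\<bar>Q t\<bar> \<le> 4 * K / \<kappa>\<^sup>2 * (h t)\<^sup>2" .
qed

lemma Q_lipschitz: "(2 * K * \<delta> * \<Lambda>)-lipschitz_on {a..b} Q"
proof (rule lipschitz_onI)
  fix s t assume st: "s \<in> {a..b}" "t \<in> {a..b}"
  note bl = G_bilinear[OF x0_in(1)]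
  have eq: "Q s - Q t = G x0 (\<beta> s - \<beta> t) (\<beta> s) + G x0 (\<beta> t) (\<beta> s - \<beta> t)"
    by (simp add: Q_def bilinear_lsub[OF bl] bilinear_rsub[OF bl])
  have "\<bar>G x0 (\<beta> s - \<beta> t) (\<beta> s)\<bar> \<le> K * (\<Lambda> * dist s t) * \<delta>" 
    by (rule order_trans[OF G_bound[OF x0_in(1)]])
      (use lipschitz_onD[OF lip_\<beta> st] \<beta>[OF st(1)] K lipschitz_on_nonneg[OF lip_\<beta>] in \<open>intro mult_mono; auto simp: dist_norm\<close>)
  moreover have "\<bar>G x0 (\<beta> t) (\<beta> s - \<beta> t)\<bar> \<le> K * \<delta> * (\<Lambda> * dist s t)"
    by (rule order_trans[OF G_bound[OF x0_in(1)]])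
      (use lipschitz_onD[OF lip_\<beta> st] \<beta>[OF st(2)] K delta(1) in \<open>intro mult_mono; auto simp: dist_norm\<close>)
  ultimately show "dist (Q s) (Q t) \<le> 2 * K * \<delta> * \<Lambda> * dist s t"
    unfolding dist_real_def eq by (simp add: mult_ac)
qed (use K delta lipschitz_on_nonneg[OF lip_x] in simp)

text \<open>Where the lift is spacelike, the position vector becomes causal after adding a multiple of \<open>T\<close>;
  this bounds the growth of \<open>Q\<close>.\<close>

lemma Q_growth:
  assumes t: "a < t" "t < b" and w: "(x has_vector_derivative w) (at t)" and Qt: "0 < Q t"
  shows "2 * G (x t) (vel (\<beta> t) 1) w \<le> Q t * \<tau> w * (1 / h t + C\<^sub>4)"
proof -
  have ti: "t \<in> {a..b}" and tb: "t \<le> b" using t by auto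
  let ?P = "vel (\<beta> t) 1" and ?x = "x t"
  have xr: "?x \<in> cball x0 r" and xR: "?x \<in> cball x0 R" by (rule curve_in[OF ti] curve_in_R[OF ti])+
  note bl = G_bilinear[OF xR] and lf = G_lorentz[OF xr] and Tt = T_timelike[OF xr] and hp = h_pos[OF t(1) tb]
  have ca: "G ?x w w \<le> 0" "G ?x T w < 0" using causal[OF t w] by auto
  note cv = causal_velocity[OF t w]
  define \<alpha> where "\<alpha> = - G ?x T ?P"
  have \<alpha>: "0 < \<alpha>" "(1 - C\<^sub>2 * h t) * h t \<le> \<alpha>" using tau_beta_pos[OF t(1) tb] by (auto simp: \<alpha>_def)
  \<comment> \<open>With this multiple the terms Q and -2 q \<alpha> in the square of the corrected
    vector cancel, which leaves q^2 G(T, T).\<close>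
  define q where "q = Q t / (2 * \<alpha>)"
  have q: "0 < q" using Qt \<alpha> by (simp add: q_def)
  define Z where "Z = ?P + q *\<^sub>R T"
  have GP: "G ?x ?P ?P = Q t" using energy_constant[OF beta_rho[OF ti], of 1] x\<beta>[OF ti] by (simp add: Q_def)
  have "G ?x Z Z = Q t + 2 * q * (- \<alpha>) + q * q * G ?x T T"
    using G_sym[OF xR, of ?P T] GP
    by (simp add: Z_def \<alpha>_def bilinear_ladd[OF bl] bilinear_radd[OF bl] bilinear_lmul[OF bl] bilinear_rmul[OF bl] algebra_simps)
  also have "\<dots> = q * q * G ?x T T" using \<alpha>(1) by (simp add: q_def)
  also have "\<dots> \<le> 0" using Tt q by (intro mult_nonneg_nonpos) auto
  finally have Z1: "G ?x Z Z \<le> 0" .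
  have "G ?x T Z = - \<alpha> + q * G ?x T T"
    by (simp add: Z_def \<alpha>_def bilinear_radd[OF bl] bilinear_rmul[OF bl])
  then have Z2: "G ?x T Z < 0" using \<alpha>(1) mult_pos_neg[OF q Tt] by linarith
  \<comment> \<open>Future-directed causal vectors have nonpositive product; this bounds the pairing
    of the radial velocity with \<open>w\<close> by that of the correction along
    \<open>T\<close>.\<close>
  have "G ?x Z w \<le> 0" by (rule timelike_complement_inner(1)[OF lf Tt Z2 ca(2) Z1 ca(1)])
  then have 1: "2 * G ?x ?P w \<le> 2 * q * (- G ?x T w)"
    by (simp add: Z_def bilinear_ladd[OF bl] bilinear_lmul[OF bl])
  have "- G ?x T w \<le> \<tau> w + L * norm (?x - x0) * norm T * norm w"
    using G_lipschitz[OF x0_in(1) xR, of T w] by (simp add: \<tau>_def L_def abs_le_iff)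
  also have "\<dots> \<le> \<tau> w + C\<^sub>3 * h t * \<tau> w"
  proof -
    have "norm (?x - x0) \<le> h t / \<kappa>" "norm w \<le> \<tau> w / \<kappa>"
      using h_dominates[OF ti] cv(1) \<kappa> by (auto simp: field_simps)
    then have "(L * norm T) * (norm (?x - x0) * norm w) \<le> (L * norm T) * ((h t / \<kappa>) * (\<tau> w / \<kappa>))"
      using constants_nonneg hp \<kappa> by (intro mult_left_mono mult_mono) auto
    also have "\<dots> = C\<^sub>3 * h t * \<tau> w" by (simp add: C\<^sub>3_def power2_eq_square)
    finally show ?thesis by (simp add: mult_ac)
  qed
  finally have 2: "- G ?x T w \<le> \<tau> w * (1 + C\<^sub>3 * h t)" by (simp add: algebra_simps)
  have y: "C\<^sub>2 * h t \<le> 1/2" by (rule tau_beta_near(3)[OF ti])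
  have pos: "0 < 1 - C\<^sub>2 * h t" using y by simp
  have "2 * q * (- G ?x T w) \<le> 2 * q * (\<tau> w * (1 + C\<^sub>3 * h t))" using 2 q by (intro mult_left_mono) auto
  also have "\<dots> = Q t * \<tau> w * (1 + C\<^sub>3 * h t) / \<alpha>" by (simp add: q_def)
  also have "\<dots> \<le> Q t * \<tau> w * (1 + C\<^sub>3 * h t) / ((1 - C\<^sub>2 * h t) * h t)"
    using \<alpha> pos hp Qt cv(2) constants_nonneg by (intro divide_left_mono mult_nonneg_nonneg mult_pos_pos) auto
  also have "\<dots> \<le> Q t * \<tau> w * ((1 + C\<^sub>4 * h t) * (1 - C\<^sub>2 * h t)) / ((1 - C\<^sub>2 * h t) * h t)"
  proof (intro divide_right_mono mult_left_mono)
    have "C\<^sub>4 * h t * (C\<^sub>2 * h t) \<le> C\<^sub>4 * h t * (1/2)" using y constants_nonneg hp by (intro mult_left_mono) auto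
    then show "1 + C\<^sub>3 * h t \<le> (1 + C\<^sub>4 * h t) * (1 - C\<^sub>2 * h t)" by (simp add: C\<^sub>4_def algebra_simps)
  qed (use Qt cv(2) pos hp in auto)
  also have "\<dots> = Q t * \<tau> w * (1 / h t + C\<^sub>4)" using pos hp by (simp add: field_simps)
  finally show ?thesis using 1 by linarith
qed

text \<open>The function \<open>exp (- C\<^sub>4 * y) / y\<close> is the integrating factor for the
  bound in \<open>Q_growth\<close>. It is singular at y = 0, so the interval begins after
  \<open>a\<close>; there \<open>h\<close> is at least \<open>h s > 0\<close> and the weight is
  Lipschitz.\<close>

lemma Q_weighted_decreasing:
  assumes s: "a < s" "s < t" "t \<le> b" and Qp: "\<And>q. s < q \<Longrightarrow> q < t \<Longrightarrow> 0 < Q q"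
  shows "Q t * (exp (- C\<^sub>4 * h t) / h t) \<le> Q s * (exp (- C\<^sub>4 * h s) / h s)"
proof -
  define \<phi> where "\<phi> y = exp (- C\<^sub>4 * y) / y" for y :: real
  define y0 where "y0 = h s"
  have y0: "y0 > 0" using h_pos[of s] s by (simp add: y0_def)
  have \<phi>': "(\<phi> has_real_derivative - \<phi> y * (C\<^sub>4 + 1 / y)) (at y)" if "y > 0" for y
    using that unfolding \<phi>_def
    by (auto intro!: derivative_eq_intros simp: field_simps power2_eq_square)
  have \<phi>b: "0 < \<phi> y" "\<phi> y \<le> 1 / y0" if "y \<ge> y0" for y
  proof -
    have yp: "y > 0" using that y0 by simp
    then show "0 < \<phi> y" by (simp add: \<phi>_def)
    have "exp (- C\<^sub>4 * y) \<le> 1" using constants_nonneg yp by simp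
    then have "\<phi> y \<le> 1 / y" using yp by (simp add: \<phi>_def divide_right_mono)
    also have "\<dots> \<le> 1 / y0" using that y0 by (simp add: frac_le)
    finally show "\<phi> y \<le> 1 / y0" .
  qed
  have \<phi>_lip: "(1 / y0 * (C\<^sub>4 + 1 / y0))-lipschitz_on {y0..} \<phi>"
  proof (rule lipschitz_onI)
    fix y z assume yz: "y \<in> {y0..}" "z \<in> {y0..}"
    have "norm (\<phi> y - \<phi> z) \<le> 1 / y0 * (C\<^sub>4 + 1 / y0) * norm (y - z)"
    proof (rule differentiable_bound[of "{y0..}" \<phi> "\<lambda>y d. (- \<phi> y * (C\<^sub>4 + 1 / y)) * d"])
      fix u assume u: "u \<in> {y0..}"
      then have up: "u > 0" using y0 by simp
      show "(\<phi> has_derivative (\<lambda>d. (- \<phi> u * (C\<^sub>4 + 1 / u)) * d)) (at u within {y0..})"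
        using \<phi>'[OF up] unfolding has_field_derivative_def by (rule has_derivative_at_withinI)
      have "\<phi> u * (C\<^sub>4 + 1 / u) \<le> 1 / y0 * (C\<^sub>4 + 1 / y0)"
        using \<phi>b[of u] u y0 constants_nonneg by (intro mult_mono add_left_mono) (auto simp: frac_le)
      moreover have "0 \<le> \<phi> u * (C\<^sub>4 + 1 / u)" using \<phi>b[of u] u up constants_nonneg by auto
      ultimately have "\<bar>- \<phi> u * (C\<^sub>4 + 1 / u)\<bar> \<le> 1 / y0 * (C\<^sub>4 + 1 / y0)" by simp
      then have "norm (- \<phi> u * (C\<^sub>4 + 1 / u) * d) \<le> 1 / y0 * (C\<^sub>4 + 1 / y0) * norm d" for d
        unfolding real_norm_def abs_mult[of _ d] by (rule mult_right_mono) simp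
      then show "onorm ((*) (- \<phi> u * (C\<^sub>4 + 1 / u))) \<le> 1 / y0 * (C\<^sub>4 + 1 / y0)"
        by (rule onorm_le)
    qed (use yz in auto)
    then show "dist (\<phi> y) (\<phi> z) \<le> 1 / y0 * (C\<^sub>4 + 1 / y0) * dist y z" by (simp add: dist_norm)
  qed (use y0 constants_nonneg in auto)
  have sub: "{s..t} \<subseteq> {a..b}" using s by auto
  have him: "h q \<in> {y0..}" if "q \<in> {s..t}" for q
    using h_mono[of s q] that s by (simp add: y0_def)
  have lip1: "(1 / y0 * (C\<^sub>4 + 1 / y0) * (B * \<Lambda>))-lipschitz_on {s..t} (\<lambda>q. \<phi> (h q))"
    by (rule lipschitz_on_compose2[OF lipschitz_on_subset[OF h_lipschitz sub] lipschitz_on_subset[OF \<phi>_lip]])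
      (use him in blast)
  define H where "H = 4 * K / \<kappa>\<^sup>2 * (h b)\<^sup>2"
  have Qb: "\<bar>Q q\<bar> \<le> H" if "q \<in> {s..t}" for q
  proof -
    have q: "q \<in> {a..b}" using that sub by blast
    have "(h q)\<^sup>2 \<le> (h b)\<^sup>2" using h_mono[of q b] h_pos[of q] that s q by (intro power_mono) auto
    then have "4 * K / \<kappa>\<^sup>2 * (h q)\<^sup>2 \<le> H" using K unfolding H_def by (intro mult_left_mono) auto
    then show ?thesis using Q_bound[OF q] by linarith
  qed
  have H0: "0 \<le> H" using K by (simp add: H_def)
  obtain N where N: "negligible N" "\<And>t. a < t \<Longrightarrow> t < b \<Longrightarrow> t \<notin> N \<Longrightarrow> \<exists>w. (x has_vector_derivative w) (at t)"
    using differentiable_ae by blast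
  have "Q t * \<phi> (h t) \<le> Q s * \<phi> (h s)"
  proof (rule lipschitz_nonincreasing[where f="\<lambda>q. Q q * \<phi> (h q)", OF _ _ N(1)])
    show "(H * (1 / y0 * (C\<^sub>4 + 1 / y0) * (B * \<Lambda>)) + 1 / y0 * (2 * K * \<delta> * \<Lambda>))-lipschitz_on {s..t} (\<lambda>q. Q q * \<phi> (h q))"
    proof (rule lipschitz_on_mult_bounded[OF lipschitz_on_subset[OF Q_lipschitz sub] Qb lip1])
      show "\<bar>\<phi> (h q)\<bar> \<le> 1 / y0" if "q \<in> {s..t}" for q using \<phi>b[of "h q"] him[OF that] by auto
    qed (use H0 y0 in auto)
    fix q assume q: "s < q" "q < t" "q \<notin> N"
    have qa: "a < q" "q < b" "q \<le> b" using q s by auto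
    then obtain w where w: "(x has_vector_derivative w) (at q)" using N(2) q by blast
    have hq: "h q > 0" using h_pos[OF qa(1,3)] .
    have hd: "(h has_real_derivative \<tau> w) (at q)" by (rule h_derivative[OF w])
    have "((\<lambda>q. \<phi> (h q)) has_real_derivative (- \<phi> (h q) * (C\<^sub>4 + 1 / h q)) * \<tau> w) (at q)"
      by (rule DERIV_chain2[OF \<phi>'[OF hq] hd])
    from DERIV_mult[OF Q_derivative[OF qa(1,2) w] this]
    have d: "((\<lambda>q. Q q * \<phi> (h q)) has_real_derivative
       \<phi> (h q) * (2 * G (x q) (vel (\<beta> q) 1) w - Q q * \<tau> w * (1 / h q + C\<^sub>4))) (at q)"
      by (simp add: algebra_simps)
    have "\<phi> (h q) * (2 * G (x q) (vel (\<beta> q) 1) w - Q q * \<tau> w * (1 / h q + C\<^sub>4)) \<le> 0"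
      using Q_growth[OF qa(1,2) w Qp[OF q(1,2)]] hq by (intro mult_nonneg_nonpos) (auto simp: \<phi>_def)
    with d show "\<exists>D\<le>0. ((\<lambda>q. Q q * \<phi> (h q)) has_real_derivative D) (at q)" by blast
  qed (use s in simp)
  then show ?thesis by (simp add: \<phi>_def)
qed

text \<open>Let s be the last time before \<open>t\<close> with Q \<le> 0. From then on the weighted
  \<open>Q\<close> does not increase, so it stays above its positive value at \<open>t\<close>. If s
  > a this contradicts Q s \<le> 0; if s = a it contradicts Q = O(h^2), by which the weighted
  \<open>Q\<close> tends to 0 at \<open>a\<close>.\<close>

lemma Q_nonpos:
  assumes t: "t \<in> {a..b}" shows "Q t \<le> 0"
proof (rule ccontr)
  assume "\<not> Q t \<le> 0"
  then have Qt: "0 < Q t" by simp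
  have Qa: "Q a = 0" using start bilinear_lzero[OF G_bilinear[OF x0_in(1)]] by (simp add: Q_def)
  have at: "a < t" using t Qt Qa by (cases "a = t") auto
  have tb: "t \<le> b" using t by simp
  have cont: "continuous_on {a..t} Q"
    by (rule continuous_on_subset[OF lipschitz_on_continuous_on[OF Q_lipschitz]]) (use tb in auto)
  let ?S = "{s\<in>{a..t}. Q s \<le> 0}"
  have "closedin (top_of_set {a..t}) ?S"
    using continuous_closedin_preimage[OF cont closed_atMost[of 0]] by (simp add: vimage_def Int_def)
  then have "compact ?S" by (rule closedin_compact[OF compact_Icc])
  moreover have "a \<in> ?S" using Qa at by simp
  then have "?S \<noteq> {}" by blast
  ultimately obtain s where s: "s \<in> ?S" "\<And>q. q \<in> ?S \<Longrightarrow> q \<le> s"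
    using compact_attains_sup[of ?S] by blast
  have st: "s < t" using s(1) Qt by (cases "s = t") auto
  have Qp: "0 < Q q" if "s < q" "q < t" for q
    using s(2)[of q] s(1) that by (cases "Q q \<le> 0") auto
  define \<eta> where "\<eta> = Q t * (exp (- C\<^sub>4 * h t) / h t)"
  have \<eta>: "0 < \<eta>" using Qt h_pos[OF at tb] by (simp add: \<eta>_def)
  show False
  proof (cases "s = a")
    case False
    then have as: "a < s" using s(1) by simp
    have "\<eta> \<le> Q s * (exp (- C\<^sub>4 * h s) / h s)"
      unfolding \<eta>_def by (rule Q_weighted_decreasing[OF as st tb Qp])
    also have "\<dots> \<le> 0" using s(1) h_pos[OF as] st tb by (intro mult_nonpos_nonneg) auto
    finally show False using \<eta> by simp
  next
    case True
    define C where "C = 4 * K / \<kappa>\<^sup>2 * (B * \<Lambda>) + 1"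
    have C: "C > 0" using K constants_nonneg lipschitz_on_nonneg[OF lip_x] by (auto simp: C_def intro!: add_nonneg_pos)
    \<comment> \<open>So close to \<open>a\<close> that the weighted value, at most (C - 1) (q - a),
      does not exceed \<eta>/2.\<close>
    define q where "q = a + min ((t - a) / 2) (\<eta> / (2 * C))"
    have q: "a < q" "q < t" "q - a \<le> \<eta> / (2 * C)" using at \<eta> C by (auto simp: q_def min_def field_simps)
    have qb: "q \<le> b" "q \<in> {a..b}" using q tb by auto
    have hq: "0 < h q" by (rule h_pos[OF q(1) qb(1)])
    have "\<eta> \<le> Q q * (exp (- C\<^sub>4 * h q) / h q)"
      unfolding \<eta>_def by (rule Q_weighted_decreasing[OF q(1,2) tb]) (use Qp q True in auto)
    also have "\<dots> \<le> (4 * K / \<kappa>\<^sup>2 * (h q)\<^sup>2) * (1 / h q)"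
      using Q_bound[OF qb(2)] hq K constants_nonneg
      by (intro mult_mono divide_right_mono) auto
    also have "\<dots> = 4 * K / \<kappa>\<^sup>2 * h q" using hq by (simp add: power2_eq_square)
    also have "\<dots> \<le> 4 * K / \<kappa>\<^sup>2 * (B * \<Lambda> * (q - a))"
    proof (rule mult_left_mono)
      have "dist (h q) (h a) \<le> B * \<Lambda> * dist q a" by (rule lipschitz_onD[OF h_lipschitz]) (use qb ab in auto)
      then show "h q \<le> B * \<Lambda> * (q - a)"
        using q(1) curve_start linear_0[OF tau_linear] by (simp add: dist_real_def h_def)
    qed (use K in simp)
    also have "\<dots> = (C - 1) * (q - a)" by (simp add: C_def)
    also have "\<dots> \<le> C * (q - a)" using q(1) by (simp add: left_diff_distrib)
    also have "\<dots> \<le> C * (\<eta> / (2 * C))" using q(3) C by (intro mult_left_mono) auto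
    also have "\<dots> = \<eta> / 2" using C by simp
    finally show False using \<eta> by simp
  qed
qed

lemma lift_causal:
  assumes "a < t" "t \<le> b" shows "G x0 (\<beta> t) (\<beta> t) \<le> 0" "0 < \<tau> (\<beta> t)"
  using Q_nonpos[of t] tau_beta_pos(1)[OF assms] assms by (auto simp: Q_def)

text \<open>The radial velocity is causal by \<open>Q_nonpos\<close>, so its product with a timelike
  velocity is strictly negative and \<open>Q\<close> decreases. Were \<open>Q b = 0\<close>, then
  \<open>Q\<close> would vanish throughout, against its negative derivative at some point.\<close>

lemma lift_timelike:
  assumes timelike: "\<And>t w. a < t \<Longrightarrow> t < b \<Longrightarrow> (x has_vector_derivative w) (at t) \<Longrightarrow> G (x t) w w < 0"
  shows "G x0 (\<beta> b) (\<beta> b) < 0"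
proof -
  have neg: "2 * G (x t) (vel (\<beta> t) 1) w < 0" if t: "a < t" "t < b" and w: "(x has_vector_derivative w) (at t)" for t w
  proof -
    have ti: "t \<in> {a..b}" "t \<le> b" using t by auto
    have xr: "x t \<in> cball x0 r" by (rule curve_in[OF ti(1)])
    have "G (x t) (vel (\<beta> t) 1) (vel (\<beta> t) 1) \<le> 0"
      using energy_constant[OF beta_rho[OF ti(1)], of 1] x\<beta>[OF ti(1)] Q_nonpos[OF ti(1)] by (simp add: Q_def)
    then have "G (x t) (vel (\<beta> t) 1) w < 0"
      using timelike_complement_inner(2)[OF G_lorentz[OF xr] T_timelike[OF xr] tau_beta_pos(3)[OF t(1) ti(2)]]
        causal[OF t w] timelike[OF t w] by blast
    then show ?thesis by simp
  qed
  obtain N where N: "negligible N" "\<And>t. a < t \<Longrightarrow> t < b \<Longrightarrow> t \<notin> N \<Longrightarrow> \<exists>w. (x has_vector_derivative w) (at t)"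
    using differentiable_ae by blast
  have mono: "Q t \<le> Q s" if st: "a \<le> s" "s \<le> t" "t \<le> b" for s t
  proof (rule lipschitz_nonincreasing[OF _ st(2) N(1)])
    show "(2 * K * \<delta> * \<Lambda>)-lipschitz_on {s..t} Q"
      by (rule lipschitz_on_subset[OF Q_lipschitz]) (use st in auto)
    fix q assume q: "s < q" "q < t" "q \<notin> N"
    have qa: "a < q" "q < b" using q st by auto
    then obtain w where w: "(x has_vector_derivative w) (at q)" using N(2) q by blast
    show "\<exists>D\<le>0. (Q has_real_derivative D) (at q)"
      using Q_derivative[OF qa w] neg[OF qa w] by (intro exI[of _ "2 * G (x q) (vel (\<beta> q) 1) w"]) auto
  qed
  have "Q b \<noteq> 0"
  proof
    assume Qb: "Q b = 0"
    have zero: "Q t = 0" if "t \<in> {a..b}" for t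
      using mono[of t b] Q_nonpos[OF that] Qb that by auto
    obtain q w where q: "a < q" "q < b" "(x has_vector_derivative w) (at q)"
      using differentiable_point[of a b] ab by auto
    have "((\<lambda>_. 0) has_real_derivative 2 * G (x q) (vel (\<beta> q) 1) w) (at q)"
      by (rule has_field_derivative_transform_within_open[OF Q_derivative[OF q], of "{a<..<b}"]) (use q zero in auto)
    then have "2 * G (x q) (vel (\<beta> q) 1) w = 0" using DERIV_unique[OF _ DERIV_const] by blast
    then show False using neg[OF q] by simp
  qed
  then have "Q b < 0" using Q_nonpos[of b] ab by simp
  then show ?thesis by (simp add: Q_def)
qed

end

end

section \<open>The local exponential map and the cones at a point\<close>

context local_spray
begin

definition E :: "'e \<Rightarrow> 'e" where "E v = traj v 1"

text \<open>By \<open>vel_lip\<close> at time 1, \<open>E\<close> differs from the identity by a map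
  with Lipschitz constant 1/4.\<close>

lemma E_bilipschitz:
  assumes v: "norm v \<le> \<rho>" and w: "norm w \<le> \<rho>"
  shows "norm (E v - E w) \<le> 2 * norm (v - w)" "norm (v - w) \<le> 2 * norm (E v - E w)"
proof -
  have *: "norm (E v - E w - (v - w)) \<le> norm (v - w) / 4"
    using vel_lip(2)[OF v w, of 1] by (simp add: E_def)
  have "norm (E v - E w) \<le> norm (v - w) + norm (E v - E w - (v - w))"
    by (metis norm_triangle_sub)
  then show "norm (E v - E w) \<le> 2 * norm (v - w)" using * norm_ge_zero[of "v - w"] by linarith
  have "norm (v - w) \<le> norm (E v - E w) + norm (E v - E w - (v - w))"
    by (metis norm_triangle_sub norm_minus_commute)
  then show "norm (v - w) \<le> 2 * norm (E v - E w)" using * norm_ge_zero[of "v - w"] by linarith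
qed

lemma E_inj: "inj_on E (cball 0 \<rho>)"
  using E_bilipschitz(2) by (intro inj_onI) (force simp: dist_norm)

lemma E_continuous: "continuous_on (cball 0 \<rho>) E"
proof -
  have "2-lipschitz_on (cball 0 \<rho>) E"
    using E_bilipschitz(1) by (intro lipschitz_onI) (auto simp: dist_norm)
  then show ?thesis by (rule lipschitz_on_continuous_on)
qed

lemma E_0: "E 0 = x0"
  using traj_near[of 0 1] rho(1) by (simp add: E_def)

text \<open>Invariance of domain asks for continuity and injectivity, and so takes the place of the
  inverse function theorem for a map that may fail to be differentiable.\<close>

lemma E_open_image:
  assumes "\<epsilon> \<le> \<rho>" shows "open (E ` ball 0 \<epsilon>)"
  by (rule invariance_of_domain[OF continuous_on_subset[OF E_continuous] open_ball inj_on_subset[OF E_inj]])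
    (use assms in auto)

lemma E_homeomorphism:
  assumes "\<epsilon> \<le> \<rho>"
  obtains E' where "homeomorphism (ball 0 \<epsilon>) (E ` ball 0 \<epsilon>) E E'"
  by (rule invariance_of_domain_homeomorphism[OF open_ball continuous_on_subset[OF E_continuous] _ inj_on_subset[OF E_inj]])
    (use assms in auto)

end

section \<open>The future cones in the tangent space and their topology\<close>

context local_cone
begin

definition I0 :: "'e set" where "I0 = {v. G x0 v v < 0 \<and> 0 < \<tau> v}"
definition J0 :: "'e set" where "J0 = {0} \<union> {v. G x0 v v \<le> 0 \<and> 0 < \<tau> v}"

text \<open>The bound in \<open>cone\<close> absorbs the separately listed vertex:
  \<open>\<kappa> * norm v \<le> \<tau> v\<close> is a closed condition that also holds at 0, which
  makes closedness of the cone evident.\<close>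

lemma J0_eq: "J0 = {v. G x0 v v \<le> 0 \<and> \<kappa> * norm v \<le> \<tau> v}"
proof (intro set_eqI iffI)
  fix v assume "v \<in> J0"
  then show "v \<in> {v. G x0 v v \<le> 0 \<and> \<kappa> * norm v \<le> \<tau> v}"
    using cone[OF x0_in(2), of v] bilinear_lzero[OF G_bilinear[OF x0_in(1)]] linear_0[OF tau_linear]
    by (auto simp: J0_def \<tau>_def)
next
  fix v assume v: "v \<in> {v. G x0 v v \<le> 0 \<and> \<kappa> * norm v \<le> \<tau> v}"
  then show "v \<in> J0"
    using less_le_trans[OF mult_pos_pos[OF \<kappa>, of "norm v"], of "\<tau> v"] by (cases "v = 0") (auto simp: J0_def)
qed

lemma continuous_on_G0: "continuous_on UNIV (\<lambda>v. G x0 v v)" and continuous_on_tau: "continuous_on UNIV \<tau>"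
proof -
  have "bounded_bilinear (G x0)" using G_bilinear[OF x0_in(1)] bilinear_conv_bounded_bilinear by blast
  then show "continuous_on UNIV (\<lambda>v. G x0 v v)"
    by (intro bounded_bilinear.continuous_on[of "G x0"] continuous_intros)
  show "continuous_on UNIV \<tau>" using tau_linear linear_continuous_on linear_conv_bounded_linear by blast
qed

lemma I0_open: "open I0"
  unfolding I0_def Collect_conj_eq
  by (intro open_Int open_Collect_less continuous_on_G0 continuous_on_tau continuous_on_const)

lemma J0_closed: "closed J0"
  unfolding J0_eq Collect_conj_eq
  by (intro closed_Int closed_Collect_le continuous_on_G0 continuous_on_tau continuous_intros)

lemma G0_shift: "G x0 (v + s *\<^sub>R T) (v + s *\<^sub>R T) = G x0 v v - 2 * s * \<tau> v + s * s * G x0 T T"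
proof -
  note bl = G_bilinear[OF x0_in(1)]
  show ?thesis using G_sym[OF x0_in(1), of v T]
    by (simp add: bilinear_ladd[OF bl] bilinear_radd[OF bl] bilinear_lmul[OF bl] bilinear_rmul[OF bl] \<tau>_def algebra_simps)
qed

lemma tau_shift: "\<tau> (v + s *\<^sub>R T) = \<tau> v - s * G x0 T T"
  using linear_add[OF tau_linear] linear_scale[OF tau_linear] by (simp add: \<tau>_def)

lemma shift_tendsto:
  fixes v :: 'e
  assumes "open S" "v \<in> S" obtains d where "d > 0" "\<And>s. \<bar>s\<bar> < d \<Longrightarrow> v + s *\<^sub>R T \<in> S"
proof -
  have "isCont (\<lambda>s. v + s *\<^sub>R T) 0" by (intro continuous_intros)
  then have "\<forall>\<^sub>F s in at 0. v + s *\<^sub>R T \<in> S"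
    using topological_tendstoD[of "\<lambda>s. v + s *\<^sub>R T" v "at 0" S] assms by (simp add: isCont_def)
  then obtain d where "d > 0" "\<forall>s. s \<noteq> 0 \<and> dist s 0 < d \<longrightarrow> v + s *\<^sub>R T \<in> S"
    unfolding eventually_at by blast
  then show thesis using that[of d] assms(2)
    by (metis add.right_neutral dist_0_norm dist_commute real_norm_def scaleR_zero_left)
qed

lemma I0_subset_J0: "I0 \<subseteq> J0"
  by (auto simp: I0_def J0_def)

text \<open>Adding a small positive multiple of \<open>T\<close> moves any vector of the closed cone
  into the open one.\<close>

lemma closure_I0: "closure I0 = J0"
proof
  show "closure I0 \<subseteq> J0" by (rule closure_minimal[OF I0_subset_J0 J0_closed])
  show "J0 \<subseteq> closure I0"
  proof
    fix v assume v: "v \<in> J0"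
    have Tt: "G x0 T T < 0" by (rule T_timelike[OF x0_in(2)])
    have v': "G x0 v v \<le> 0" "0 \<le> \<tau> v"
      using v linear_0[OF tau_linear] bilinear_lzero[OF G_bilinear[OF x0_in(1)]] by (auto simp: J0_def)
    show "v \<in> closure I0"
      unfolding closure_iff_nhds_not_empty
    proof (intro allI impI)
      fix S V assume "V \<subseteq> S" "v \<in> V" "open V"
      then obtain d where d: "d > 0" "\<And>s. \<bar>s\<bar> < d \<Longrightarrow> v + s *\<^sub>R T \<in> V" using shift_tendsto by blast
      define s where "s = d / 2"
      have s: "s > 0" "\<bar>s\<bar> < d" using d(1) by (auto simp: s_def)
      have "0 \<le> 2 * s * \<tau> v" "s * s * G x0 T T < 0" "s * G x0 T T < 0"
        using s v' Tt by (auto simp: mult_pos_neg)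
      then have "v + s *\<^sub>R T \<in> I0" using v' by (simp add: I0_def G0_shift tau_shift)
      then show "I0 \<inter> S \<noteq> {}" using d(2)[OF s(2)] \<open>V \<subseteq> S\<close> by blast
    qed
  qed
qed

text \<open>Subtracting a small multiple of \<open>T\<close> from a null vector, or from 0, leads
  out of the closed cone. Together with \<open>closure_I0\<close> this gives both cones the same
  frontier.\<close>

lemma interior_J0: "interior J0 = I0"
proof
  show "I0 \<subseteq> interior J0" by (rule interior_maximal[OF I0_subset_J0 I0_open])
  show "interior J0 \<subseteq> I0"
  proof
    fix v assume "v \<in> interior J0"
    then obtain d where d: "d > 0" "\<And>s. \<bar>s\<bar> < d \<Longrightarrow> v + s *\<^sub>R T \<in> interior J0"
      using shift_tendsto[OF open_interior] by blast
    have Tt: "G x0 T T < 0" by (rule T_timelike[OF x0_in(2)])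
    have v: "v \<in> J0" using \<open>v \<in> interior J0\<close> interior_subset by blast
    show "v \<in> I0"
    proof (rule ccontr)
      assume nI: "v \<notin> I0"
      \<comment> \<open>For \<open>v \<noteq> 0\<close> this bound on the shift keeps the negative
        quadratic term of \<open>G0_shift\<close> below the positive linear term
        \<open>- 2 * s * \<tau> v\<close> in size.\<close>
      define e where "e = (if v = 0 then d else \<tau> v / - G x0 T T)"
      have e: "e > 0" using v d(1) Tt by (auto simp: e_def J0_def divide_pos_neg)
      define s where "s = - min (d / 2) e"
      have s: "s < 0" "\<bar>s\<bar> < d" "- s \<le> e" using d(1) e by (auto simp: s_def)
      have J: "v + s *\<^sub>R T \<in> J0" using d(2)[OF s(2)] interior_subset by blast
      show False
      proof (cases "v = 0")
        case True
        have "0 < s * G x0 T T" using s Tt by (simp add: mult_neg_neg)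
        moreover have "0 \<le> \<tau> (v + s *\<^sub>R T)"
          using J linear_0[OF tau_linear] by (auto simp: J0_def)
        ultimately show False using True linear_0[OF tau_linear] by (simp add: tau_shift[of 0, simplified] tau_shift)
      next
        case False
        then have v': "G x0 v v = 0" "0 < \<tau> v" using v nI by (auto simp: J0_def I0_def)
        have "- s * (- G x0 T T) \<le> \<tau> v" using s(3) False Tt by (simp add: e_def field_simps)
        then have "- s * (s * G x0 T T) \<le> - s * \<tau> v" using s(1) by (intro mult_left_mono) auto
        then have "0 < G x0 (v + s *\<^sub>R T) (v + s *\<^sub>R T)"
          using mult_neg_pos[OF s(1) v'(2)] v'(1) by (simp add: G0_shift mult_ac)
        moreover have "G x0 (v + s *\<^sub>R T) (v + s *\<^sub>R T) \<le> 0"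
          using J bilinear_lzero[OF G_bilinear[OF x0_in(1)]] by (auto simp: J0_def)
        ultimately show False by simp
      qed
    qed
  qed
qed

lemma frontier_I0: "frontier I0 = J0 - I0" and frontier_J0: "frontier J0 = J0 - I0"
  using closure_I0 interior_J0 J0_closed I0_open by (auto simp: frontier_def interior_open)

end

section \<open>Time orientation in charts and uniform cones\<close>

locale lorentz_spacetime = lorentz_manifold A g
  for A :: "('m::{t2_space, second_countable_topology}, 'e::euclidean_space) chart set" and g :: "('m, 'e) metric" +
  fixes X :: "'m \<Rightarrow> ('m, 'e) tvec"
  assumes orient: "time_orientation A g X"
begin

lemma X_timelike:
  assumes c: "c \<in> A" and x: "x \<in> snd c ` fst c"
  shows "G c x (X (chart_inv c x) c) (X (chart_inv c x) c) < 0"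
proof -
  let ?q = "chart_inv c x"
  have q: "c \<in> charts_at A ?q" using chart_inv_in[OF c x] c by (simp add: charts_at_iff)
  have "X ?q \<in> tangent_space A ?q" "g ?q (X ?q) (X ?q) < 0"
    using orient by (auto simp: time_orientation_def timelike_def)
  then show ?thesis using metric_eq_G[OF q, of "X ?q" "X ?q"] chart_inv_right[OF c x] by simp
qed

lemma future_directed_iff:
  assumes c: "c \<in> charts_at A q" and v: "v \<in> tangent_space A q"
  shows "future_directed g X q v \<longleftrightarrow> G c (snd c q) (X q c) (v c) < 0"
  using metric_eq_G[OF c _ v, of "X q"] orient by (auto simp: future_directed_def time_orientation_def)

lemma local_cone_exists:
  assumes c: "c \<in> A" and x0: "x0 \<in> snd c ` fst c" and RK: "cball x0 R \<subseteq> snd c ` fst c"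
    and lg: "local_geodesic x0 R K (\<lambda>x u. \<Gamma> c x u u) (G c) (DG c)"
  defines "T \<equiv> X (chart_inv c x0) c"
  obtains \<kappa> r where "local_cone x0 R K (\<lambda>x u. \<Gamma> c x u u) (G c) (DG c) T \<kappa> r"
    "\<And>x w. x \<in> cball x0 r \<Longrightarrow> G c x w w \<le> 0 \<Longrightarrow> w \<noteq> 0 \<Longrightarrow> G c x (X (chart_inv c x) c) w < 0 \<longleftrightarrow> G c x T w < 0"
proof -
  interpret LG: local_geodesic x0 R K "\<lambda>x u. \<Gamma> c x u u" "G c" "DG c" by (rule lg)
  define \<xi> where "\<xi> x = X (chart_inv c x) c" for x
  define s where "s = - G c x0 T T"
  have s: "s > 0" using X_timelike[OF c x0] by (simp add: s_def T_def)
  obtain m where m: "m > 0" "\<And>w. m * (norm w)\<^sup>2 \<le> G c x0 w w - 2 / G c x0 T T * (G c x0 T w)\<^sup>2"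
    using lorentz_form_coercive[OF G_lorentz[OF c x0], of T] s by (auto simp: s_def)
  have m': "m * (norm w)\<^sup>2 \<le> G c x0 w w + 2 / s * (G c x0 T w)\<^sup>2" for w
    using m(2)[of w] by (simp add: s_def)
  \<comment> \<open>For a causal \<open>w\<close> near \<open>x0\<close> half of the coercivity
    constant survives, so (m/2) |w|^2 \<le> (2/s) G(T, w)^2, where m s / 4 is the square of
    \<kappa>.\<close>
  define \<kappa> where "\<kappa> = sqrt (m * s) / 2"
  have \<kappa>: "\<kappa> > 0" "\<kappa>\<^sup>2 = m * s / 4" using m s by (auto simp: \<kappa>_def power_divide)
  define L where "L = K * (1 + 2 * R)"
  have L: "L > 0" using LG.K LG.R by (auto simp: L_def intro!: mult_pos_pos add_pos_pos)
  have K: "K \<ge> 1" and R: "R > 0" using LG.K LG.R by auto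
  have \<xi>c: "continuous_on (snd c ` fst c) \<xi>"
    unfolding \<xi>_def using orient c
    by (intro continuous_on_compose2[OF _ continuous_on_chart_inv[OF c], of "fst c" "\<lambda>q. X q c"])
      (auto simp: time_orientation_def chart_inv_left[OF c])
  then have "isCont \<xi> x0" using open_chart_image[OF c] x0 continuous_on_eq_continuous_at by blast
  moreover have "\<kappa> / (4 * K) > 0" using \<kappa> K by simp
  ultimately obtain d where d: "d > 0" "\<And>x. dist x x0 < d \<Longrightarrow> dist (\<xi> x) (\<xi> x0) < \<kappa> / (4 * K)"
    unfolding continuous_at_eps_delta by blast
  define n where "n = norm T + 1"
  have n: "norm T \<le> n" "0 < n" by (auto simp: n_def add_nonneg_pos)
  \<comment> \<open>The last three entries bound the variation of the metric by (m/2) |w|^2 on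
    squares, by s/2 on the square of \<open>T\<close>, and by (\<kappa>/4) |w| on pairings with
    \<open>T\<close>. This \<kappa>/4 and another \<kappa>/4 for the variation of \<open>X\<close>
    cannot change a sign that has margin \<kappa>.\<close>
  define r where "r = min (min R (d / 2)) (min (m / (2 * L)) (min (s / (2 * L * n\<^sup>2)) (\<kappa> / (4 * L * n))))"
  have rle: "r \<le> R" "r \<le> d / 2" "r \<le> m / (2 * L)" "r \<le> s / (2 * L * n\<^sup>2)" "r \<le> \<kappa> / (4 * L * n)"
    unfolding r_def by (simp_all only: min_le_iff_disj order_refl simp_thms)
  have r: "r > 0" using R d(1) m(1) s \<kappa>(1) L n by (simp add: r_def)
  have Lr: "L * r \<le> m / 2" "L * r * n\<^sup>2 \<le> s / 2" "L * r * n \<le> \<kappa> / 4"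
    using rle(3-5) L n by (auto simp: field_simps)
  have inR: "x \<in> cball x0 R" and in\<Omega>: "x \<in> snd c ` fst c" and nx: "norm (x - x0) \<le> r" if "x \<in> cball x0 r" for x
    using that rle(1) RK by (auto simp: dist_norm norm_minus_commute)
  have x0R: "x0 \<in> cball x0 R" using R by simp
  have GL: "\<bar>G c x u w - G c x0 u w\<bar> \<le> L * r * norm u * norm w" if x: "x \<in> cball x0 r" for x u w
  proof -
    have "\<bar>G c x u w - G c x0 u w\<bar> \<le> L * norm (x - x0) * norm u * norm w"
      using LG.G_lipschitz[OF x0R inR[OF x]] by (simp add: L_def)
    also have "\<dots> \<le> L * r * norm u * norm w" using nx[OF x] L by (intro mult_right_mono mult_left_mono) auto
    finally show ?thesis .
  qed
  have cone: "\<kappa> * norm w \<le> \<bar>G c x0 T w\<bar>" if x: "x \<in> cball x0 r" and w: "G c x w w \<le> 0" for x w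
  proof -
    have "\<bar>G c x w w - G c x0 w w\<bar> \<le> L * r * (norm w)\<^sup>2"
      using GL[OF x, of w w] by (simp add: power2_eq_square mult.assoc)
    also have "\<dots> \<le> m / 2 * (norm w)\<^sup>2" using Lr(1) by (rule mult_right_mono) simp
    finally have "\<bar>G c x w w - G c x0 w w\<bar> \<le> m / 2 * (norm w)\<^sup>2" .
    then have "m / 2 * (norm w)\<^sup>2 \<le> 2 / s * (G c x0 T w)\<^sup>2" using m'[of w] w by linarith
    then have "(\<kappa> * norm w)\<^sup>2 \<le> \<bar>G c x0 T w\<bar>\<^sup>2" using s by (simp add: power_mult_distrib \<kappa>(2) field_simps)
    then show ?thesis by (rule power2_le_imp_le) simp
  qed
  have Tsmall: "\<bar>G c x T w - G c x0 T w\<bar> \<le> \<kappa> / 4 * norm w" if x: "x \<in> cball x0 r" for x w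
  proof -
    have "\<bar>G c x T w - G c x0 T w\<bar> \<le> L * r * norm T * norm w" by (rule GL[OF x])
    also have "\<dots> \<le> L * r * n * norm w" using n L r by (intro mult_right_mono mult_left_mono) auto
    also have "\<dots> \<le> \<kappa> / 4 * norm w" using Lr(3) by (intro mult_right_mono) auto
    finally show ?thesis .
  qed
  have sign1: "G c x T w < 0 \<longleftrightarrow> G c x0 T w < 0"
    if x: "x \<in> cball x0 r" and w: "G c x w w \<le> 0" "w \<noteq> 0" for x w
  proof -
    have "0 < \<kappa> * norm w" using \<kappa> w by simp
    then show ?thesis using cone[OF x w(1)] Tsmall[OF x, of w] by (auto simp: abs_if split: if_splits)
  qed
  have sign2: "G c x (\<xi> x) w < 0 \<longleftrightarrow> G c x0 T w < 0"
    if x: "x \<in> cball x0 r" and w: "G c x w w \<le> 0" "w \<noteq> 0" for x w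
  proof -
    have "dist x x0 < d" using x rle(2) d(1) by (simp add: dist_commute)
    then have "norm (\<xi> x - T) \<le> \<kappa> / (4 * K)" using d(2)[of x] by (simp add: dist_norm \<xi>_def T_def)
    then have "K * norm (\<xi> x - T) * norm w \<le> K * (\<kappa> / (4 * K)) * norm w"
      using K by (intro mult_right_mono mult_left_mono) auto
    then have "\<bar>G c x (\<xi> x - T) w\<bar> \<le> \<kappa> / 4 * norm w"
      using LG.G_bound[OF inR[OF x], of "\<xi> x - T" w] K by simp
    moreover have "G c x (\<xi> x) w = G c x (\<xi> x - T) w + G c x T w"
      by (simp add: bilinear_lsub[OF G_bilinear[OF c in\<Omega>[OF x]]])
    moreover have "0 < \<kappa> * norm w" using \<kappa> w by simp
    ultimately show ?thesis using cone[OF x w(1)] Tsmall[OF x, of w] by (auto simp: abs_if split: if_splits)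
  qed
  show thesis
  proof (rule that[of \<kappa> r])
    show "local_cone x0 R K (\<lambda>x u. \<Gamma> c x u u) (G c) (DG c) T \<kappa> r"
    proof (intro local_cone.intro lg local_cone_axioms.intro)
      fix x w assume x: "x \<in> cball x0 r"
      show "lorentz_form (G c x)" by (rule G_lorentz[OF c in\<Omega>[OF x]])
      have "\<bar>G c x T T - G c x0 T T\<bar> \<le> L * r * norm T * norm T" by (rule GL[OF x])
      also have "\<dots> \<le> L * r * n * n" using n L r by (intro mult_mono) auto
      also have "\<dots> \<le> s / 2" using Lr(2) by (simp add: power2_eq_square mult.assoc)
      finally show "G c x T T < 0" using s by (simp add: s_def abs_if split: if_splits)
      assume w: "G c x w w \<le> 0"
      show "\<kappa> * norm w \<le> \<bar>G c x0 T w\<bar>" by (rule cone[OF x w])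
      assume "w \<noteq> 0"
      then show "G c x T w < 0 \<longleftrightarrow> G c x0 T w < 0" by (rule sign1[OF x w])
    qed (use r rle \<kappa> in auto)
  qed (use sign1 sign2 in \<open>simp add: \<xi>_def\<close>)
qed

end

text \<open>A finite subcover provides one constant that is valid near every point, and along an
  interval local estimates with a common constant chain together.\<close>

lemma locally_lipschitz_Icc_imp_lipschitz:
  fixes f :: "real \<Rightarrow> 'a::metric_space"
  assumes loc: "\<And>t. t \<in> {a..b} \<Longrightarrow> \<exists>e>0. \<exists>L. L-lipschitz_on ({a..b} \<inter> ball t e) f"
  obtains L where "L-lipschitz_on {a..b} f"
proof -
  have "\<forall>t\<in>{a..b}. \<exists>q. fst q > 0 \<and> (snd q)-lipschitz_on ({a..b} \<inter> ball t (fst q)) f"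
    using loc by (metis fst_conv snd_conv)
  then obtain q where q: "\<forall>t\<in>{a..b}. fst (q t) > 0 \<and> (snd (q t))-lipschitz_on ({a..b} \<inter> ball t (fst (q t))) f"
    using bchoice by metis
  define e where "e t = fst (q t)" for t
  define L where "L t = snd (q t)" for t
  have eL: "\<And>t. t \<in> {a..b} \<Longrightarrow> e t > 0" "\<And>t. t \<in> {a..b} \<Longrightarrow> (L t)-lipschitz_on ({a..b} \<inter> ball t (e t)) f"
    using q by (auto simp: e_def L_def)
  have "\<exists>F\<subseteq>{a..b}. finite F \<and> {a..b} \<subseteq> (\<Union>t\<in>F. ball t (e t))"
    by (rule compactE_image[OF compact_Icc[of a b], of "{a..b}" "\<lambda>t. ball t (e t)"]) (use eL(1) in auto)
  then obtain F where F: "F \<subseteq> {a..b}" "finite F" "{a..b} \<subseteq> (\<Union>t\<in>F. ball t (e t))" by blast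
  define M where "M = (\<Sum>t\<in>F. L t)"
  have L0: "0 \<le> L t" if "t \<in> F" for t by (rule lipschitz_on_nonneg[OF eL(2)[OF subsetD[OF F(1) that]]])
  have LM: "L t \<le> M" if "t \<in> F" for t
    unfolding M_def using that F(2) L0 by (intro member_le_sum) auto
  have lipM: "M-lipschitz_on ({a..b} \<inter> ball t (e t)) f" if "t \<in> F" for t
    by (rule lipschitz_on_mono[OF eL(2)[OF subsetD[OF F(1) that]] order_refl LM[OF that]])
  have "M-lipschitz_on {a..b} f"
  proof (rule locally_lipschitz_imp_lipschitz)
    show "M \<ge> 0" unfolding M_def by (rule sum_nonneg) (rule L0)
    have near: "\<exists>d>0. \<exists>t\<in>F. ball x d \<subseteq> ball t (e t)" if xab: "x \<in> {a..b}" for x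
    proof -
      obtain t where "t \<in> F" "x \<in> ball t (e t)" using subsetD[OF F(3) xab] by blast
      then show ?thesis using open_contains_ball[of "ball t (e t)"] by blast
    qed
    show "continuous_on {a..b} f"
      unfolding continuous_on_eq_continuous_within
    proof
      fix x assume x: "x \<in> {a..b}"
      then obtain d t where d: "d > 0" "t \<in> F" "ball x d \<subseteq> ball t (e t)" using near by blast
      have "continuous_on ({a..b} \<inter> ball x d) f"
        by (rule continuous_on_subset[OF lipschitz_on_continuous_on[OF lipM[OF d(2)]]]) (use d(3) in blast)
      then have "continuous (at x within ({a..b} \<inter> ball x d)) f"
        using x d(1) by (simp add: continuous_on_eq_continuous_within)
      then show "continuous (at x within {a..b}) f"
        using at_within_nhd[of x "ball x d" "{a..b}" "{a..b} \<inter> ball x d"] d(1) by auto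
    qed
    fix x y assume x: "x \<in> {a..<b}" "x < y"
    then obtain d t where d: "d > 0" "t \<in> F" "ball x d \<subseteq> ball t (e t)" using near[of x] by auto
    define z where "z = min (min y b) (x + d / 2)"
    have z: "x < z" "z \<le> y" "z \<le> b" "z - x < d" using x d(1) by (auto simp: z_def)
    have "x \<in> {a..b} \<inter> ball t (e t)" "z \<in> {a..b} \<inter> ball t (e t)"
      using x z d(1) subsetD[OF d(3), of x] subsetD[OF d(3), of z] by (auto simp: dist_real_def)
    then have "dist (f z) (f x) \<le> M * dist z x" by (intro lipschitz_onD[OF lipM[OF d(2)]])
    then show "\<exists>z\<in>{x<..y}. dist (f z) (f x) \<le> M * (z - x)"
      using z by (intro bexI[of _ z]) (auto simp: dist_real_def)
  qed
  then show thesis by (rule that)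
qed

section \<open>Rescaling of geodesics\<close>

context lorentz_manifold
begin

lemma spray_homogeneous:
  assumes c: "c \<in> A" and x: "x \<in> snd c ` fst c"
  shows "\<Gamma> c x (t *\<^sub>R u) (t *\<^sub>R u) = (t * t) *\<^sub>R \<Gamma> c x u u"
proof (rule spray_unique[OF c x, symmetric])
  fix w
  note bD = DG_bilinear[OF c x] and lD = DG_linear[OF c x]
  show "G c x ((t * t) *\<^sub>R \<Gamma> c x u u) w = DG c x (t *\<^sub>R u) (t *\<^sub>R u) w - DG c x w (t *\<^sub>R u) (t *\<^sub>R u) / 2"
    by (simp add: spray_eq[OF c x] linear_scale[OF lD] bilinear_lmul[OF G_bilinear[OF c x]] bilinear_lmul[OF bD]
        bilinear_rmul[OF bD] algebra_simps)
qed

text \<open>The spray is quadratic, so the geodesic run at speed \<open>t\<close> and the geodesic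
  with initial velocity \<open>t *\<^sub>R v\<close> solve the same initial value problem. Radial
  geodesics thereby stay in the image of a ball under \<open>E\<close>.\<close>

lemma traj_scale:
  assumes c: "c \<in> A" and R: "cball x0 R \<subseteq> snd c ` fst c"
    and lg: "local_geodesic x0 R K (\<lambda>x u. \<Gamma> c x u u) (G c) (DG c)"
    and v: "norm v \<le> local_spray.\<rho> R K" and t: "t \<in> {0..1}"
  shows "local_spray.traj x0 (\<lambda>x u. \<Gamma> c x u u) v t = local_spray.E x0 (\<lambda>x u. \<Gamma> c x u u) (t *\<^sub>R v)"
proof -
  interpret LG: local_geodesic x0 R K "\<lambda>x u. \<Gamma> c x u u" "G c" "DG c" by (rule lg)
  have tv: "norm (t *\<^sub>R v) \<le> LG.\<rho>"
    using v t mult_mono[of "\<bar>t\<bar>" 1 "norm v" LG.\<rho>] by auto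
  let ?H = "\<lambda>(x, u). (u, - \<Gamma> c x u u)"
  define z1 where "z1 s = (LG.traj v (t * s), t *\<^sub>R LG.vel v (t * s))" for s
  define z2 where "z2 s = (LG.traj (t *\<^sub>R v) s, LG.vel (t *\<^sub>R v) s)" for s
  have in\<Omega>: "LG.traj v s \<in> snd c ` fst c" if "s \<in> {0..1}" for s
    using LG.traj_in_cball[OF v that] R by blast
  have img: "(\<lambda>s. t * s) ` {0..1} \<subseteq> {0..1}" using t by (auto simp: mult_le_one)
  have chain: "((\<lambda>s. f (t * s)) has_vector_derivative t *\<^sub>R f') (at s within {0..1})"
    if "(f has_vector_derivative f') (at (t * s) within {0..1})" for f :: "real \<Rightarrow> 'e" and f' s
  proof -
    have "((\<lambda>s. t * s) has_vector_derivative t) (at s within {0..1})"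
      by (auto intro!: derivative_eq_intros)
    from vector_diff_chain_within[OF this has_vector_derivative_within_subset[OF that img]]
    show ?thesis by (simp add: comp_def)
  qed
  have "z1 1 = z2 1"
  proof (rule ode_unique[OF spray_field_locally_lipschitz[OF c] open_Times[OF open_chart_image[OF c] open_UNIV], where a=0 and b=1])
    fix s :: real assume s: "s \<in> {0..1}"
    have ts: "t * s \<in> {0..1}" using img s by blast
    have "(z1 has_vector_derivative (t *\<^sub>R LG.vel v (t * s), t *\<^sub>R (t *\<^sub>R (- \<Gamma> c (LG.traj v (t * s)) (LG.vel v (t * s)) (LG.vel v (t * s)))))) (at s within {0..1})"
      unfolding z1_def
      by (intro has_vector_derivative_Pair chain[OF LG.traj_deriv[OF v ts]]
          bounded_linear.has_vector_derivative[OF bounded_linear_scaleR_right] chain[OF LG.vel_deriv[OF v ts]])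
    then show "(z1 has_vector_derivative ?H (z1 s)) (at s within {0..1})"
      by (simp add: z1_def spray_homogeneous[OF c in\<Omega>[OF ts]])
    show "(z2 has_vector_derivative ?H (z2 s)) (at s within {0..1})"
      unfolding z2_def using LG.traj_deriv[OF tv s] LG.vel_deriv[OF tv s] by (auto intro: has_vector_derivative_Pair)
    show "z1 s \<in> snd c ` fst c \<times> UNIV" using in\<Omega>[OF ts] by (simp add: z1_def)
  next
    show "z1 0 = z2 0"
      by (simp add: z1_def z2_def LG.traj_0[OF v] LG.traj_0[OF tv] LG.vel_0[OF v] LG.vel_0[OF tv])
  qed simp
  then show ?thesis by (simp add: z1_def z2_def LG.E_def)
qed

end

section \<open>Normal neighbourhoods\<close>

text \<open>The radius \<epsilon> remains free below \<open>LC.\<delta>\<close>; shrinking it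
  produces a basis of neighbourhoods. Through \<open>future_sign\<close> the fixed vector
  \<open>X p c\<close> stands in for the field \<open>X\<close>.\<close>

locale normal_chart = lorentz_spacetime A g X +
  LC: local_cone "snd c p" R K "\<lambda>x u. christoffel A g c x u u" "local_metric A g c" "metric_deriv A g c" "X p c" \<kappa> r
  for A :: "('m::{t2_space, second_countable_topology}, 'e::euclidean_space) chart set"
    and g :: "('m, 'e) metric" and X :: "'m \<Rightarrow> ('m, 'e) tvec"
    and p :: 'm and c :: "('m, 'e) chart" and R K \<kappa> r :: real +
  fixes \<epsilon> :: real
  assumes c_at: "c \<in> charts_at A p"
    and R_chart: "cball (snd c p) R \<subseteq> snd c ` fst c"
    and future_sign: "x \<in> cball (snd c p) r \<Longrightarrow> local_metric A g c x w w \<le> 0 \<Longrightarrow> w \<noteq> 0 \<Longrightarrow>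
      local_metric A g c x (X (chart_inv c x) c) w < 0 \<longleftrightarrow> local_metric A g c x (X p c) w < 0"
    and eps: "0 < \<epsilon>" "\<epsilon> \<le> LC.\<delta>"
begin

abbreviation x0 where "x0 \<equiv> snd c p"

definition V :: "('m, 'e) tvec set" where "V = {v\<in>tangent_space A p. norm (v c) < \<epsilon>}"
definition \<Omega> :: "'e set" where "\<Omega> = LC.E ` ball 0 \<epsilon>"
definition U :: "'m set" where "U = chart_inv c ` \<Omega>"

lemma chart_p: "c \<in> A" "p \<in> fst c"
  using c_at by (auto simp: charts_at_iff)

lemma eps_rho: "\<epsilon> \<le> LC.\<rho>"
  using eps LC.delta by linarith

lemma r_chart: "x \<in> cball x0 r \<Longrightarrow> x \<in> snd c ` fst c"
  using R_chart LC.r by auto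

lemma \<Omega>_small: "\<Omega> \<subseteq> cball x0 (3/2 * \<epsilon>)"
proof
  fix x assume "x \<in> \<Omega>"
  then obtain v where v: "norm v < \<epsilon>" "x = LC.traj v 1" by (auto simp: \<Omega>_def LC.E_def)
  have "norm (LC.traj v 1 - x0) \<le> 3/2 * norm v * 1" using v eps_rho by (intro LC.traj_near) auto
  then show "x \<in> cball x0 (3/2 * \<epsilon>)" using v by (simp add: dist_norm norm_minus_commute)
qed

lemma eps_r: "3/2 * \<epsilon> \<le> r"
  using eps LC.delta by linarith

lemma \<Omega>_r: "x \<in> \<Omega> \<Longrightarrow> x \<in> cball x0 r"
  using subsetD[OF \<Omega>_small, of x] eps_r by simp

lemma \<Omega>_chart: "\<Omega> \<subseteq> snd c ` fst c"
  using \<Omega>_r r_chart by blast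

text \<open>Evaluation at \<open>c\<close> is continuous for pointwise convergence, and its inverse
  is linear in every coordinate. Topological statements about cones in the tangent space are
  transferred to the coordinate space this way.\<close>

lemma tangent_homeomorphism: "homeomorphism UNIV (tangent_space A p) (tvec_of A c p) (\<lambda>v. v c)"
proof (rule homeomorphismI)
  show "continuous_on UNIV (tvec_of A c p)"
  proof (rule continuous_on_coordinatewise_then_product)
    fix c'
    show "continuous_on UNIV (\<lambda>e. tvec_of A c p e c')"
    proof (cases "c' \<in> charts_at A p")
      case True
      have "linear (dtrans c c' x0)"
        using True chart_p by (intro dtrans_linear overlapI) (auto simp: charts_at_iff)
      then have "continuous_on UNIV (dtrans c c' x0)"
        using linear_continuous_on linear_conv_bounded_linear by blast
      then show ?thesis using True by (simp add: tvec_of_def transition_deriv_eq)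
    qed (simp add: tvec_of_def)
  qed
  show "continuous_on (tangent_space A p) (\<lambda>v. v c)"
    by (rule continuous_on_subset[OF continuous_on_product_coordinates]) simp
  show "tvec_of A c p ` UNIV \<subseteq> tangent_space A p" using tvec_of_tangent[OF c_at] by blast
qed (auto simp: tvec_of_coord[OF c_at] tvec_of_tangent_coord[OF c_at])

lemma V_eq: "V = tvec_of A c p ` ball 0 \<epsilon>"
proof (intro equalityI subsetI)
  fix v assume "v \<in> V"
  then show "v \<in> tvec_of A c p ` ball 0 \<epsilon>"
    using tvec_of_tangent_coord[OF c_at, of v] by (intro image_eqI[of _ _ "v c"]) (auto simp: V_def)
qed (auto simp: V_def tvec_of_tangent[OF c_at] tvec_of_coord[OF c_at])

lemma V_subset: "V \<subseteq> tangent_space A p"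
  by (auto simp: V_def)

lemma traj_chart: "norm v \<le> LC.\<rho> \<Longrightarrow> t \<in> {0..1} \<Longrightarrow> LC.traj v t \<in> snd c ` fst c"
  using LC.traj_in_cball R_chart by blast

lemma traj_velocity:
  assumes v: "norm v \<le> LC.\<rho>" and t: "t \<in> {0..1}"
  shows "((snd c \<circ> (chart_inv c \<circ> LC.traj v)) has_vector_derivative LC.vel v t) (at t within {0..1})"
  by (rule has_vector_derivative_transform[OF t _ LC.traj_deriv[OF v t]])
    (simp add: chart_inv_right[OF chart_p(1) traj_chart[OF v]])

lemma geodesic_from_traj:
  assumes v: "v \<in> tangent_space A p" "norm (v c) \<le> LC.\<rho>"
  shows "geodesic_from A g p v (chart_inv c \<circ> LC.traj (v c))"
  unfolding geodesic_from_def
proof (intro conjI)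
  show geo: "geodesic_on A g {0..1} (chart_inv c \<circ> LC.traj (v c))"
    by (rule geodesic_on_chart_inv[OF chart_p(1) _ LC.traj_deriv[OF v(2)] LC.vel_deriv[OF v(2)]])
      (use traj_chart[OF v(2)] in auto)
  show 0: "(chart_inv c \<circ> LC.traj (v c)) 0 = p"
    by (simp add: LC.traj_0[OF v(2)] chart_inv_left[OF chart_p])
  have "has_velocity A {0..1} (chart_inv c \<circ> LC.traj (v c)) (tvec_of A c ((chart_inv c \<circ> LC.traj (v c)) 0) (LC.vel (v c) 0)) 0"
    by (rule has_velocity_tvec_of[OF _ _ _ traj_velocity[OF v(2)]]) (use geo c_at 0 in \<open>auto simp: geodesic_on_def\<close>)
  then show "has_velocity A {0..1} (chart_inv c \<circ> LC.traj (v c)) v 0"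
    unfolding 0 LC.vel_0[OF v(2)] tvec_of_tangent_coord[OF c_at v(1)] .
qed

lemma exp_map_coord:
  assumes "v \<in> tangent_space A p" "norm (v c) \<le> LC.\<rho>"
  shows "exp_map A g p v = chart_inv c (LC.E (v c))"
  using exp_map_eq[OF geodesic_from_traj[OF assms]] by (simp add: LC.E_def)

lemma exp_map_image:
  assumes "S \<subseteq> ball 0 \<epsilon>" shows "exp_map A g p ` (tvec_of A c p ` S) = (chart_inv c \<circ> LC.E) ` S"
  unfolding image_image
proof (rule image_cong[OF refl])
  fix v assume "v \<in> S"
  then have "norm v \<le> LC.\<rho>" using assms eps_rho by fastforce
  then show "exp_map A g p (tvec_of A c p v) = (chart_inv c \<circ> LC.E) v"
    using exp_map_coord[OF tvec_of_tangent[OF c_at], of v] by (simp add: tvec_of_coord[OF c_at])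
qed

lemma exp_map_V: "exp_map A g p ` V = U"
  unfolding V_eq exp_map_image[OF order_refl] by (simp add: U_def \<Omega>_def image_comp)

lemma chart_homeomorphism: obtains h where "homeomorphism (ball 0 \<epsilon>) U (chart_inv c \<circ> LC.E) h"
proof -
  obtain E' where E': "homeomorphism (ball 0 \<epsilon>) \<Omega> LC.E E'"
    using LC.E_homeomorphism[OF eps_rho] unfolding \<Omega>_def by blast
  have "homeomorphism \<Omega> U (chart_inv c) (snd c)"
    unfolding U_def
    by (rule homeomorphism_of_subsets[OF homeomorphism_symD[OF chart_hom[OF chart_p(1)]] \<Omega>_chart _ refl])
      (use \<Omega>_chart chart_inv_in[OF chart_p(1)] in auto)
  from homeomorphism_compose[OF E' this] show thesis by (rule that)
qed

lemma exp_homeomorphism: obtains h where "homeomorphism V U (exp_map A g p) h"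
proof -
  obtain h where h: "homeomorphism (ball 0 \<epsilon>) U (chart_inv c \<circ> LC.E) h" by (rule chart_homeomorphism)
  have "homeomorphism V (ball 0 \<epsilon>) (\<lambda>v. v c) (tvec_of A c p)"
    by (rule homeomorphism_of_subsets[OF homeomorphism_symD[OF tangent_homeomorphism] V_subset])
      (auto simp: V_eq tvec_of_coord[OF c_at] image_image)
  from homeomorphism_compose[OF this h]
  have "homeomorphism V U (chart_inv c \<circ> LC.E \<circ> (\<lambda>v. v c)) (tvec_of A c p \<circ> h)" .
  then have "homeomorphism V U (exp_map A g p) (tvec_of A c p \<circ> h)"
    by (rule homeomorphism_cong) (use eps_rho in \<open>auto simp: V_def exp_map_coord\<close>)
  then show thesis by (rule that)
qed

lemma U_open: "open U"
  unfolding U_def by (rule open_chart_inv_image[OF chart_p(1) _ \<Omega>_chart]) (simp add: \<Omega>_def LC.E_open_image[OF eps_rho])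

lemma zero_tangent: "(\<lambda>c. 0) \<in> tangent_space A p"
  using tvec_of_tangent[OF c_at, of 0] tvec_of_eq_zero_iff[OF c_at, of 0] by simp

lemma scale_tangent:
  assumes v: "v \<in> tangent_space A p" shows "(\<lambda>c. t *\<^sub>R v c) \<in> tangent_space A p"
proof -
  have "t *\<^sub>R v c' = transition_deriv c'' c' p (t *\<^sub>R v c'')" if "c' \<in> charts_at A p" "c'' \<in> charts_at A p" for c' c''
  proof -
    have "linear (dtrans c'' c' (snd c'' p))"
      using that by (intro dtrans_linear overlapI) (auto simp: charts_at_iff)
    moreover have "v c' = transition_deriv c'' c' p (v c'')" using v that unfolding tangent_space_def by blast
    ultimately show ?thesis by (simp add: transition_deriv_eq linear_scale)
  qed
  moreover have "t *\<^sub>R v c' = 0" if "c' \<notin> charts_at A p" for c'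
  proof -
    have "v c' = 0" using v that unfolding tangent_space_def by blast
    then show ?thesis by simp
  qed
  ultimately show ?thesis unfolding tangent_space_def by blast
qed

lemma normal_neighbourhood_U: "normal_neighbourhood A g p V U"
  unfolding normal_neighbourhood_def
proof (intro conjI U_open)
  have zV: "(\<lambda>c. 0) \<in> V" using zero_tangent eps by (simp add: V_def)
  have "exp_map A g p (\<lambda>c. 0) = p"
    using exp_map_coord[OF zero_tangent] LC.rho(1) by (simp add: LC.E_0 chart_inv_left[OF chart_p])
  then show "p \<in> U" using exp_map_V zV by force
  have "V = tangent_space A p \<inter> (\<lambda>v. v c) -` ball 0 \<epsilon>" by (auto simp: V_def)
  then show "openin (top_of_set (tangent_space A p)) V"
    using continuous_openin_preimage_gen[OF homeomorphism_cont2[OF tangent_homeomorphism], of "ball 0 \<epsilon>"] by simp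
  show "star_shaped_0 V"
    unfolding star_shaped_0_def
  proof (intro conjI ballI zV)
    fix v t assume v: "v \<in> V" and t: "t \<in> {0..1::real}"
    have "\<bar>t\<bar> * norm (v c) \<le> 1 * norm (v c)" using t by (intro mult_right_mono) auto
    then show "(\<lambda>c. t *\<^sub>R v c) \<in> V" using v scale_tangent by (auto simp: V_def)
  qed
  show "V \<subseteq> exp_domain A g p"
  proof
    fix v assume "v \<in> V"
    then have "v \<in> tangent_space A p" "norm (v c) \<le> LC.\<rho>" using eps_rho by (auto simp: V_def)
    then show "v \<in> exp_domain A g p" using geodesic_from_traj unfolding exp_domain_def by blast
  qed
  show "\<exists>h. homeomorphism V U (exp_map A g p) h" using exp_homeomorphism by blast
  show "bi_lipschitz_into A p V (exp_map A g p)"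
    unfolding bi_lipschitz_into_def
  proof (intro bexI[OF _ c_at] conjI)
    have cK: "cball x0 (3/2 * \<epsilon>) \<subseteq> snd c ` fst c" using r_chart eps_r by (auto intro: r_chart)
    \<comment> \<open>A compact subset of the chart domain that contains the image, hence also its
      closure.\<close>
    let ?C = "chart_inv c ` cball x0 (3/2 * \<epsilon>)"
    have "compact ?C"
      by (rule compact_continuous_image[OF continuous_on_subset[OF continuous_on_chart_inv[OF chart_p(1)] cK] compact_cball])
    moreover have "exp_map A g p ` V \<subseteq> ?C" unfolding exp_map_V U_def using \<Omega>_small by blast
    ultimately have sub: "closure (exp_map A g p ` V) \<subseteq> ?C" 
      by (intro closure_minimal compact_imp_closed)
    then show "compact (closure (exp_map A g p ` V))"
      using \<open>compact ?C\<close> compact_Int_closed[OF \<open>compact ?C\<close> closed_closure] by (metis inf.absorb_iff2)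
    show "closure (exp_map A g p ` V) \<subseteq> fst c"
      using sub cK chart_inv_in[OF chart_p(1)] by blast
    show "\<exists>L>0. \<forall>v\<in>V. \<forall>w\<in>V.
        dist (snd c (exp_map A g p v)) (snd c (exp_map A g p w)) \<le> L * dist (v c) (w c) \<and>
        dist (v c) (w c) \<le> L * dist (snd c (exp_map A g p v)) (snd c (exp_map A g p w))"
    proof (intro exI[of _ 2] conjI ballI)
      fix v w assume vw: "v \<in> V" "w \<in> V"
      have e: "snd c (exp_map A g p v) = LC.E (v c)" if "v \<in> V" for v
      proof -
        have "LC.E (v c) \<in> \<Omega>" using that by (auto simp: \<Omega>_def V_def)
        then show ?thesis using exp_map_coord[of v] chart_inv_right[OF chart_p(1)] \<Omega>_chart eps_rho that by (auto simp: V_def)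
      qed
      have n: "norm (v c) \<le> LC.\<rho>" "norm (w c) \<le> LC.\<rho>" using vw eps_rho by (auto simp: V_def)
      show "dist (snd c (exp_map A g p v)) (snd c (exp_map A g p w)) \<le> 2 * dist (v c) (w c)"
        "dist (v c) (w c) \<le> 2 * dist (snd c (exp_map A g p v)) (snd c (exp_map A g p w))"
        using LC.E_bilipschitz[OF n] by (auto simp: e vw dist_norm)
    qed simp
  qed
qed

lemma metric_at_p: "v \<in> tangent_space A p \<Longrightarrow> g p v v = G c x0 (v c) (v c)"
  by (rule metric_eq_G[OF c_at])

lemma I_plus_0_eq: "I_plus_0 A g X p = tvec_of A c p ` LC.I0"
proof (intro equalityI subsetI)
  fix v assume "v \<in> I_plus_0 A g X p"
  then have v: "v \<in> tangent_space A p" "g p v v < 0" "future_directed g X p v"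
    by (auto simp: I_plus_0_def timelike_def)
  then have "v c \<in> LC.I0"
    using metric_at_p future_directed_iff[OF c_at v(1)] by (auto simp: LC.I0_def LC.\<tau>_def)
  then show "v \<in> tvec_of A c p ` LC.I0" using tvec_of_tangent_coord[OF c_at v(1)] by (metis image_eqI)
next
  fix v assume "v \<in> tvec_of A c p ` LC.I0"
  then obtain e where e: "e \<in> LC.I0" "v = tvec_of A c p e" by blast
  have v: "v \<in> tangent_space A p" "v c = e" using e tvec_of_tangent[OF c_at] tvec_of_coord[OF c_at] by auto
  have "e \<noteq> 0" using e(1) linear_0[OF LC.tau_linear] by (auto simp: LC.I0_def)
  then show "v \<in> I_plus_0 A g X p"
    using e v metric_at_p[OF v(1)] future_directed_iff[OF c_at v(1)] tvec_of_eq_zero_iff[OF c_at, of e]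
    by (auto simp: I_plus_0_def timelike_def LC.I0_def LC.\<tau>_def)
qed

lemma J_plus_0_eq: "J_plus_0 A g X p = tvec_of A c p ` LC.J0"
proof (intro equalityI subsetI)
  fix v assume v: "v \<in> J_plus_0 A g X p"
  then have vt: "v \<in> tangent_space A p" using zero_tangent by (auto simp: J_plus_0_def)
  have "v c \<in> LC.J0"
    using v metric_at_p[OF vt] future_directed_iff[OF c_at vt] by (auto simp: J_plus_0_def causal_def LC.J0_def LC.\<tau>_def)
  then show "v \<in> tvec_of A c p ` LC.J0" using tvec_of_tangent_coord[OF c_at vt] by (metis image_eqI)
next
  fix v assume "v \<in> tvec_of A c p ` LC.J0"
  then obtain e where e: "e \<in> LC.J0" "v = tvec_of A c p e" by blast
  have v: "v \<in> tangent_space A p" "v c = e" using e tvec_of_tangent[OF c_at] tvec_of_coord[OF c_at] by auto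
  then show "v \<in> J_plus_0 A g X p"
    using e metric_at_p[OF v(1)] future_directed_iff[OF c_at v(1)] tvec_of_eq_zero_iff[OF c_at, of e]
    by (auto simp: J_plus_0_def causal_def LC.J0_def LC.\<tau>_def)
qed

lemma exp_map_cone:
  "exp_map A g p ` (tvec_of A c p ` S \<inter> V) = (chart_inv c \<circ> LC.E) ` (S \<inter> ball 0 \<epsilon>)"
proof -
  have "inj (tvec_of A c p)" using tvec_of_coord[OF c_at] by (metis injI)
  then have "tvec_of A c p ` S \<inter> V = tvec_of A c p ` (S \<inter> ball 0 \<epsilon>)"
    unfolding V_eq by (rule image_Int[symmetric])
  then show ?thesis using exp_map_image[of "S \<inter> ball 0 \<epsilon>"] by simp
qed

text \<open>A homeomorphism onto \<open>U\<close> carries relative frontiers to relative frontiers,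
  and relative to the open ball these are traces of ordinary ones.\<close>

lemma frontier_relative:
  "top_of_set U frontier_of ((chart_inv c \<circ> LC.E) ` (S \<inter> ball 0 \<epsilon>)) = (chart_inv c \<circ> LC.E) ` (frontier S \<inter> ball 0 \<epsilon>)"
proof -
  let ?\<psi> = "chart_inv c \<circ> LC.E"
  obtain h where h: "homeomorphism (ball 0 \<epsilon>) U ?\<psi> h" by (rule chart_homeomorphism)
  then have hm: "homeomorphic_map (top_of_set (ball 0 \<epsilon>)) (top_of_set U) ?\<psi>"
    unfolding homeomorphic_map_maps homeomorphic_maps_def homeomorphism_def
    by (intro exI[of _ h]) auto
  have "top_of_set (ball 0 \<epsilon>) frontier_of (S \<inter> ball 0 \<epsilon>) = ball 0 \<epsilon> \<inter> frontier S"
  proof -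
    have "top_of_set (ball 0 \<epsilon>) frontier_of (S \<inter> ball 0 \<epsilon>) = top_of_set (ball 0 \<epsilon>) frontier_of S"
      by (subst (2) frontier_of_restrict) (simp add: Int_commute)
    also have "\<dots> = ball 0 \<epsilon> \<inter> euclidean frontier_of S"
      by (rule frontier_of_subtopology_open) simp
    finally show ?thesis by simp
  qed
  then show ?thesis using homeomorphic_map_frontier_of[OF hm, of "S \<inter> ball 0 \<epsilon>"] by (simp add: Int_commute)
qed

lemma frontier_tangent:
  "top_of_set (tangent_space A p) frontier_of (tvec_of A c p ` S) = tvec_of A c p ` frontier S"
proof -
  have "homeomorphic_map euclidean (top_of_set (tangent_space A p)) (tvec_of A c p)"
    using tangent_homeomorphism unfolding homeomorphic_map_maps homeomorphic_maps_def homeomorphism_def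
    by (intro exI[of _ "\<lambda>v. v c"]) (auto simp: continuous_map_in_subtopology)
  from homeomorphic_map_frontier_of[OF this, of S] show ?thesis by simp
qed

end

section \<open>Causal curves inside a normal neighbourhood\<close>

context normal_chart
begin

text \<open>The curve is read in the chart and lifted through the inverse of \<open>E\<close>. Its
  coordinate derivatives are velocities by \<open>has_velocity_tvec_of\<close>, so the causality
  assumptions reach the estimates \<open>LC.lift_causal\<close> and
  \<open>LC.lift_timelike\<close>.\<close>

lemma future_causal_curve_lift:
  assumes ab: "a < b" and causal: "causal_curve A g {a..b} \<gamma>" and future: "future_directed_curve A g X {a..b} \<gamma>"
    and \<gamma>U: "\<gamma> ` {a..b} \<subseteq> U" and start: "\<gamma> a = p"
  shows "\<gamma> b \<in> (chart_inv c \<circ> LC.E) ` (LC.J0 \<inter> ball 0 \<epsilon>)"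
    and "timelike_curve A g {a..b} \<gamma> \<Longrightarrow> \<gamma> b \<in> (chart_inv c \<circ> LC.E) ` (LC.I0 \<inter> ball 0 \<epsilon>)"
proof -
  define x where "x t = snd c (\<gamma> t)" for t
  define \<beta> where "\<beta> t = inv_into (ball 0 \<epsilon>) LC.E (x t)" for t
  have x: "x t \<in> \<Omega>" "chart_inv c (x t) = \<gamma> t" "c \<in> charts_at A (\<gamma> t)" if "t \<in> {a..b}" for t
  proof -
    have "\<gamma> t \<in> U" using \<gamma>U \<open>t \<in> {a..b}\<close> by blast
    then obtain y where y: "y \<in> \<Omega>" "\<gamma> t = chart_inv c y" unfolding U_def by blast
    have yc: "y \<in> snd c ` fst c" using y(1) \<Omega>_chart by blast
    have xy: "x t = y" by (simp add: x_def y(2) chart_inv_right[OF chart_p(1) yc])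
    show "x t \<in> \<Omega>" "chart_inv c (x t) = \<gamma> t" "c \<in> charts_at A (\<gamma> t)"
      using xy y chart_p(1) chart_inv_in[OF chart_p(1) yc] by (auto simp: charts_at_iff)
  qed
  have \<beta>: "norm (\<beta> t) < \<epsilon>" "LC.E (\<beta> t) = x t" if "t \<in> {a..b}" for t
    using inv_into_into[of "x t" LC.E "ball 0 \<epsilon>"] f_inv_into_f[of "x t" LC.E "ball 0 \<epsilon>"] x(1)[OF that]
    by (auto simp: \<beta>_def \<Omega>_def)
  have lip: "locally_lipschitz_curve A {a..b} \<gamma>" using causal by (simp add: causal_curve_def)
  have cont: "continuous_on {a..b} \<gamma>" by (rule lipschitz_curve_continuous[OF lip])
  have "\<exists>e>0. \<exists>L. L-lipschitz_on ({a..b} \<inter> ball t e) x" if t: "t \<in> {a..b}" for t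
  proof -
    have "x = snd c \<circ> \<gamma>" by (auto simp: x_def)
    then show ?thesis
      using lip[unfolded locally_lipschitz_curve_def, rule_format, OF t x(3)[OF t]] by blast
  qed
  then obtain \<Lambda> where \<Lambda>: "\<Lambda>-lipschitz_on {a..b} x" by (rule locally_lipschitz_Icc_imp_lipschitz)
  have \<Lambda>0: "0 \<le> \<Lambda>" by (rule lipschitz_on_nonneg[OF \<Lambda>])
  \<comment> \<open>The inverse of \<open>E\<close> at most doubles the constant, and the lift
    estimates ask for one constant for both the curve and its lift.\<close>
  have lip_x: "(2 * \<Lambda>)-lipschitz_on {a..b} x"
    by (rule lipschitz_on_mono[OF \<Lambda> order_refl]) (use \<Lambda>0 in simp)
  have lip_\<beta>: "(2 * \<Lambda>)-lipschitz_on {a..b} \<beta>"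
  proof (rule lipschitz_onI)
    fix s t assume st: "s \<in> {a..b}" "t \<in> {a..b}"
    have "norm (\<beta> s) \<le> LC.\<rho>" "norm (\<beta> t) \<le> LC.\<rho>" using \<beta>(1)[OF st(1)] \<beta>(1)[OF st(2)] eps_rho by auto
    then have "norm (\<beta> s - \<beta> t) \<le> 2 * norm (x s - x t)"
      using LC.E_bilipschitz(2)[of "\<beta> s" "\<beta> t"] unfolding \<beta>(2)[OF st(1)] \<beta>(2)[OF st(2)] by blast
    also have "\<dots> \<le> 2 * (\<Lambda> * dist s t)" using lipschitz_onD[OF \<Lambda> st] by (simp add: dist_norm)
    finally show "dist (\<beta> s) (\<beta> t) \<le> 2 * \<Lambda> * dist s t" by (simp add: dist_norm)
  qed (use \<Lambda>0 in simp)
  have vel: "\<exists>v. has_velocity A {a..b} \<gamma> v t \<and> v \<in> tangent_space A (\<gamma> t) \<and> v c = w"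
    if t: "a < t" "t < b" "(x has_vector_derivative w) (at t)" for t w
  proof -
    have ti: "t \<in> {a..b}" using t by simp
    have "x = snd c \<circ> \<gamma>" by (auto simp: x_def)
    then have "((snd c \<circ> \<gamma>) has_vector_derivative w) (at t within {a..b})"
      using t(3) has_vector_derivative_at_within by blast
    from has_velocity_tvec_of[OF cont ti x(3)[OF ti] this]
    show ?thesis using tvec_of_tangent[OF x(3)[OF ti]] tvec_of_coord[OF x(3)[OF ti]] by blast
  qed
  have causal': "G c (x t) w w \<le> 0 \<and> G c (x t) (X p c) w < 0"
    if t: "a < t" "t < b" "(x has_vector_derivative w) (at t)" for t w
  proof -
    have ti: "t \<in> {a..b}" using t by simp
    obtain v where v: "has_velocity A {a..b} \<gamma> v t" "v \<in> tangent_space A (\<gamma> t)" "v c = w" using vel[OF t] by blast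
    have "g (\<gamma> t) v v \<le> 0" "future_directed g X (\<gamma> t) v"
      using causal future v(1) ti by (auto simp: causal_curve_def causal_def future_directed_curve_def)
    then have 1: "G c (x t) w w \<le> 0" "G c (x t) (X (chart_inv c (x t)) c) w < 0"
      using metric_eq_G[OF x(3)[OF ti] v(2,2)] future_directed_iff[OF x(3)[OF ti] v(2)] x(2)[OF ti]
      by (auto simp: v(3) x_def)
    have "w \<noteq> 0"
      using 1(2) bilinear_rzero[OF G_bilinear[OF chart_p(1)]] x(1)[OF ti] \<Omega>_chart by force
    then show ?thesis using future_sign[OF \<Omega>_r[OF x(1)[OF ti]] 1(1)] 1 by simp
  qed
  have bi: "b \<in> {a..b}" "a \<in> {a..b}" using ab by auto
  have small: "norm (\<beta> t) \<le> LC.\<delta>" if "t \<in> {a..b}" for t using \<beta>(1)[OF that] eps by simp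
  have x\<beta>: "x t = LC.traj (\<beta> t) 1" if "t \<in> {a..b}" for t using \<beta>(2)[OF that] by (simp add: LC.E_def)
  have \<beta>a: "\<beta> a = 0"
  proof (rule inj_onD[OF LC.E_inj])
    show "LC.E (\<beta> a) = LC.E 0" using \<beta>(2)[OF bi(2)] start by (simp add: LC.E_0 x_def)
  qed (use \<beta>(1)[OF bi(2)] eps_rho LC.rho(1) in auto)
  have J: "G c x0 (\<beta> b) (\<beta> b) \<le> 0" "0 < LC.\<tau> (\<beta> b)"
    by (rule LC.lift_causal[OF ab lip_x lip_\<beta> small x\<beta> \<beta>a causal' ab order_refl]; assumption)+
  have \<gamma>b: "\<gamma> b = (chart_inv c \<circ> LC.E) (\<beta> b)" using \<beta>(2)[OF bi(1)] x(2)[OF bi(1)] by simp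
  show "\<gamma> b \<in> (chart_inv c \<circ> LC.E) ` (LC.J0 \<inter> ball 0 \<epsilon>)"
    unfolding \<gamma>b by (rule imageI) (use J \<beta>(1)[OF bi(1)] in \<open>auto simp: LC.J0_def\<close>)
  assume tl: "timelike_curve A g {a..b} \<gamma>"
  have timelike': "G c (x t) w w < 0" if t: "a < t" "t < b" "(x has_vector_derivative w) (at t)" for t w
  proof -
    have ti: "t \<in> {a..b}" using t by simp
    obtain v where v: "has_velocity A {a..b} \<gamma> v t" "v \<in> tangent_space A (\<gamma> t)" "v c = w" using vel[OF t] by blast
    have "g (\<gamma> t) v v < 0" using tl v(1) ti by (auto simp: timelike_curve_def timelike_def)
    then show ?thesis using metric_eq_G[OF x(3)[OF ti] v(2,2)] by (simp add: v(3) x_def)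
  qed
  have I: "G c x0 (\<beta> b) (\<beta> b) < 0"
    by (rule LC.lift_timelike[OF ab lip_x lip_\<beta> small x\<beta> \<beta>a causal' timelike']; assumption)
  show "\<gamma> b \<in> (chart_inv c \<circ> LC.E) ` (LC.I0 \<inter> ball 0 \<epsilon>)"
    unfolding \<gamma>b by (rule imageI) (use I J \<beta>(1)[OF bi(1)] in \<open>auto simp: LC.I0_def\<close>)
qed

text \<open>This yields the converse inclusions: the radial geodesic to an end point in the cone is
  an admissible curve, and \<open>traj_scale\<close> keeps it inside \<open>U\<close>. The zero
  vector is excluded because its geodesic is constant.\<close>

lemma radial_curve:
  assumes v: "v \<in> LC.J0" "v \<noteq> 0" "norm v < \<epsilon>"
  defines "\<gamma> \<equiv> chart_inv c \<circ> LC.traj v"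
  shows "\<gamma> ` {0..1} \<subseteq> U" "\<gamma> 0 = p" "\<gamma> 1 = (chart_inv c \<circ> LC.E) v"
    and "causal_curve A g {0..1} \<gamma>" "future_directed_curve A g X {0..1} \<gamma>"
    and "v \<in> LC.I0 \<Longrightarrow> timelike_curve A g {0..1} \<gamma>"
proof -
  have v\<rho>: "norm v \<le> LC.\<rho>" and v\<delta>: "norm v \<le> LC.\<delta>" using v eps_rho eps by auto
  have geo: "geodesic_from A g p (tvec_of A c p v) \<gamma>"
    using geodesic_from_traj[OF tvec_of_tangent[OF c_at, of v]] v\<rho> by (simp add: tvec_of_coord[OF c_at] \<gamma>_def)
  then show "\<gamma> 0 = p" by (simp add: geodesic_from_def)
  show "\<gamma> 1 = (chart_inv c \<circ> LC.E) v" by (simp add: \<gamma>_def LC.E_def)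
  have lg: "local_geodesic x0 R K (\<lambda>x u. \<Gamma> c x u u) (G c) (DG c)" by (rule LC.local_geodesic_axioms)
  have tr: "LC.traj v t = LC.E (t *\<^sub>R v)" if "t \<in> {0..1}" for t
    by (rule traj_scale[OF chart_p(1) R_chart lg v\<rho> that])
  have in\<Omega>: "LC.traj v t \<in> \<Omega>" if t: "t \<in> {0..1}" for t
  proof -
    have "\<bar>t\<bar> * norm v \<le> 1 * norm v" using t by (intro mult_right_mono) auto
    then show ?thesis using v(3) unfolding tr[OF t] \<Omega>_def by (intro imageI) simp
  qed
  then show "\<gamma> ` {0..1} \<subseteq> U" by (auto simp: \<gamma>_def U_def)
  have ll: "locally_lipschitz_curve A {0..1} \<gamma>"
    using geodesic_locally_lipschitz geo by (simp add: geodesic_from_def)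
  have Jv: "G c x0 v v \<le> 0" "0 < LC.\<tau> v" using v by (auto simp: LC.J0_def)
  have velo: "w \<noteq> (\<lambda>c. 0) \<and> g (\<gamma> t) w w = G c x0 v v \<and> future_directed g X (\<gamma> t) w"
    if t: "t \<in> {0..1}" and w: "has_velocity A {0..1} \<gamma> w t" for t w
  proof -
    let ?x = "LC.traj v t" and ?u = "LC.vel v t"
    have xi: "?x \<in> snd c ` fst c" by (rule traj_chart[OF v\<rho> t])
    have ca: "c \<in> charts_at A (\<gamma> t)" using chart_p(1) chart_inv_in[OF chart_p(1) xi] by (simp add: charts_at_iff \<gamma>_def)
    have sx: "snd c (\<gamma> t) = ?x" by (simp add: \<gamma>_def chart_inv_right[OF chart_p(1) xi])
    have wt: "w \<in> tangent_space A (\<gamma> t)" using w by (simp add: has_velocity_def)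
    have wc: "w c = ?u"
      by (rule velocity_unique[OF zero_less_one t w ca]) (use traj_velocity[OF v\<rho> t] in \<open>simp only: \<gamma>_def\<close>)
    note rad = LC.radial_geodesic_causal[OF v\<delta> Jv t]
    have u0: "?u \<noteq> 0" using rad(2) bilinear_rzero[OF G_bilinear[OF chart_p(1) xi]] by auto
    have xr: "?x \<in> cball x0 r" by (rule LC.traj_in_small_cball[OF v\<delta> t])
    have "G c ?x (X (chart_inv c ?x) c) ?u < 0"
      using future_sign[OF xr _ u0] rad Jv(1) by simp
    then have "future_directed g X (\<gamma> t) w"
      using future_directed_iff[OF ca wt] by (simp add: sx wc) (simp add: \<gamma>_def)
    moreover have "g (\<gamma> t) w w = G c x0 v v"
      using metric_eq_G[OF ca wt wt] rad(1) by (simp add: sx wc)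
    moreover have "w \<noteq> (\<lambda>c. 0)" using wc u0 by auto
    ultimately show ?thesis by blast
  qed
  show "causal_curve A g {0..1} \<gamma>" "future_directed_curve A g X {0..1} \<gamma>"
    using ll velo Jv(1) by (auto simp: causal_curve_def causal_def future_directed_curve_def)
  assume "v \<in> LC.I0"
  then have "G c x0 v v < 0" by (simp add: LC.I0_def)
  then show "timelike_curve A g {0..1} \<gamma>"
    using ll velo by (auto simp: timelike_curve_def timelike_def)
qed

lemma I_plus_eq: "I_plus A g X p U = (chart_inv c \<circ> LC.E) ` (LC.I0 \<inter> ball 0 \<epsilon>)"
proof (intro equalityI subsetI)
  fix q assume "q \<in> I_plus A g X p U"
  then obtain \<gamma> a b where \<gamma>: "a < b" "timelike_curve A g {a..b} \<gamma>" "future_directed_curve A g X {a..b} \<gamma>"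
    "\<gamma> ` {a..b} \<subseteq> U" "\<gamma> a = p" "\<gamma> b = q"
    unfolding I_plus_def by blast
  have "causal_curve A g {a..b} \<gamma>"
    using \<gamma>(2) by (force simp: timelike_curve_def causal_curve_def timelike_def causal_def)
  then show "q \<in> (chart_inv c \<circ> LC.E) ` (LC.I0 \<inter> ball 0 \<epsilon>)"
    using future_causal_curve_lift(2)[OF \<gamma>(1) _ \<gamma>(3-5,2)] \<gamma>(6) by simp
next
  fix q assume "q \<in> (chart_inv c \<circ> LC.E) ` (LC.I0 \<inter> ball 0 \<epsilon>)"
  then obtain v where v: "v \<in> LC.I0" "norm v < \<epsilon>" "q = (chart_inv c \<circ> LC.E) v" by auto
  have vJ: "v \<in> LC.J0" "v \<noteq> 0"
    using v(1) LC.I0_subset_J0 linear_0[OF LC.tau_linear] by (auto simp: LC.I0_def)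
  note rc = radial_curve[OF vJ v(2)]
  have "q \<in> U" using subsetD[OF rc(1) imageI[of 1]] rc(3) v(3) by simp
  then show "q \<in> I_plus A g X p U"
    unfolding I_plus_def using rc(1-3,5) rc(6)[OF v(1)] v(3) zero_less_one[where 'a=real] by blast
qed

lemma J_plus_eq: "J_plus A g X p U = (chart_inv c \<circ> LC.E) ` (LC.J0 \<inter> ball 0 \<epsilon>)"
proof (intro equalityI subsetI)
  fix q assume q: "q \<in> J_plus A g X p U"
  show "q \<in> (chart_inv c \<circ> LC.E) ` (LC.J0 \<inter> ball 0 \<epsilon>)"
  \<comment> \<open>The point \<open>p\<close> belongs to the causal future by convention and
    corresponds to the vertex of the cone.\<close>
  proof (cases "q = p")
    case True
    then show ?thesis
      using eps(1) by (intro image_eqI[of _ _ 0]) (auto simp: LC.J0_def LC.E_0 chart_inv_left[OF chart_p])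
  next
    case False
    then obtain \<gamma> a b where \<gamma>: "a < b" "causal_curve A g {a..b} \<gamma>" "future_directed_curve A g X {a..b} \<gamma>"
      "\<gamma> ` {a..b} \<subseteq> U" "\<gamma> a = p" "\<gamma> b = q"
      using q unfolding J_plus_def by blast
    then show ?thesis using future_causal_curve_lift(1)[OF \<gamma>(1-5)] by simp
  qed
next
  fix q assume "q \<in> (chart_inv c \<circ> LC.E) ` (LC.J0 \<inter> ball 0 \<epsilon>)"
  then obtain v where v: "v \<in> LC.J0" "norm v < \<epsilon>" "q = (chart_inv c \<circ> LC.E) v" by auto
  show "q \<in> J_plus A g X p U"
  proof (cases "v = 0")
    case True
    then show ?thesis using v(3) by (simp add: J_plus_def LC.E_0 chart_inv_left[OF chart_p])
  next
    case False
    note rc = radial_curve[OF v(1) False v(2)]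
    have "q \<in> U" using subsetD[OF rc(1) imageI[of 1]] rc(3) v(3) by simp
    then show ?thesis
      unfolding J_plus_def using rc(1-5) v(3) zero_less_one[where 'a=real] by blast
  qed
qed

lemma causal_structure:
  shows "I_plus A g X p U = exp_map A g p ` (I_plus_0 A g X p \<inter> V)"
    and "J_plus A g X p U = exp_map A g p ` (J_plus_0 A g X p \<inter> V)"
    and "top_of_set U frontier_of I_plus A g X p U = top_of_set U frontier_of J_plus A g X p U"
    and "top_of_set U frontier_of J_plus A g X p U =
      exp_map A g p ` ((top_of_set (tangent_space A p) frontier_of I_plus_0 A g X p) \<inter> V)"
    and "openin (top_of_set U) (I_plus A g X p U)"
    and "closedin (top_of_set U) (J_plus A g X p U)"
proof -
  let ?\<psi> = "chart_inv c \<circ> LC.E"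
  show "I_plus A g X p U = exp_map A g p ` (I_plus_0 A g X p \<inter> V)"
    unfolding I_plus_eq I_plus_0_eq exp_map_cone ..
  show "J_plus A g X p U = exp_map A g p ` (J_plus_0 A g X p \<inter> V)"
    unfolding J_plus_eq J_plus_0_eq exp_map_cone ..
  show "top_of_set U frontier_of I_plus A g X p U = top_of_set U frontier_of J_plus A g X p U"
    unfolding I_plus_eq J_plus_eq frontier_relative LC.frontier_I0 LC.frontier_J0 ..
  show "top_of_set U frontier_of J_plus A g X p U =
      exp_map A g p ` ((top_of_set (tangent_space A p) frontier_of I_plus_0 A g X p) \<inter> V)"
    unfolding J_plus_eq I_plus_0_eq frontier_relative frontier_tangent exp_map_cone LC.frontier_I0 LC.frontier_J0 ..
  obtain h where h: "homeomorphism (ball 0 \<epsilon>) U ?\<psi> h" by (rule chart_homeomorphism)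
  show "openin (top_of_set U) (I_plus A g X p U)"
    unfolding I_plus_eq
    by (rule homeomorphism_imp_open_map[OF h]) (use openin_open_Int[OF LC.I0_open, of "ball 0 \<epsilon>"] in \<open>simp add: Int_commute\<close>)
  show "closedin (top_of_set U) (J_plus A g X p U)"
    unfolding J_plus_eq
    by (rule homeomorphism_imp_closed_map[OF h]) (use closedin_closed_Int[OF LC.J0_closed, of "ball 0 \<epsilon>"] in \<open>simp add: Int_commute\<close>)
qed

end

theorem theorem3p9:
  fixes A :: "('m::{t2_space, second_countable_topology}, 'e::euclidean_space) chart set"
    and g :: "('m, 'e) metric"
    and X :: "'m \<Rightarrow> ('m, 'e) tvec"
    and p :: 'm
  assumes "smooth_atlas A"
    and "C11_lorentz_metric A g"
    and "time_orientation A g X"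
  shows "\<forall>W. open W \<and> p \<in> W \<longrightarrow> (\<exists>U V.
    U \<subseteq> W \<and> normal_neighbourhood A g p V U \<and>
    I_plus A g X p U = exp_map A g p ` (I_plus_0 A g X p \<inter> V) \<and>
    J_plus A g X p U = exp_map A g p ` (J_plus_0 A g X p \<inter> V) \<and>
    top_of_set U frontier_of I_plus A g X p U = top_of_set U frontier_of J_plus A g X p U \<and>
    top_of_set U frontier_of J_plus A g X p U =
      exp_map A g p ` ((top_of_set (tangent_space A p) frontier_of I_plus_0 A g X p) \<inter> V) \<and>
    openin (top_of_set U) (I_plus A g X p U) \<and>
    closedin (top_of_set U) (J_plus A g X p U))"
proof (intro allI impI)
  fix W assume W: "open W \<and> p \<in> W"
  interpret lorentz_spacetime A g X
    by (intro lorentz_spacetime.intro lorentz_manifold.intro lorentz_spacetime_axioms.intro assms)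
  obtain c where c: "c \<in> A" "p \<in> fst c" by (rule chart_around)
  then have x0: "snd c p \<in> snd c ` fst c" by blast
  obtain R K where RK: "cball (snd c p) R \<subseteq> snd c ` fst c"
    "local_geodesic (snd c p) R K (\<lambda>x u. \<Gamma> c x u u) (G c) (DG c)"
    using local_geodesic_exists[OF c(1) x0] .
  obtain \<kappa> r where LC: "local_cone (snd c p) R K (\<lambda>x u. \<Gamma> c x u u) (G c) (DG c) (X p c) \<kappa> r"
    and sign: "\<And>x w. x \<in> cball (snd c p) r \<Longrightarrow> G c x w w \<le> 0 \<Longrightarrow> w \<noteq> 0 \<Longrightarrow>
      G c x (X (chart_inv c x) c) w < 0 \<longleftrightarrow> G c x (X p c) w < 0"
    using local_cone_exists[OF c(1) x0 RK] unfolding chart_inv_left[OF c] by blast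
  interpret LC: local_cone "snd c p" R K "\<lambda>x u. \<Gamma> c x u u" "G c" "DG c" "X p c" \<kappa> r by (rule LC)
  have "open (snd c ` (W \<inter> fst c))"
    using W by (intro open_chart_image_subset[OF c(1)] open_Int open_chart_dom[OF c(1)]) auto
  moreover have "snd c p \<in> snd c ` (W \<inter> fst c)" using W c by blast
  ultimately obtain d where d: "d > 0" "cball (snd c p) d \<subseteq> snd c ` (W \<inter> fst c)"
    using open_contains_cball by blast
  \<comment> \<open>The coordinate image of the neighbourhood lies in the closed ball of radius
    (3/2) \<epsilon>, which thus fits into the ball of radius \<open>d\<close> inside
    \<open>W\<close>.\<close>
  define \<epsilon> where "\<epsilon> = min LC.\<delta> (2/3 * d)"
  have eps: "0 < \<epsilon>" "\<epsilon> \<le> LC.\<delta>" "3/2 * \<epsilon> \<le> d" using LC.delta(1) d(1) by (auto simp: \<epsilon>_def min_def)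
  interpret N: normal_chart A g X p c R K \<kappa> r \<epsilon>
    by unfold_locales (use c RK(1) sign eps in \<open>auto simp: charts_at_iff\<close>)
  have "N.U \<subseteq> W"
  proof
    fix q assume "q \<in> N.U"
    then obtain x where x: "x \<in> N.\<Omega>" "q = chart_inv c x" by (auto simp: N.U_def)
    have "x \<in> cball (snd c p) d" using subsetD[OF N.\<Omega>_small x(1)] eps(3) by simp
    then obtain q' where "q' \<in> W" "q' \<in> fst c" "x = snd c q'" using d(2) by blast
    then show "q \<in> W" using x(2) chart_inv_left[OF c(1)] by simp
  qed
  then show "\<exists>U V. U \<subseteq> W \<and> normal_neighbourhood A g p V U \<and>
    I_plus A g X p U = exp_map A g p ` (I_plus_0 A g X p \<inter> V) \<and>
    J_plus A g X p U = exp_map A g p ` (J_plus_0 A g X p \<inter> V) \<and>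
    top_of_set U frontier_of I_plus A g X p U = top_of_set U frontier_of J_plus A g X p U \<and>
    top_of_set U frontier_of J_plus A g X p U =
      exp_map A g p ` ((top_of_set (tangent_space A p) frontier_of I_plus_0 A g X p) \<inter> V) \<and>
    openin (top_of_set U) (I_plus A g X p U) \<and>
    closedin (top_of_set U) (J_plus A g X p U)"
    by (intro exI[of _ N.U] exI[of _ N.V] conjI N.normal_neighbourhood_U N.causal_structure)
qed

end
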